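(* Let $X$ be a Banach space and $D\subset X^*$ a norming subspace. The following assertions are equivalent. (1) $D$ is induced by a projectional skeleton in $X$. (2) There is an $\omega$-monotone mapping $\psi:[D\cup X]^{\le\omega}\to[D\cup X]^{\le\omega}$ such that for any $A\in[D\cup X]^{\le\omega}$: (i) $A\subset\psi(A)$; (ii) $\overline{\psi(A)\cap D}^{w^*}\subset D$; (iii) $\overline{\psi(A)\cap D}^{w^*}$ is a linear space; (iv) the mapping $x^*\mapsto x^*|_{\overline{\operatorname{span}}(\psi(A)\cap X)}$ is a bijection of $\overline{\psi(A)\cap D}^{w^*}$ onto $(\overline{\operatorname{span}}(\psi(A)\cap X))^*$. (3) There is an $\omega$-monotone mapping $\theta:[X]^{\le\omega}\to[D\cup X]^{\le\omega}$ such that $D=\bigcup\{\overline{\theta(A)\cap D}^{w^*}:A\in[X]^{\le\omega}\}$ and for any $A\in[X]^{\le\omega}$: (i) $A\subset\theta(A)$; (ii) $\overline{\theta(A)\cap D}^{w^*}$ is a linear space; (iii) the mapping $x^*\mapsto x^*|_{\overline{\operatorname{span}}(\theta(A)\cap X)}$ is a bijection of $\overline{\theta(A)\cap D}^{w^*}$ onto $(\overline{\operatorname{span}}(\theta(A)\cap X))^*$. (4) $D$ is weak$^*$-countably closed and $(X,\sigma(X,D))$ is monotonically Sokolov. (5) $D$ is weak$^*$-countably closed and there is $M\subset X$ such that $\overline{\operatorname{span}}M=X$ and $(M,\sigma(X,D))$ is monotonically Sokolov. (6) $D$ is weak$^*$-countably closed and $(X,\sigma(X,D))$ is a continuous image of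 a monotonically Sokolov space.
   Context: Banach spaces are real or complex. $X$ and $X^*$ are regarded as disjoint sets. A subspace $D\subset X^*$ is norming if there is $C\ge1$ with $\|x\|\le C\sup\{|x^*(x)|:x^*\in D,\|x^*\|\le1\}$ for all $x\in X$. $\sigma(X,D)$ is the weakest topology on $X$ making all functionals from $D$ continuous. $D$ is weak$^*$-countably closed if the weak$^*$-closure of each countable subset of $D$ is contained in $D$. A projectional skeleton on $X$ is a family $(P_s)_{s\in\Gamma}$ of bounded linear projections on $X$ indexed by an up-directed partially ordered set $\Gamma$ such that: (i) $P_sX$ is separable; (ii) $P_sP_t=P_tP_s=P_s$ whenever $s\le t$; (iii) if $(s_n)$ is an increasing (non-decreasing) sequence in $\Gamma$, then $s=\sup_ns_n$ exists in $\Gamma$ and $P_sX=\overline{\bigcup_nP_{s_n}X}$; (iv) $X=\bigcup_sP_sX$. The subspace of $X^*$ induced by it is $\bigcup_{s\in\Gamma}P_s^*X^*$. $[M]^{\le\omega}$ is the family of all countable (including finite) subsets of $M$. A mapping $\varphi:[M_1]^{\le\omega}\to[M_2]^{\le\omega}$ is $\omega$-monotone if $A\subset B$ implies $\varphi(A)\subset\varphi(B)$, and $\varphi(\bigcup_nA_n)=\bigcup_n\varphi(A_n)$ for every increasing sequence $(A_n)$. A topological space $T$ is monotonically Sokolov if there is an assignment $\mathcal A\mapsto(r_{\mathcal A},\mathcal N(\mathcal A))$, $\mathcal A\in[\mathcal F(T)]^{\le\omega}$, where $\mathcal F(T)$ is the family of nonempty closed subsets of $T$, such that for each $\mathcal A$: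 $r_{\mathcal A}$ is a continuous retraction on $T$ with $r_{\mathcal A}(F)\subset F$ for $F\in\mathcal A$; $\mathcal N(\mathcal A)$ is a countable outer network of $r_{\mathcal A}(T)$ (i.e. a countable family of subsets of $T$ such that for any open $U\subset T$ and any $x\in U\cap r_{\mathcal A}(T)$ there is $N\in\mathcal N(\mathcal A)$ with $x\in N\subset U$); and the mapping $\mathcal N$ is $\omega$-monotone. *)

theory Defs
  imports "HOL-Analysis.Analysis"
begin

text \<open>
  Scalars. Banach spaces are real or complex, so the scalar field is a type of the following class,
  whose members are (up to isometric isomorphism) exactly the real and the complex numbers.
\<close>

class real_or_complex = real_normed_field +
  assumes real_or_complex:
    "(\<forall>z. \<exists>a. z = a *\<^sub>R 1) \<or>
     (\<exists>i. i * i = - 1 \<and> (\<forall>z. \<exists>a b. z = a *\<^sub>R 1 + b *\<^sub>R i) \<and>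
          (\<forall>a b. norm (a *\<^sub>R 1 + b *\<^sub>R i) = sqrt (a\<^sup>2 + b\<^sup>2)))"

instance real :: real_or_complex
  by standard (auto intro: exI[of _ "_ :: real"])

instance complex :: real_or_complex
proof
  have "\<i> * \<i> = - 1 \<and> (\<forall>z. \<exists>a b. z = a *\<^sub>R 1 + b *\<^sub>R \<i>) \<and>
        (\<forall>a b. norm (a *\<^sub>R 1 + b *\<^sub>R \<i>) = sqrt (a\<^sup>2 + b\<^sup>2))"
  proof (intro conjI allI)
    fix z show "\<exists>a b. z = a *\<^sub>R 1 + b *\<^sub>R \<i>"
      by (rule exI[of _ "Re z"], rule exI[of _ "Im z"]) (simp add: complex_eq_iff)
  qed (simp_all add: cmod_def)
  then show "(\<forall>z::complex. \<exists>a. z = a *\<^sub>R 1) \<or>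
     (\<exists>i::complex. i * i = - 1 \<and> (\<forall>z. \<exists>a b. z = a *\<^sub>R 1 + b *\<^sub>R i) \<and>
          (\<forall>a b. norm (a *\<^sub>R 1 + b *\<^sub>R i) = sqrt (a\<^sup>2 + b\<^sup>2)))"
    by blast
qed

text \<open>
  A Banach space over such a field: the class \<^class>\<open>banach\<close> supplies the underlying real Banach
  space, and \<open>smul\<close> is a scalar multiplication extending the real one.
\<close>

locale banach_over = vector_space smul
  for smul :: "'k::real_or_complex \<Rightarrow> 'a::banach \<Rightarrow> 'a" +
  assumes smul_of_real: "smul (of_real r) x = r *\<^sub>R x"
    and norm_smul: "norm (smul c x) = norm c * norm x"

lemma banach_over_scaleR: "banach_over ((*\<^sub>R) :: real \<Rightarrow> 'a::banach \<Rightarrow> 'a)"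
  by unfold_locales (auto simp: algebra_simps)

text \<open>
  The dual of a linear subspace \<open>Y\<close>. Functionals on \<open>Y\<close> are functions with the fixed value
  \<^term>\<open>undefined\<close> off \<open>Y\<close>, so that equality means equality on \<open>Y\<close>; for \<open>Y = UNIV\<close> this is no
  restriction.
\<close>

definition dual_on :: "('k::real_or_complex \<Rightarrow> 'a::banach \<Rightarrow> 'a) \<Rightarrow> 'a set \<Rightarrow> ('a \<Rightarrow> 'k) set" where
  "dual_on smul Y = {f \<in> extensional Y.
     (\<forall>x\<in>Y. \<forall>y\<in>Y. f (x + y) = f x + f y) \<and>
     (\<forall>c. \<forall>x\<in>Y. f (smul c x) = c * f x) \<and>
     (\<exists>B. \<forall>x\<in>Y. norm (f x) \<le> B * norm x)}"

abbreviation dual :: "('k::real_or_complex \<Rightarrow> 'a::banach \<Rightarrow> 'a) \<Rightarrow> ('a \<Rightarrow> 'k) set" where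
  "dual smul \<equiv> dual_on smul UNIV"

definition linear_space :: "('a \<Rightarrow> 'k::real_or_complex) set \<Rightarrow> bool" where
  "linear_space E \<longleftrightarrow> (\<lambda>_. 0) \<in> E \<and>
     (\<forall>f\<in>E. \<forall>g\<in>E. (\<lambda>x. f x + g x) \<in> E) \<and>
     (\<forall>c. \<forall>f\<in>E. (\<lambda>x. c * f x) \<in> E)"

definition norming :: "('a::banach \<Rightarrow> 'k::real_or_complex) set \<Rightarrow> bool" where
  "norming D \<longleftrightarrow>
     (\<exists>C\<ge>1. \<forall>x. norm x \<le> C * (SUP f\<in>{f\<in>D. onorm f \<le> 1}. norm (f x)))"

abbreviation closed_span :: "('k::real_or_complex \<Rightarrow> 'a::banach \<Rightarrow> 'a) \<Rightarrow> 'a set \<Rightarrow> 'a set" where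
  "closed_span smul S \<equiv> closure (module.span smul S)"

text \<open>The weakest topology on \<open>S\<close> making all functions in \<open>F\<close> continuous.\<close>

definition initial_topology :: "'s set \<Rightarrow> ('s \<Rightarrow> 'k::topological_space) set \<Rightarrow> 's topology" where
  "initial_topology S F =
     topology_generated_by (insert S {{x\<in>S. f x \<in> U} | f U. f \<in> F \<and> open U})"

abbreviation sigma_top :: "('a \<Rightarrow> 'k::real_or_complex) set \<Rightarrow> 'a topology" where
  "sigma_top D \<equiv> initial_topology UNIV D"

abbreviation weak_star :: "('k::real_or_complex \<Rightarrow> 'a::banach \<Rightarrow> 'a) \<Rightarrow> ('a \<Rightarrow> 'k) topology" where
  "weak_star smul \<equiv> initial_topology (dual smul) (range (\<lambda>x f. f x))"

definition weak_star_countably_closed ::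
    "('k::real_or_complex \<Rightarrow> 'a::banach \<Rightarrow> 'a) \<Rightarrow> ('a \<Rightarrow> 'k) set \<Rightarrow> bool" where
  "weak_star_countably_closed smul D \<longleftrightarrow>
     (\<forall>S. S \<subseteq> D \<and> countable S \<longrightarrow> weak_star smul closure_of S \<subseteq> D)"

text \<open>
  The index set of a skeleton is the carrier \<open>\<Gamma>\<close>, ordered by the relation \<open>r\<close>; only the values
  \<open>P s\<close> with \<open>s \<in> \<Gamma>\<close> matter.
\<close>

definition bounded_projection ::
    "('k::real_or_complex \<Rightarrow> 'a::banach \<Rightarrow> 'a) \<Rightarrow> ('a \<Rightarrow> 'a) \<Rightarrow> bool" where
  "bounded_projection smul P \<longleftrightarrow>
     bounded_linear P \<and> (\<forall>c x. P (smul c x) = smul c (P x)) \<and> P \<circ> P = P"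

definition is_sup_in :: "'i set \<Rightarrow> 'i rel \<Rightarrow> 'i set \<Rightarrow> 'i \<Rightarrow> bool" where
  "is_sup_in \<Gamma> r S s \<longleftrightarrow> s \<in> \<Gamma> \<and> (\<forall>t\<in>S. (t, s) \<in> r) \<and>
     (\<forall>u\<in>\<Gamma>. (\<forall>t\<in>S. (t, u) \<in> r) \<longrightarrow> (s, u) \<in> r)"

definition projectional_skeleton ::
    "('k::real_or_complex \<Rightarrow> 'a::banach \<Rightarrow> 'a) \<Rightarrow> 'i set \<Rightarrow> 'i rel \<Rightarrow> ('i \<Rightarrow> 'a \<Rightarrow> 'a) \<Rightarrow> bool" where
  "projectional_skeleton smul \<Gamma> r P \<longleftrightarrow>
     partial_order_on \<Gamma> r \<and> (\<forall>s\<in>\<Gamma>. \<forall>t\<in>\<Gamma>. \<exists>u\<in>\<Gamma>. (s, u) \<in> r \<and> (t, u) \<in> r) \<and>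
     (\<forall>s\<in>\<Gamma>. bounded_projection smul (P s)) \<and>
     (\<forall>s\<in>\<Gamma>. separable_space (top_of_set (range (P s)))) \<and>
     (\<forall>s\<in>\<Gamma>. \<forall>t\<in>\<Gamma>. (s, t) \<in> r \<longrightarrow> P s \<circ> P t = P s \<and> P t \<circ> P s = P s) \<and>
     (\<forall>\<sigma> :: nat \<Rightarrow> 'i. (\<forall>n. \<sigma> n \<in> \<Gamma>) \<and> (\<forall>n. (\<sigma> n, \<sigma> (Suc n)) \<in> r) \<longrightarrow>
        (\<exists>s. is_sup_in \<Gamma> r (range \<sigma>) s \<and> range (P s) = closure (\<Union>n. range (P (\<sigma> n))))) \<and>
     (\<Union>s\<in>\<Gamma>. range (P s)) = UNIV"

text \<open>The image of the adjoint of \<open>P s\<close> consists of the functionals \<open>f \<circ> P s\<close>.\<close>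

definition induced_subspace ::
    "('k::real_or_complex \<Rightarrow> 'a::banach \<Rightarrow> 'a) \<Rightarrow> 'i set \<Rightarrow> ('i \<Rightarrow> 'a \<Rightarrow> 'a) \<Rightarrow> ('a \<Rightarrow> 'k) set" where
  "induced_subspace smul \<Gamma> P = (\<Union>s\<in>\<Gamma>. (\<lambda>f. f \<circ> P s) ` dual smul)"

text \<open>
  HOL cannot quantify existentially over types, so ``there is a skeleton'' has to name the type
  \<open>'i\<close> that contains the index set; the unrestricted assertion is expressed by a sufficiently large
  type together with the fact that no other type yields more.
\<close>

definition induced_by_skeleton ::
    "'i itself \<Rightarrow> ('k::real_or_complex \<Rightarrow> 'a::banach \<Rightarrow> 'a) \<Rightarrow> ('a \<Rightarrow> 'k) set \<Rightarrow> bool" where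
  "induced_by_skeleton _ smul D \<longleftrightarrow>
     (\<exists>(\<Gamma> :: 'i set) r P. projectional_skeleton smul \<Gamma> r P \<and> D = induced_subspace smul \<Gamma> P)"

definition countable_subsets :: "'m set \<Rightarrow> 'm set set" where
  "countable_subsets M = {A. A \<subseteq> M \<and> countable A}"

definition omega_monotone :: "'m set \<Rightarrow> 'n set \<Rightarrow> ('m set \<Rightarrow> 'n set) \<Rightarrow> bool" where
  "omega_monotone M1 M2 \<phi> \<longleftrightarrow>
     \<phi> ` countable_subsets M1 \<subseteq> countable_subsets M2 \<and>
     (\<forall>A\<in>countable_subsets M1. \<forall>B\<in>countable_subsets M1. A \<subseteq> B \<longrightarrow> \<phi> A \<subseteq> \<phi> B) \<and>
     (\<forall>A :: nat \<Rightarrow> 'm set. (\<forall>n. A n \<in> countable_subsets M1) \<and> incseq A \<longrightarrow>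
        \<phi> (\<Union>n. A n) = (\<Union>n. \<phi> (A n)))"

text \<open>
  The disjoint union of \<open>D\<close> and \<open>X\<close> is \<^term>\<open>D <+> UNIV\<close>; for a subset \<open>B\<close> of it, the
  following are the parts of \<open>B\<close> in \<open>D\<close> and in \<open>X\<close>.
\<close>

abbreviation functional_part :: "(('a \<Rightarrow> 'k) + 'a) set \<Rightarrow> ('a \<Rightarrow> 'k) set" where
  "functional_part B \<equiv> Inl -` B"

abbreviation vector_part :: "(('a \<Rightarrow> 'k) + 'a) set \<Rightarrow> 'a set" where
  "vector_part B \<equiv> Inr -` B"

definition outer_network :: "'p topology \<Rightarrow> 'p set \<Rightarrow> 'p set set \<Rightarrow> bool" where
  "outer_network T S \<N> \<longleftrightarrow> (\<forall>N\<in>\<N>. N \<subseteq> topspace T) \<and>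
     (\<forall>U x. openin T U \<and> x \<in> U \<inter> S \<longrightarrow> (\<exists>N\<in>\<N>. x \<in> N \<and> N \<subseteq> U))"

definition continuous_retraction :: "'p topology \<Rightarrow> ('p \<Rightarrow> 'p) \<Rightarrow> bool" where
  "continuous_retraction T \<rho> \<longleftrightarrow>
     continuous_map T T \<rho> \<and> (\<forall>x\<in>topspace T. \<rho> (\<rho> x) = \<rho> x)"

definition monotonically_Sokolov :: "'p topology \<Rightarrow> bool" where
  "monotonically_Sokolov T \<longleftrightarrow>
     (let \<F> = {F. closedin T F \<and> F \<noteq> {}} in
      \<exists>(\<rho> :: 'p set set \<Rightarrow> 'p \<Rightarrow> 'p) (\<N> :: 'p set set \<Rightarrow> 'p set set).
        (\<forall>\<A>\<in>countable_subsets \<F>.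
           continuous_retraction T (\<rho> \<A>) \<and> (\<forall>F\<in>\<A>. \<rho> \<A> ` F \<subseteq> F) \<and>
           countable (\<N> \<A>) \<and> outer_network T (\<rho> \<A> ` topspace T) (\<N> \<A>)) \<and>
        omega_monotone \<F> (Pow (topspace T)) \<N>)"

text \<open>Here again the points of the monotonically Sokolov space are taken from a named type \<open>'t\<close>.\<close>

definition image_of_monotonically_Sokolov :: "'t itself \<Rightarrow> 'p topology \<Rightarrow> bool" where
  "image_of_monotonically_Sokolov _ S \<longleftrightarrow>
     (\<exists>(T :: 't topology) f. monotonically_Sokolov T \<and> continuous_map T S f \<and>
        f ` topspace T = topspace S)"

end

theory Submission
  imports Defs
begin

text \<open>
  Each assertion says, in its own way, that \<open>X\<close> and \<open>D\<close> decompose compatibly into separable pieces.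
  A piece is a separable closed subspace \<open>Y\<close> of \<open>X\<close> with a weak-star closed linear
  \<open>E \<subseteq> D\<close> such that restriction maps \<open>E\<close> bijectively onto the dual of \<open>Y\<close>. Such a piece is the same
  thing as a bounded projection \<open>P\<close> with range \<open>Y\<close> whose adjoint has range \<open>E\<close>
  (\<open>projection_onto_bijective_subspace\<close>): the kernel of \<open>P\<close> is the annihilator of \<open>E\<close>, boundedness
  comes from the uniform boundedness principle, and \<open>Y\<close> and the kernel together fill \<open>X\<close>, because a
  functional that vanishes on both lies in \<open>E\<close> by the bipolar theorem and is then zero by injectivity.
  Consequently a monotone assignment of pieces to countable sets of vectors is a projectional
  skeleton, indexed by the countable sets themselves
  (\<open>monotone_dual_pairs_over_vectors_imp_skeleton\<close>). Pieces assigned to countable subsets of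
  \<open>D \<union> X\<close> can be reindexed by sets of vectors, since adding one functional to the index does not change the
  piece once enough vectors have been added
  (\<open>monotone_dual_pairs_imp_monotone_dual_pairs_over_vectors\<close>).
  
  The cycle is closed through the topological assertions. Let a skeleton be given. Every \<open>P\<close> of the
  skeleton is continuous for \<open>\<sigma>(X,D)\<close>, so what has to be arranged is that it maps given closed sets
  into themselves. Suppose that \<open>G\<close> is closed, \<open>x \<in> G\<close> and \<open>P x \<notin> G\<close>. Some finitely many functionals
  of \<open>D\<close> separate \<open>P x\<close> from \<open>G\<close>. As the range of \<open>P\<close> is separable, the quality of such a separation depends,
  up to an error, on countably many parameters only, so the separating
  functionals can be chosen in advance among countably many ones that \<open>P\<close> leaves fixed. These take the same
  values at \<open>x\<close> and at \<open>P x\<close>, which contradicts \<open>x \<in> G\<close> (\<open>skeleton_monotonically_Sokolov\<close>).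
  
  Conversely, let \<open>\<phi>\<close> be a continuous map from a monotonically Sokolov space to \<open>X\<close> with total image;
  this covers both a total subset of \<open>X\<close> and a space that is mapped onto \<open>X\<close>. Given countably many
  functionals \<open>f\<close>, take the preimages of small discs under \<open>f \<circ> \<phi>\<close> as the closed sets. The
  retraction \<open>\<rho>\<close> preserving them satisfies \<open>f \<circ> \<phi> \<circ> \<rho> = f \<circ> \<phi>\<close>, and one point from each
  network set suffices to detect every nonzero functional in the weak-star closure \<open>E\<close> of the given ones.
  That gives injectivity of the restriction to the span \<open>Y\<close> of these points. Surjectivity is obtained by
  adding functionals that norm \<open>Y\<close> and applying a Helly type extension theorem, \<open>extension\<close>
  (\<open>monotonically_Sokolov_image_imp_monotone_dual_pairs\<close>).
  
  All the sets needed are obtained by closing a countable set under operations that assign a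
  countable set to every finite one; such a closure is automatically \<open>\<omega>\<close>-monotone
  (\<open>omega_monotone_generated\<close>).
\<close>

section \<open>The scalar field\<close>

text \<open>
  The scalar field is a closed subfield of the complex numbers that is stable under conjugation. The
  isometric embedding transports real parts, conjugates, local compactness and separability to it without
  any further case distinction between real and complex spaces.
\<close>

lemma scalar_embedding_exists:
  "\<exists>e :: 'k::real_or_complex \<Rightarrow> complex.
     (\<forall>x y. e (x + y) = e x + e y) \<and> (\<forall>x y. e (x * y) = e x * e y) \<and>
     (\<forall>x. norm (e x) = norm x) \<and> (\<forall>r. e (of_real r) = of_real r) \<and>
     (\<forall>x. cnj (e x) \<in> range e) \<and> closed (range e)"
  using real_or_complex[where 'a='k]
proof (elim disjE exE conjE)
  assume real: "\<forall>z::'k. \<exists>a. z = a *\<^sub>R 1"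
  then obtain c :: "'k \<Rightarrow> real" where c: "\<And>z. z = c z *\<^sub>R 1" by metis
  have c': "c (a *\<^sub>R 1) = a" for a
    using c[of "a *\<^sub>R 1"] by simp
  have add: "c (x + y) = c x + c y" for x y
    by (metis c c' scaleR_left_distrib)
  have mult: "c (x * y) = c x * c y" for x y
  proof -
    have "x * y = (c x * c y) *\<^sub>R 1"
      by (subst c[of x], subst c[of y]) simp
    then show ?thesis by (simp only: c')
  qed
  have norm: "norm (c x) = norm x" for x
    by (subst c[of x], subst norm_scaleR) simp
  have "complex_of_real r \<in> range (\<lambda>x. complex_of_real (c x))" for r
    by (rule range_eqI[of _ _ "r *\<^sub>R 1"]) (simp only: c')
  then have "range (\<lambda>x. complex_of_real (c x)) = \<real>"
    unfolding Reals_def by blast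
  moreover have "c (of_real r) = r" for r
    using c'[of r] by (simp add: of_real_def)
  ultimately show ?thesis
    using norm
    by (intro exI[of _ "\<lambda>x. complex_of_real (c x)"] conjI allI)
      (simp_all add: add mult closed_complex_Reals)
next
  fix i :: 'k
  assume ii: "i * i = - 1" and ex: "\<forall>z. \<exists>a b. z = a *\<^sub>R 1 + b *\<^sub>R i"
    and nrm: "\<forall>a b. norm (a *\<^sub>R 1 + b *\<^sub>R i) = sqrt (a\<^sup>2 + b\<^sup>2)"
  define h where "h z = Re z *\<^sub>R 1 + Im z *\<^sub>R i" for z
  have h_norm: "norm (h z) = norm z" for z
    by (simp add: h_def nrm cmod_def)
  have h_add: "h (x + y) = h x + h y" for x y
    by (simp add: h_def algebra_simps)
  have h_diff: "h (x - y) = h x - h y" for x y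
    by (simp add: h_def algebra_simps)
  have "inj h"
    by (rule injI) (metis h_diff h_norm norm_eq_zero right_minus_eq)
  moreover have "surj h"
    unfolding surj_def h_def using ex by (metis complex.sel)
  ultimately have bij: "bij h" by (rule bijI)
  have h_mult: "h (x * y) = h x * h y" for x y
    by (simp add: h_def ii algebra_simps)
  have h_real: "h (of_real r) = of_real r" for r
    by (simp add: h_def of_real_def)
  have inv: "h (inv h z) = z" "inv h (h w) = w" for z w
    using bij by (auto simp: bij_def surj_f_inv_f)
  have "range (inv h) = UNIV"
    using bij bij_imp_bij_inv bij_is_surj by blast
  then show ?thesis
  proof (intro exI[of _ "inv h"] conjI allI)
    show "inv h (x + y) = inv h x + inv h y" for x y
      by (metis h_add inv)
    show "inv h (x * y) = inv h x * inv h y" for x y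
      by (metis h_mult inv)
    show "norm (inv h x) = norm x" for x
      by (metis h_norm inv(1))
    show "inv h (of_real r) = of_real r" for r
      by (metis h_real inv(2))
  qed simp_all
qed

definition to_complex :: "'k::real_or_complex \<Rightarrow> complex" where
  "to_complex = (SOME e.
     (\<forall>x y. e (x + y) = e x + e y) \<and> (\<forall>x y. e (x * y) = e x * e y) \<and>
     (\<forall>x. norm (e x) = norm x) \<and> (\<forall>r. e (of_real r) = of_real r) \<and>
     (\<forall>x. cnj (e x) \<in> range e) \<and> closed (range e))"

lemma
  shows to_complex_add: "to_complex (x + y) = to_complex x + to_complex (y::'k::real_or_complex)"
    and to_complex_mult: "to_complex (x * y) = to_complex x * to_complex y"
    and norm_to_complex [simp]: "norm (to_complex x) = norm x"
    and to_complex_of_real [simp]: "to_complex (of_real r :: 'k) = of_real r"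
    and cnj_to_complex: "cnj (to_complex x) \<in> range (to_complex :: 'k \<Rightarrow> complex)"
    and closed_range_to_complex: "closed (range (to_complex :: 'k \<Rightarrow> complex))"
  using someI_ex[OF scalar_embedding_exists, folded to_complex_def] by blast+

lemma to_complex_0 [simp]: "to_complex 0 = 0"
  using to_complex_of_real[of 0] by simp

lemma to_complex_diff: "to_complex (x - y) = to_complex x - to_complex y"
  by (metis add_diff_cancel_right' diff_add_cancel to_complex_add)

lemma dist_to_complex [simp]: "dist (to_complex x) (to_complex y) = dist x y"
  by (simp add: dist_norm flip: to_complex_diff)

definition scalar_Re :: "'k::real_or_complex \<Rightarrow> real" where
  "scalar_Re z = Re (to_complex z)"

definition scalar_cnj :: "'k::real_or_complex \<Rightarrow> 'k" where
  "scalar_cnj z = inv to_complex (cnj (to_complex z))"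

lemma to_complex_scalar_cnj: "to_complex (scalar_cnj z) = cnj (to_complex z)"
  unfolding scalar_cnj_def by (rule f_inv_into_f[OF cnj_to_complex])

lemma scalar_Re_add [simp]: "scalar_Re (x + y) = scalar_Re x + scalar_Re y"
  by (simp add: scalar_Re_def to_complex_add)

lemma scalar_Re_0 [simp]: "scalar_Re 0 = 0"
  by (simp add: scalar_Re_def)

lemma scalar_Re_diff: "scalar_Re (x - y) = scalar_Re x - scalar_Re y"
  by (simp add: scalar_Re_def to_complex_diff)

lemma scalar_Re_sum: "scalar_Re (sum f A) = (\<Sum>x\<in>A. scalar_Re (f x))"
  by (induction A rule: infinite_finite_induct) auto

lemma scalar_Re_of_real [simp]: "scalar_Re (of_real r) = r"
  by (simp add: scalar_Re_def)

lemma scalar_Re_le_norm: "scalar_Re z \<le> norm z"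
  unfolding scalar_Re_def using complex_Re_le_cmod[of "to_complex z"] by simp

lemma scalar_Re_cnj_mult: "scalar_Re (scalar_cnj z * z) = (norm z)\<^sup>2"
  unfolding scalar_Re_def to_complex_mult to_complex_scalar_cnj
  by (metis Re_complex_of_real complex_norm_square mult.commute norm_to_complex)

text \<open>
  The expansion of a square, which is what the variational argument in the extension theorem differentiates.
\<close>

lemma norm_add_square:
  "(norm (z + w))\<^sup>2 = (norm z)\<^sup>2 + 2 * scalar_Re (scalar_cnj z * w) + (norm w)\<^sup>2"
proof -
  have *: "(cmod (a + b))\<^sup>2 = (cmod a)\<^sup>2 + 2 * Re (cnj a * b) + (cmod b)\<^sup>2" for a b
    unfolding cmod_power2 by (simp add: power2_eq_square algebra_simps)
  show ?thesis
    using *[of "to_complex z" "to_complex w"]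
    by (simp add: scalar_Re_def to_complex_mult to_complex_scalar_cnj flip: to_complex_add)
qed

lemma rotate_to_norm:
  obtains c :: "'k::real_or_complex" where "norm c = 1" "c * z = of_real (norm z)"
proof (cases "z = 0")
  case True
  then show ?thesis using that[of 1] by simp
next
  case False
  then show ?thesis
    using that[of "of_real (norm z) / z"] by (simp add: norm_divide)
qed

lemma scalar_bounded_subsequence:
  fixes f :: "nat \<Rightarrow> 'k::real_or_complex"
  assumes "bounded (range f)"
  shows "\<exists>l r. strict_mono (r :: nat \<Rightarrow> nat) \<and> ((f \<circ> r) \<longlongrightarrow> l) sequentially"
proof -
  have "bounded (range (to_complex \<circ> f))"
    using assms by (simp add: bounded_iff)
  then obtain l r where r: "strict_mono (r :: nat \<Rightarrow> nat)" "((to_complex \<circ> f) \<circ> r) \<longlonglongrightarrow> l"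
    using bounded_imp_convergent_subsequence by blast
  moreover have "\<forall>n. ((to_complex \<circ> f) \<circ> r) n \<in> range (to_complex :: 'k \<Rightarrow> complex)"
    by auto
  ultimately have "l \<in> range (to_complex :: 'k \<Rightarrow> complex)"
    using closed_range_to_complex closed_sequentially by blast
  then obtain m :: 'k where "l = to_complex m" by blast
  with r have "(f \<circ> r) \<longlonglongrightarrow> m"
    by (simp add: tendsto_iff)
  with r show ?thesis by blast
qed

instance real_or_complex \<subseteq> heine_borel
  by standard (rule scalar_bounded_subsequence)

instance real_or_complex \<subseteq> banach ..

lemma ex_countable_dense_scalars:
  obtains Q :: "'k::real_or_complex set"
  where "countable Q" "\<And>z e. e > 0 \<Longrightarrow> \<exists>q\<in>Q. dist q z < e"
proof -
  obtain T where T: "countable T" "T \<subseteq> range (to_complex :: 'k \<Rightarrow> complex)"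
    "range (to_complex :: 'k \<Rightarrow> complex) \<subseteq> closure T"
    using separable[of "range (to_complex :: 'k \<Rightarrow> complex)"] by metis
  define Q where "Q = (inv to_complex ` T :: 'k set)"
  have "\<exists>q\<in>Q. dist q z < e" if e: "e > 0" for z e
  proof -
    have "to_complex z \<in> closure T" using T by blast
    then obtain t where t: "t \<in> T" "dist t (to_complex z) < e"
      using e unfolding closure_approachable by blast
    then have "to_complex (inv to_complex t :: 'k) = t"
      using T by (intro f_inv_into_f) auto
    then have "dist (inv to_complex t) z < e"
      using t by (metis dist_to_complex)
    then show ?thesis using t by (auto simp: Q_def)
  qed
  then show ?thesis
    using that[of Q] T by (auto simp: Q_def)
qed

definition dense_scalars :: "'k::real_or_complex set" where
  "dense_scalars = (SOME Q. countable Q \<and> (\<forall>z e. e > 0 \<longrightarrow> (\<exists>q\<in>Q. dist q z < e)))"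

lemma countable_dense_scalars: "countable (dense_scalars :: 'k::real_or_complex set)"
  and dense_scalars_approx: "e > 0 \<Longrightarrow> \<exists>q\<in>dense_scalars. dist q (z :: 'k) < e"
proof -
  have "\<exists>Q :: 'k set. countable Q \<and> (\<forall>z e. e > 0 \<longrightarrow> (\<exists>q\<in>Q. dist q z < e))"
    by (metis ex_countable_dense_scalars)
  from someI_ex[OF this, folded dense_scalars_def]
  show "countable (dense_scalars :: 'k set)" "e > 0 \<Longrightarrow> \<exists>q\<in>dense_scalars. dist q (z :: 'k) < e"
    by blast+
qed

section \<open>Initial topologies\<close>

text \<open>
  Neighbourhoods given by finitely many functions and one common radius form a base. All later
  arguments about \<open>\<sigma>(X,D)\<close> and the weak-star topology use this description.
\<close>

lemma openin_initial_topology: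
  fixes F :: "('s \<Rightarrow> 'k::metric_space) set"
  shows "openin (initial_topology S F) U \<longleftrightarrow> U \<subseteq> S \<and>
    (\<forall>x\<in>U. \<exists>J e. J \<subseteq> F \<and> finite J \<and> e > 0 \<and> (\<forall>y\<in>S. (\<forall>f\<in>J. dist (f y) (f x) < e) \<longrightarrow> y \<in> U))"
    (is "_ \<longleftrightarrow> ?P U")
proof
  let ?G = "insert S {{x\<in>S. f x \<in> U} | f U. f \<in> F \<and> open U}"
  assume "openin (initial_topology S F) U"
  then have gen: "generate_topology_on ?G U"
    unfolding initial_topology_def by (rule openin_topology_generated_by)
  show "?P U"
    using gen
  proof (induction rule: generate_topology_on.induct)
    case (Int a b)
    show ?case
    proof (intro conjI ballI)
      fix x assume "x \<in> a \<inter> b"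
      then have "x \<in> a" "x \<in> b" by auto
      obtain J e where J: "J \<subseteq> F" "finite J" "e > 0" "\<forall>y\<in>S. (\<forall>f\<in>J. dist (f y) (f x) < e) \<longrightarrow> y \<in> a"
        using bspec[OF conjunct2[OF Int.IH(1)] \<open>x \<in> a\<close>] by blast
      obtain J' e' where J': "J' \<subseteq> F" "finite J'" "e' > 0" "\<forall>y\<in>S. (\<forall>f\<in>J'. dist (f y) (f x) < e') \<longrightarrow> y \<in> b"
        using bspec[OF conjunct2[OF Int.IH(2)] \<open>x \<in> b\<close>] by blast
      show "\<exists>J e. J \<subseteq> F \<and> finite J \<and> e > 0 \<and> (\<forall>y\<in>S. (\<forall>f\<in>J. dist (f y) (f x) < e) \<longrightarrow> y \<in> a \<inter> b)"
        using J J' by (intro exI[of _ "J \<union> J'"] exI[of _ "min e e'"]) auto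
    qed (use Int.IH in blast)
  next
    case (UN K)
    show ?case
    proof (intro conjI ballI)
      fix x assume "x \<in> \<Union>K"
      then obtain k where k: "k \<in> K" "x \<in> k" by blast
      then obtain J e where "J \<subseteq> F" "finite J" "e > 0" "\<forall>y\<in>S. (\<forall>f\<in>J. dist (f y) (f x) < e) \<longrightarrow> y \<in> k"
        using bspec[OF conjunct2[OF UN.IH[OF k(1)]] k(2)] by blast
      then show "\<exists>J e. J \<subseteq> F \<and> finite J \<and> e > 0 \<and> (\<forall>y\<in>S. (\<forall>f\<in>J. dist (f y) (f x) < e) \<longrightarrow> y \<in> \<Union>K)"
        using k by (intro exI[of _ J] exI[of _ e]) auto
    qed (use UN.IH in blast)
  next
    case (Basis s)
    show ?case
    proof (cases "s = S")
      case True
      then show ?thesis by (auto intro!: exI[of _ "{}"] exI[of _ "1::real"])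
    next
      case False
      then obtain f V where V: "f \<in> F" "open V" "s = {x\<in>S. f x \<in> V}"
        using Basis by blast
      show ?thesis
      proof (intro conjI ballI)
        fix x assume "x \<in> s"
        then obtain e where "e > 0" "\<forall>y. dist y (f x) < e \<longrightarrow> y \<in> V"
          using V unfolding open_dist by auto
        then show "\<exists>J e. J \<subseteq> F \<and> finite J \<and> e > 0 \<and> (\<forall>y\<in>S. (\<forall>f\<in>J. dist (f y) (f x) < e) \<longrightarrow> y \<in> s)"
          using V by (intro exI[of _ "{f}"] exI[of _ e]) auto
      qed (use V in blast)
    qed
  qed auto
next
  assume P: "?P U"
  have *: "openin (initial_topology S F) {y\<in>S. \<forall>f\<in>J. dist (f y) (f x) < e}"
    if "finite J" "J \<subseteq> F" for J x and e :: real
    using that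
  proof (induction J)
    case empty
    show ?case
      unfolding initial_topology_def by (simp add: topology_generated_by_Basis)
  next
    case (insert f J)
    have "openin (initial_topology S F) {y\<in>S. f y \<in> ball (f x) e}"
      unfolding initial_topology_def using insert.prems
      by (intro topology_generated_by_Basis) (use open_ball in blast)
    then have "openin (initial_topology S F)
        ({y\<in>S. f y \<in> ball (f x) e} \<inter> {y\<in>S. \<forall>f\<in>J. dist (f y) (f x) < e})"
      using insert by (intro openin_Int) auto
    also have "{y\<in>S. f y \<in> ball (f x) e} \<inter> {y\<in>S. \<forall>f\<in>J. dist (f y) (f x) < e} =
        {y\<in>S. \<forall>f\<in>insert f J. dist (f y) (f x) < e}"
      by (auto simp: dist_commute)
    finally show ?case .
  qed
  show "openin (initial_topology S F) U"
    unfolding openin_subopen[of _ U]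
  proof
    fix x assume x: "x \<in> U"
    obtain J e where "J \<subseteq> F" "finite J" "e > 0"
      "\<forall>y\<in>S. (\<forall>f\<in>J. dist (f y) (f x) < e) \<longrightarrow> y \<in> U"
      using bspec[OF conjunct2[OF P] x] by blast
    then show "\<exists>T. openin (initial_topology S F) T \<and> x \<in> T \<and> T \<subseteq> U"
      using P x *[of J x e] by (intro exI[of _ "{y\<in>S. \<forall>f\<in>J. dist (f y) (f x) < e}"]) auto
  qed
qed

lemma topspace_initial_topology [simp]: "topspace (initial_topology S F) = S"
  unfolding initial_topology_def by auto

lemma openin_initial_basic:
  fixes F :: "('s \<Rightarrow> 'k::metric_space) set"
  assumes "finite J" "J \<subseteq> F"
  shows "openin (initial_topology S F) {y\<in>S. \<forall>f\<in>J. dist (f y) (c f) < e}"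
  unfolding openin_initial_topology
proof (intro conjI ballI)
  fix x assume x: "x \<in> {y\<in>S. \<forall>f\<in>J. dist (f y) (c f) < e}"
  show "\<exists>J' e'. J' \<subseteq> F \<and> finite J' \<and> e' > 0 \<and> (\<forall>y\<in>S. (\<forall>f\<in>J'. dist (f y) (f x) < e') \<longrightarrow>
      y \<in> {y\<in>S. \<forall>f\<in>J. dist (f y) (c f) < e})"
  proof (cases "J = {}")
    case True
    then show ?thesis by (intro exI[of _ "{}"] exI[of _ 1]) auto
  next
    case False
    define d where "d = Min ((\<lambda>f. e - dist (f x) (c f)) ` J)"
    have "d > 0" using x False assms by (auto simp: d_def)
    moreover have "dist (f y) (c f) < e" if "f \<in> J" "dist (f y) (f x) < d" for y f
    proof -
      have "d \<le> e - dist (f x) (c f)" using that assms by (simp add: d_def)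
      then show ?thesis using that dist_triangle[of "f y" "c f" "f x"] by linarith
    qed
    ultimately show ?thesis using assms
      by (intro exI[of _ J] exI[of _ d]) auto
  qed
qed auto

lemma closure_of_initial_topology:
  fixes F :: "('s \<Rightarrow> 'k::metric_space) set"
  assumes "A \<subseteq> S"
  shows "x \<in> initial_topology S F closure_of A \<longleftrightarrow>
    x \<in> S \<and> (\<forall>J e. J \<subseteq> F \<and> finite J \<and> e > 0 \<longrightarrow> (\<exists>y\<in>A. \<forall>f\<in>J. dist (f y) (f x) < e))"
proof (intro iffI conjI allI impI)
  assume x: "x \<in> initial_topology S F closure_of A"
  then show "x \<in> S" by (auto simp: in_closure_of)
  fix J e assume *: "J \<subseteq> F \<and> finite J \<and> (e::real) > 0"
  have "openin (initial_topology S F) {y\<in>S. \<forall>f\<in>J. dist (f y) (f x) < e}"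
    using * by (intro openin_initial_basic) auto
  with x * \<open>x \<in> S\<close> show "\<exists>y\<in>A. \<forall>f\<in>J. dist (f y) (f x) < e"
    by (auto simp: in_closure_of dest!: spec[of _ "{y\<in>S. \<forall>f\<in>J. dist (f y) (f x) < e}"])
next
  assume x: "x \<in> S \<and> (\<forall>J e. J \<subseteq> F \<and> finite J \<and> e > 0 \<longrightarrow> (\<exists>y\<in>A. \<forall>f\<in>J. dist (f y) (f x) < e))"
  show "x \<in> initial_topology S F closure_of A"
    unfolding in_closure_of
  proof (intro conjI allI impI)
    fix T assume T: "x \<in> T \<and> openin (initial_topology S F) T"
    then have "\<forall>x\<in>T. \<exists>J e. J \<subseteq> F \<and> finite J \<and> e > 0 \<and>
        (\<forall>y\<in>S. (\<forall>f\<in>J. dist (f y) (f x) < e) \<longrightarrow> y \<in> T)"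
      unfolding openin_initial_topology by (rule conjunct2[OF conjunct2])
    from bspec[OF this conjunct1[OF T]]
    obtain J e where J: "J \<subseteq> F" "finite J" "e > 0"
      "\<forall>y\<in>S. (\<forall>f\<in>J. dist (f y) (f x) < e) \<longrightarrow> y \<in> T"
      by blast
    then obtain y where "y \<in> A" "\<forall>f\<in>J. dist (f y) (f x) < e" using x by blast
    then show "\<exists>y. y \<in> A \<and> y \<in> T" using J assms by blast
  qed (use x in auto)
qed

lemma continuous_map_into_initial_topology:
  fixes F :: "('s \<Rightarrow> 'k::metric_space) set"
  assumes "\<And>t. t \<in> topspace T \<Longrightarrow> \<phi> t \<in> S"
    and "\<And>f. f \<in> F \<Longrightarrow> continuous_map T euclidean (\<lambda>t. f (\<phi> t))"
  shows "continuous_map T (initial_topology S F) \<phi>"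
  unfolding initial_topology_def
proof (rule continuous_on_generated_topo)
  fix U assume "U \<in> insert S {{x\<in>S. f x \<in> U} | f U. f \<in> F \<and> open U}"
  then consider "U = S" | f V where "f \<in> F" "open V" "U = {x\<in>S. f x \<in> V}" by blast
  then show "openin T (\<phi> -` U \<inter> topspace T)"
  proof cases
    case 1
    then have "\<phi> -` U \<inter> topspace T = topspace T" using assms(1) by auto
    then show ?thesis by simp
  next
    case 2
    then have "\<phi> -` U \<inter> topspace T = {t\<in>topspace T. f (\<phi> t) \<in> V}" using assms(1) by auto
    then show ?thesis
      using openin_continuous_map_preimage[OF assms(2)[OF 2(1)], of V] 2(2) by simp
  qed
qed (use assms(1) in auto)

lemma continuous_map_from_initial_topology:
  fixes F :: "('s \<Rightarrow> 'k::metric_space) set"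
  assumes "f \<in> F"
  shows "continuous_map (initial_topology S F) euclidean f"
  unfolding continuous_map_def
proof (intro conjI allI impI)
  fix U :: "'k set" assume "openin euclidean U"
  then have "{x\<in>S. f x \<in> U} \<in> insert S {{x\<in>S. f x \<in> U} | f U. f \<in> F \<and> open U}"
    using assms by auto
  then show "openin (initial_topology S F) {x \<in> topspace (initial_topology S F). f x \<in> U}"
    unfolding topspace_initial_topology
    unfolding initial_topology_def by (rule topology_generated_by_Basis)
qed auto

section \<open>The dual ball\<close>

text \<open>
  The topology of pointwise convergence on all functions is the one in which the dual ball is
  compact; the next lemma extracts weak-star approximations from it.
\<close>

lemma closure_fun_approx:
  fixes A :: "('s \<Rightarrow> 'k::metric_space) set"
  assumes "f \<in> closure A" "finite J" "e > 0"
  shows "\<exists>g\<in>A. \<forall>x\<in>J. dist (g x) (f x) < e"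
proof -
  have "open {h. \<forall>x\<in>J. h (id x) \<in> ball (f x) e}"
    by (rule product_topology_basis'[OF assms(2)]) auto
  moreover have "f \<in> {h. \<forall>x\<in>J. h (id x) \<in> ball (f x) e}" using assms by auto
  ultimately have "{h. \<forall>x\<in>J. h (id x) \<in> ball (f x) e} \<inter> A \<noteq> {}"
    using assms(1) open_Int_closure_eq_empty by blast
  then show ?thesis by (auto simp: dist_commute)
qed

context banach_over
begin

lemma dual_iff:
  "f \<in> dual smul \<longleftrightarrow> (\<forall>x y. f (x + y) = f x + f y) \<and> (\<forall>c x. f (smul c x) = c * f x) \<and>
     (\<exists>B. \<forall>x. norm (f x) \<le> B * norm x)"
  by (auto simp: dual_on_def)

lemma dualI:
  assumes "\<And>x y. f (x + y) = f x + f y" "\<And>c x. f (smul c x) = c * f x"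
    and "\<And>x. norm (f x) \<le> B * norm x"
  shows "f \<in> dual smul"
  using assms unfolding dual_iff by blast

lemma
  assumes "f \<in> dual smul"
  shows dual_add: "f (x + y) = f x + f y"
    and dual_smul: "f (smul c x) = c * f x"
    and dual_zero: "f 0 = 0"
    and dual_diff: "f (x - y) = f x - f y"
    and dual_bounded_linear: "bounded_linear f"
proof -
  show add: "f (x + y) = f x + f y" for x y using assms by (simp add: dual_iff)
  show mult: "f (smul c x) = c * f x" for c x using assms by (simp add: dual_iff)
  show z: "f 0 = 0" using add[of 0 0] by simp
  show "f (x - y) = f x - f y" by (metis add add_diff_cancel_right' diff_add_cancel)
  obtain B where "\<And>x. norm (f x) \<le> B * norm x" using assms by (auto simp: dual_iff)
  moreover have "f (r *\<^sub>R x) = r *\<^sub>R f x" for r x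
    using mult[of "of_real r" x] by (simp add: smul_of_real scaleR_conv_of_real)
  ultimately show "bounded_linear f"
    by (intro bounded_linear_intro[of f B]) (auto simp: add mult.commute)
qed

lemma dual_sum:
  assumes "f \<in> dual smul"
  shows "f (\<Sum>i\<in>I. smul (c i) (v i)) = (\<Sum>i\<in>I. c i * f (v i))"
  using assms
  by (induction I rule: infinite_finite_induct) (auto simp: dual_zero dual_add dual_smul)

lemma dual_bound:
  assumes "f \<in> dual smul"
  obtains B where "B > 0" "\<And>x. norm (f x) \<le> B * norm x"
proof -
  obtain B where B: "\<And>x. norm (f x) \<le> B * norm x" using assms by (auto simp: dual_iff)
  have "norm (f x) \<le> (\<bar>B\<bar> + 1) * norm x" for x
    by (rule order_trans[OF B mult_right_mono]) auto
  then show ?thesis using that[of "\<bar>B\<bar> + 1"] by simp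
qed

lemma continuous_on_dual: "f \<in> dual smul \<Longrightarrow> continuous_on S f"
  by (simp add: dual_bounded_linear linear_continuous_on)

lemma weak_star_closure:
  assumes "S \<subseteq> dual smul"
  shows "f \<in> weak_star smul closure_of S \<longleftrightarrow> f \<in> dual smul \<and>
    (\<forall>J e. finite J \<and> e > 0 \<longrightarrow> (\<exists>g\<in>S. \<forall>x\<in>J. dist (g x) (f x) < e))"
  unfolding closure_of_initial_topology[OF assms]
proof (intro conj_cong refl iffI allI impI)
  fix J :: "'a set" and e :: real
  assume *: "\<forall>J e. J \<subseteq> range (\<lambda>x f. f x) \<and> finite J \<and> e > 0 \<longrightarrow> (\<exists>y\<in>S. \<forall>h\<in>J. dist (h y) (h f) < e)"
    and J: "finite J \<and> e > 0"
  have "\<exists>y\<in>S. \<forall>h\<in>(\<lambda>x f. f x) ` J. dist (h y) (h f) < e"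
    using J by (intro *[rule_format]) auto
  then show "\<exists>g\<in>S. \<forall>x\<in>J. dist (g x) (f x) < e"
    by simp
next
  fix J :: "(('a \<Rightarrow> 'k) \<Rightarrow> 'k) set" and e :: real
  assume *: "\<forall>J e. finite J \<and> e > 0 \<longrightarrow> (\<exists>g\<in>S. \<forall>x\<in>J. dist (g x) (f x) < e)"
    and "J \<subseteq> range (\<lambda>x f. f x) \<and> finite J \<and> (e::real) > 0"
  then obtain I where "finite I" "J = (\<lambda>x f. f x) ` I" "e > 0" by (metis finite_subset_image)
  then show "\<exists>y\<in>S. \<forall>h\<in>J. dist (h y) (h f) < e" using * by auto
qed

lemma closedin_weak_star:
  "closedin (weak_star smul) E \<longleftrightarrow> E \<subseteq> dual smul \<and> (\<forall>f\<in>dual smul.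
    (\<forall>J e. finite J \<and> e > 0 \<longrightarrow> (\<exists>g\<in>E. \<forall>x\<in>J. dist (g x) (f x) < e)) \<longrightarrow> f \<in> E)"
proof (cases "E \<subseteq> dual smul")
  case True
  then show ?thesis
    using weak_star_closure[OF True]
    by (auto simp flip: closure_of_subset_eq)
next
  case False
  then show ?thesis using closedin_subset by force
qed

definition unit_ball :: "('a \<Rightarrow> 'k) set \<Rightarrow> ('a \<Rightarrow> 'k) set" where
  "unit_ball E = {f\<in>E. \<forall>x. norm (f x) \<le> norm x}"

text \<open>
  The Banach-Alaoglu theorem. A pointwise limit of functionals of norm at most one is again such a
  functional, so the ball is closed in a product of compact discs.
\<close>

lemma compact_unit_ball:
  assumes E: "closedin (weak_star smul) E"
  shows "compact (unit_ball E)"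
proof -
  let ?K = "Pi\<^sub>E UNIV (\<lambda>x::'a. cball (0::'k) (norm x))"
  let ?L = "{f::'a \<Rightarrow> 'k. (\<forall>x y. f (x + y) = f x + f y) \<and> (\<forall>c x. f (smul c x) = c * f x) \<and>
     (\<forall>x. norm (f x) \<le> norm x)}"
  have E': "E \<subseteq> dual smul" using E by (simp add: closedin_weak_star)
  have cont: "continuous_on UNIV (\<lambda>f::'a \<Rightarrow> 'k. f x)" for x
    by simp
  have "closed ?L"
    by (intro closed_Collect_conj closed_Collect_all closed_Collect_eq closed_Collect_le
        continuous_intros cont)
  moreover have "unit_ball E \<subseteq> ?L"
    using E' by (auto simp: unit_ball_def dual_add dual_smul)
  ultimately have sub: "closure (unit_ball E) \<subseteq> ?L" by (rule closure_minimal[rotated])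
  have "f \<in> unit_ball E" if f: "f \<in> closure (unit_ball E)" for f
  proof -
    have *: "f \<in> ?L" using f sub by blast
    then have "f \<in> dual smul" by (auto simp: dual_iff intro!: exI[of _ 1])
    moreover have "\<exists>g\<in>E. \<forall>x\<in>J. dist (g x) (f x) < e" if "finite J" "e > 0" for J e
      using closure_fun_approx[OF f that] by (auto simp: unit_ball_def)
    ultimately have "f \<in> E" using E by (simp add: closedin_weak_star)
    with * show ?thesis by (simp add: unit_ball_def)
  qed
  then have "closed (unit_ball E)"
    using closure_subset_eq by blast
  moreover have "compactin (product_topology (\<lambda>i. euclidean) UNIV) ?K"
    unfolding compactin_PiE by auto
  then have "compact ?K"
    by (simp add: euclidean_product_topology)
  moreover have "unit_ball E = ?K \<inter> unit_ball E"
    by (auto simp: unit_ball_def)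
  ultimately show ?thesis
    by (metis compact_Int_closed)
qed

lemma linear_space_combination:
  assumes "linear_space E" "f \<in> E" "g \<in> E"
  shows "(\<lambda>x. a * f x + b * g x) \<in> E"
proof -
  have "(\<lambda>x. a * f x) \<in> E" "(\<lambda>x. b * g x) \<in> E"
    using assms by (auto simp: linear_space_def)
  then show ?thesis using assms(1) by (fastforce simp: linear_space_def)
qed

lemma linear_space_diff:
  assumes "linear_space E" "f \<in> E" "g \<in> E"
  shows "(\<lambda>x. f x - g x) \<in> E"
  using linear_space_combination[OF assms, of 1 "-1"] by simp

lemma linear_space_dual: "linear_space (dual smul)"
  unfolding linear_space_def
proof (intro conjI ballI allI)
  show "(\<lambda>_. 0) \<in> dual smul" by (auto simp: dual_iff intro!: exI[of _ 0])
  fix f assume f: "f \<in> dual smul"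
  obtain B where B: "\<And>x. norm (f x) \<le> B * norm x" using dual_bound[OF f] by blast
  {
    fix g assume g: "g \<in> dual smul"
    obtain C where C: "\<And>x. norm (g x) \<le> C * norm x" using dual_bound[OF g] by blast
    have "norm (f x + g x) \<le> (B + C) * norm x" for x
      using norm_triangle_ineq[of "f x" "g x"] B[of x] C[of x] by (simp add: algebra_simps)
    then show "(\<lambda>x. f x + g x) \<in> dual smul"
      by (intro dualI[of _ "B + C"]) (simp_all add: dual_add[OF f] dual_add[OF g] dual_smul[OF f] dual_smul[OF g] algebra_simps)
  }
  fix c
  have "norm (c * f x) \<le> (norm c * B) * norm x" for x
    using mult_left_mono[OF B[of x], of "norm c"] by (simp add: norm_mult algebra_simps)
  then show "(\<lambda>x. c * f x) \<in> dual smul"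
    by (intro dualI[of _ "norm c * B"]) (simp_all add: dual_add[OF f] dual_smul[OF f] algebra_simps)
qed

lemma closedin_dual: "closedin (weak_star smul) (dual smul)"
  by (metis closedin_topspace topspace_initial_topology)

section \<open>Extending functionals within a weak-star closed space\<close>

lemma unit_ball_convex:
  assumes "linear_space E" "e \<in> unit_ball E" "e' \<in> unit_ball E" "0 \<le> t" "t \<le> 1"
  shows "(\<lambda>x. e x + of_real t * (e' x - e x)) \<in> unit_ball E"
proof -
  have "(\<lambda>x. e x + of_real t * (e' x - e x)) = (\<lambda>x. of_real (1 - t) * e x + of_real t * e' x)"
    by (auto simp: algebra_simps)
  moreover have "norm (of_real (1 - t) * e x + of_real t * e' x) \<le> norm x" for x
  proof -
    have "norm (of_real (1 - t) * e x + of_real t * e' x) \<le> (1 - t) * norm (e x) + t * norm (e' x)"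
      using assms by (intro norm_triangle_le) (simp add: norm_mult flip: of_real_diff del: of_real_diff)
    also have "\<dots> \<le> (1 - t) * norm x + t * norm x"
      using assms by (intro add_mono mult_left_mono) (auto simp: unit_ball_def)
    finally show ?thesis by (simp add: algebra_simps)
  qed
  ultimately show ?thesis
    using linear_space_combination[OF assms(1), of e e'] assms(2,3)
    by (auto simp: unit_ball_def simp del: of_real_diff)
qed

text \<open>
  Helly's theorem, by a least-squares argument. By compactness some \<open>e0\<close> in the ball minimises the squared
  distance to \<open>g\<close> on \<open>J\<close>. The first variation shows that \<open>e0\<close> maximises the real part at the vector
  \<open>y0 \<in> Y\<close> whose coefficients are the conjugate errors, while the value of \<open>e0\<close> at \<open>y0\<close> stays below that
  of \<open>g\<close> by the squared error. Since the ball norms \<open>y0\<close> up to \<open>C\<close> and \<open>g\<close> is bounded by \<open>1 / C\<close>, the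
  error is zero.
\<close>

lemma extension_on_finite_set:
  fixes g :: "'a \<Rightarrow> 'k"
  assumes E: "closedin (weak_star smul) E" "linear_space E"
    and Y: "subspace Y"
    and norming: "\<And>y d. y \<in> Y \<Longrightarrow> d > 0 \<Longrightarrow> \<exists>e\<in>unit_ball E. norm y \<le> C * norm (e y) + d"
    and C: "C > 0"
    and g: "\<And>x y. x \<in> Y \<Longrightarrow> y \<in> Y \<Longrightarrow> g (x + y) = g x + g y"
      "\<And>c y. y \<in> Y \<Longrightarrow> g (smul c y) = c * g y" "\<And>y. y \<in> Y \<Longrightarrow> C * norm (g y) \<le> norm y"
    and J: "finite J" "J \<subseteq> Y"
  shows "\<exists>e\<in>unit_ball E. \<forall>y\<in>J. e y = g y"
proof -
  have E': "E \<subseteq> dual smul" using E by (simp add: closedin_weak_star)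
  define \<Phi> where "\<Phi> e = (\<Sum>y\<in>J. (norm (e y - g y))\<^sup>2)" for e
  have "(\<lambda>_. 0) \<in> unit_ball E" using E by (simp add: unit_ball_def linear_space_def)
  moreover have "continuous_on UNIV \<Phi>"
    unfolding \<Phi>_def by (intro continuous_intros) auto
  ultimately obtain e0 where e0: "e0 \<in> unit_ball E" and min: "\<And>e. e \<in> unit_ball E \<Longrightarrow> \<Phi> e0 \<le> \<Phi> e"
    using continuous_attains_inf[OF compact_unit_ball[OF E(1)], of \<Phi>] continuous_on_subset by blast
  define a where "a y = e0 y - g y" for y
  define b where "b y = - scalar_cnj (a y)" for y
  define y0 where "y0 = (\<Sum>y\<in>J. smul (b y) y)"
  have y0: "y0 \<in> Y"
    unfolding y0_def using Y J by (intro subspace_sum subspace_scale) auto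
  have g0: "g 0 = 0" using g(1)[of 0 0] Y by (simp add: subspace_0)
  have gy0: "g y0 = (\<Sum>y\<in>J. (b y) * g y)"
    using J unfolding y0_def
  proof (induction J)
    case (insert y J)
    have "g (smul (b y) y + (\<Sum>y\<in>J. smul (b y) y)) =
        g (smul (b y) y) + g (\<Sum>y\<in>J. smul (b y) y)"
      using Y insert.prems by (intro g subspace_sum subspace_scale) auto
    then show ?case using insert g by auto
  qed (simp add: g0)
  define S where "S = (\<Sum>y\<in>J. (norm (a y))\<^sup>2)"
  have ey0: "e y0 = (\<Sum>y\<in>J. b y * e y)" if "e \<in> E" for e
    unfolding y0_def by (rule dual_sum) (use that E' in blast)
  have e0y0: "scalar_Re (e0 y0) = scalar_Re (g y0) - S"
  proof -
    have "e0 y0 - g y0 = (\<Sum>y\<in>J. - (scalar_cnj (a y) * a y))"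
      using e0 by (simp add: ey0 gy0 unit_ball_def a_def b_def algebra_simps flip: sum_subtractf)
    then have "scalar_Re (e0 y0 - g y0) = (\<Sum>y\<in>J. scalar_Re (- (scalar_cnj (a y) * a y)))"
      by (simp add: scalar_Re_sum)
    moreover have "scalar_Re (- z) = - scalar_Re z" for z :: 'k
      using scalar_Re_diff[of 0 z] by simp
    ultimately have "scalar_Re (e0 y0 - g y0) = - S"
      by (simp add: scalar_Re_cnj_mult S_def sum_negf)
    then show ?thesis by (simp add: scalar_Re_diff)
  qed
  have var: "scalar_Re (e y0) \<le> scalar_Re (e0 y0)" if e: "e \<in> unit_ball E" for e
  proof (rule ccontr)
    assume "\<not> scalar_Re (e y0) \<le> scalar_Re (e0 y0)"
    define u where "u = scalar_Re (e y0) - scalar_Re (e0 y0)"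
    have u: "u > 0" using \<open>\<not> _\<close> by (simp add: u_def)
    define V where "V = (\<Sum>y\<in>J. (norm (e y - e0 y))\<^sup>2)"
    have V: "V \<ge> 0" by (simp add: V_def sum_nonneg)
    \<comment> \<open>A step \<open>t\<close> so short that the quadratic term cannot compensate the linear one.\<close>
    define t where "t = min 1 (u / (V + 1))"
    have t: "0 < t" "t \<le> 1" using u V by (auto simp: t_def)
    have "t \<le> u / (V + 1)" by (simp add: t_def)
    then have "t * (V + 1) \<le> u" using V by (simp add: field_simps)
    then have tV: "t * V < 2 * u" using t u by (simp add: algebra_simps)
    have "u = scalar_Re (e y0 - e0 y0)" by (simp add: u_def scalar_Re_diff)
    also have "e y0 - e0 y0 = (\<Sum>y\<in>J. 0 - scalar_cnj (a y) * (e y - e0 y))"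
      using e e0 by (simp add: ey0 unit_ball_def b_def algebra_simps flip: sum_subtractf)
    also have "scalar_Re \<dots> = - (\<Sum>y\<in>J. scalar_Re (scalar_cnj (a y) * (e y - e0 y)))"
      by (simp only: scalar_Re_sum scalar_Re_diff) (simp add: sum_negf)
    finally have u': "(\<Sum>y\<in>J. scalar_Re (scalar_cnj (a y) * (e y - e0 y))) = - u" by simp
    have mulr: "scalar_Re (of_real t * z) = t * scalar_Re z" for z :: 'k
      by (simp add: scalar_Re_def to_complex_mult)
    have "\<Phi> e0 \<le> \<Phi> (\<lambda>x. e0 x + of_real t * (e x - e0 x))"
      using t by (intro min unit_ball_convex E e e0) auto
    also have "\<dots> = (\<Sum>y\<in>J. (norm (a y + of_real t * (e y - e0 y)))\<^sup>2)"
      by (simp add: \<Phi>_def a_def algebra_simps)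
    also have "\<dots> = (\<Sum>y\<in>J. (norm (a y))\<^sup>2 + 2 * (t * scalar_Re (scalar_cnj (a y) * (e y - e0 y))) +
        t\<^sup>2 * (norm (e y - e0 y))\<^sup>2)"
      using mulr by (simp add: norm_add_square norm_mult power_mult_distrib mult.left_commute[of _ "of_real t"])
    also have "\<dots> = \<Phi> e0 + 2 * (t * - u) + t\<^sup>2 * V"
      unfolding u'[symmetric] by (simp add: \<Phi>_def a_def V_def sum.distrib sum_distrib_left)
    finally have "2 * t * u \<le> t * (t * V)" by (simp add: power2_eq_square algebra_simps)
    also have "\<dots> < t * (2 * u)" using t tV by simp
    finally show False by simp
  qed
  have "S = 0"
  proof (rule ccontr)
    assume "S \<noteq> 0"
    then have S: "S > 0" by (simp add: S_def sum_nonneg order_less_le)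
    then obtain e where e: "e \<in> unit_ball E" and ney: "norm y0 \<le> C * norm (e y0) + C * S / 2"
      using norming[OF y0, of "C * S / 2"] C by auto
    obtain c where c: "norm c = 1" "c * e y0 = of_real (norm (e y0))"
      by (rule rotate_to_norm)
    have "(\<lambda>x. c * e x) \<in> unit_ball E"
      using e E c by (auto simp: unit_ball_def linear_space_def norm_mult)
    from var[OF this] have "norm (e y0) \<le> scalar_Re (g y0) - S"
      using c e0y0 by simp
    also have "\<dots> \<le> norm (g y0) - S" using scalar_Re_le_norm[of "g y0"] by simp
    finally have "C * norm (e y0) \<le> C * (norm (g y0) - S)" using C by simp
    then have "norm y0 \<le> norm y0 - C * S / 2"
      using ney g(3)[OF y0] by (simp add: algebra_simps)
    then show False using C S by (simp add: mult_le_0_iff)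
  qed
  then have "\<forall>y\<in>J. e0 y = g y"
    using J by (simp add: S_def sum_nonneg_eq_0_iff a_def)
  with e0 show ?thesis by blast
qed

lemma extension_in_unit_ball:
  fixes g :: "'a \<Rightarrow> 'k"
  assumes E: "closedin (weak_star smul) E" "linear_space E"
    and Y: "subspace Y"
    and norming: "\<And>y d. y \<in> Y \<Longrightarrow> d > 0 \<Longrightarrow> \<exists>e\<in>unit_ball E. norm y \<le> C * norm (e y) + d"
    and C: "C > 0"
    and g: "\<And>x y. x \<in> Y \<Longrightarrow> y \<in> Y \<Longrightarrow> g (x + y) = g x + g y"
      "\<And>c y. y \<in> Y \<Longrightarrow> g (smul c y) = c * g y" "\<And>y. y \<in> Y \<Longrightarrow> C * norm (g y) \<le> norm y"
  shows "\<exists>e\<in>unit_ball E. \<forall>y\<in>Y. e y = g y"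
proof -
  have "unit_ball E \<inter> (\<Inter>y\<in>Y. {e. e y = g y}) \<noteq> {}"
  proof (rule compact_imp_fip_image[OF compact_unit_ball[OF E(1)]])
    show "closed {e. e y = g y}" for y
      by (intro closed_Collect_eq continuous_intros) auto
    show "unit_ball E \<inter> (\<Inter>y\<in>J. {e. e y = g y}) \<noteq> {}" if "finite J" "J \<subseteq> Y" for J
      using extension_on_finite_set[OF E Y norming C g that] by blast
  qed
  then show ?thesis by blast
qed

text \<open>
  Taking \<open>E\<close> to be the whole dual, which norms \<open>X\<close> when \<open>D\<close> does, this replaces the Hahn-Banach
  theorem; with a smaller \<open>E\<close> it yields the surjectivity of restriction maps.
\<close>

lemma extension:
  fixes g :: "'a \<Rightarrow> 'k"
  assumes E: "closedin (weak_star smul) E" "linear_space E"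
    and Y: "subspace Y"
    and norming: "\<And>y d. y \<in> Y \<Longrightarrow> d > 0 \<Longrightarrow> \<exists>e\<in>unit_ball E. norm y \<le> C * norm (e y) + d"
    and C: "C > 0"
    and g: "\<And>x y. x \<in> Y \<Longrightarrow> y \<in> Y \<Longrightarrow> g (x + y) = g x + g y"
      "\<And>c y. y \<in> Y \<Longrightarrow> g (smul c y) = c * g y" "\<And>y. y \<in> Y \<Longrightarrow> norm (g y) \<le> B * norm y"
  shows "\<exists>e\<in>E. \<forall>y\<in>Y. e y = g y"
proof -
  define b where "b = C * (\<bar>B\<bar> + 1)"
  have b: "b > 0" using C by (simp add: b_def)
  have "norm (g y) \<le> (\<bar>B\<bar> + 1) * norm y" if "y \<in> Y" for y
    by (rule order_trans[OF g(3)[OF that] mult_right_mono]) auto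
  then have "C * norm (g y) \<le> b * norm y" if "y \<in> Y" for y
    unfolding b_def using that C by simp
  then have bd: "C * norm (of_real (1 / b) * g y) \<le> norm y" if "y \<in> Y" for y
  proof -
    have "C * norm (of_real (1 / b) * g y) = (C * norm (g y)) / b"
      using b by (simp add: norm_divide)
    also have "\<dots> \<le> norm y"
      using b \<open>\<And>y. y \<in> Y \<Longrightarrow> C * norm (g y) \<le> b * norm y\<close>[OF that] by (simp add: field_simps)
    finally show ?thesis .
  qed
  obtain e where e: "e \<in> unit_ball E" "\<forall>y\<in>Y. e y = of_real (1 / b) * g y"
    using extension_in_unit_ball[OF E Y norming C, of "\<lambda>y. of_real (1 / b) * g y"] bd g(1,2)
    by (auto simp: algebra_simps)
  then have "(\<lambda>x. of_real b * e x) \<in> E"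
    using E by (auto simp: unit_ball_def linear_space_def)
  then show ?thesis
    using e b by (intro bexI[of _ "\<lambda>x. of_real b * e x"]) auto
qed

section \<open>The bipolar theorem\<close>

text \<open>
  A linear form that vanishes where finitely many others vanish is a combination of these.
\<close>

lemma linear_dependence_on_finite_set:
  assumes "finite J" "linear_space E" "\<And>e. e \<in> E \<Longrightarrow> (\<forall>j\<in>J. e j = 0) \<Longrightarrow> e x = 0"
  shows "\<exists>c. \<forall>e\<in>E. e x = (\<Sum>j\<in>J. c j * (e j :: 'k))"
  using assms
proof (induction J arbitrary: E)
  case empty
  then show ?case by auto
next
  case (insert j J)
  define E' where "E' = {e\<in>E. e j = 0}"
  have "linear_space E'"
    using insert.prems by (auto simp: linear_space_def E'_def)
  then obtain c where c: "\<And>e. e \<in> E' \<Longrightarrow> e x = (\<Sum>j\<in>J. c j * e j)"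
    using insert.IH[of E'] insert.prems by (auto simp: E'_def)
  show ?case
  proof (cases "\<exists>e\<in>E. e j \<noteq> 0")
    case False
    then show ?thesis
      using c insert.hyps by (intro exI[of _ c]) (auto simp: E'_def)
  next
    case True
    then obtain e1 where e1: "e1 \<in> E" "e1 j \<noteq> 0" by blast
    define k where "k = (e1 x - (\<Sum>j\<in>J. c j * e1 j)) / e1 j"
    have "e x = (\<Sum>i\<in>insert j J. (c(j := k)) i * e i)" if e: "e \<in> E" for e
    proof -
      define r where "r = e j / e1 j"
      have "(\<lambda>x. 1 * e x + (- r) * e1 x) \<in> E'"
        using linear_space_combination[OF insert.prems(1) e e1(1), of 1 "- r"] e1
        by (simp add: E'_def r_def)
      from c[OF this] have "e x - r * e1 x = (\<Sum>j\<in>J. c j * e j) - r * (\<Sum>j\<in>J. c j * e1 j)"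
        by (simp add: sum_subtractf sum_distrib_left algebra_simps)
      then have "e x = r * (e1 x - (\<Sum>j\<in>J. c j * e1 j)) + (\<Sum>j\<in>J. c j * e j)"
        by (simp add: algebra_simps)
      moreover have "k * e j = r * (e1 x - (\<Sum>j\<in>J. c j * e1 j))"
        using e1 by (simp add: k_def r_def)
      moreover have "(\<Sum>i\<in>insert j J. (c(j := k)) i * e i) = k * e j + (\<Sum>j\<in>J. c j * e j)"
        using insert.hyps by (auto intro!: sum.cong)
      ultimately show ?thesis by simp
    qed
    then show ?thesis by blast
  qed
qed

text \<open>
  If no member of \<open>E\<close> vanishes on \<open>J\<close> but not at \<open>x\<close>, then on \<open>E\<close> the value at \<open>x\<close> is a combination
  of the values on \<open>J\<close>, and \<open>f\<close> obeys the same relation because it vanishes on the annihilator of \<open>E\<close>.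
\<close>

lemma interpolation_on_finite_set:
  assumes E: "E \<subseteq> dual smul" "linear_space E" and f: "f \<in> dual smul"
    and ann: "\<And>x. (\<forall>e\<in>E. e x = 0) \<Longrightarrow> f x = 0"
    and "finite J"
  shows "\<exists>e\<in>E. \<forall>x\<in>J. e x = f x"
  using \<open>finite J\<close>
proof induction
  case empty
  then show ?case using E by (auto simp: linear_space_def)
next
  case (insert x J)
  then obtain e where e: "e \<in> E" "\<forall>x\<in>J. e x = f x" by blast
  show ?case
  proof (cases "\<exists>e1\<in>E. (\<forall>j\<in>J. e1 j = 0) \<and> e1 x \<noteq> 0")
    case True
    then obtain e1 where e1: "e1 \<in> E" "\<forall>j\<in>J. e1 j = 0" "e1 x \<noteq> 0" by blast
    have "(\<lambda>y. 1 * e y + ((f x - e x) / e1 x) * e1 y) \<in> E"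
      by (rule linear_space_combination[OF E(2) e(1) e1(1)])
    then show ?thesis
      using e e1 by (rule_tac bexI) auto
  next
    case False
    then obtain c where c: "\<And>e. e \<in> E \<Longrightarrow> e x = (\<Sum>j\<in>J. c j * e j)"
      using linear_dependence_on_finite_set[OF insert.hyps(1) E(2)] by metis
    have *: "h (x - (\<Sum>j\<in>J. smul (c j) j)) = h x - (\<Sum>j\<in>J. c j * h j)" if "h \<in> dual smul" for h
      using dual_sum[OF that, of c "\<lambda>j. j" J] by (simp add: dual_diff[OF that])
    have "\<forall>h\<in>E. h (x - (\<Sum>j\<in>J. smul (c j) j)) = 0"
    proof
      fix h assume h: "h \<in> E"
      show "h (x - (\<Sum>j\<in>J. smul (c j) j)) = 0"
        using *[of h] c[OF h] h E(1) by auto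
    qed
    then have "f (x - (\<Sum>j\<in>J. smul (c j) j)) = 0" by (rule ann)
    then have "f x = (\<Sum>j\<in>J. c j * f j)" using *[OF f] by simp
    also have "\<dots> = e x" using c[OF e(1)] e(2) by simp
    finally have "f x = e x" .
    then show ?thesis using e by auto
  qed
qed

lemma bipolar:
  assumes E: "closedin (weak_star smul) E" "linear_space E" and f: "f \<in> dual smul"
    and ann: "\<And>x. (\<forall>e\<in>E. e x = 0) \<Longrightarrow> f x = 0"
  shows "f \<in> E"
proof -
  have E': "E \<subseteq> dual smul" using E by (simp add: closedin_weak_star)
  have "\<exists>g\<in>E. \<forall>x\<in>J. dist (g x) (f x) < e" if J: "finite J" and "e > 0" for J e
  proof -
    obtain g where "g \<in> E" "\<forall>x\<in>J. g x = f x"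
      using interpolation_on_finite_set[OF E' E(2) f ann J] by blast
    then show ?thesis using \<open>e > 0\<close> by (intro bexI[of _ g]) auto
  qed
  then show ?thesis using E(1) f by (simp add: closedin_weak_star)
qed

section \<open>Complementing a subspace by the annihilator of a dual one\<close>

text \<open>
  A form of the norming condition that mentions neither suprema nor operator norms, but near-optimal
  functionals in the unit ball.
\<close>

definition norms_up_to :: "real \<Rightarrow> ('a \<Rightarrow> 'k) set \<Rightarrow> bool" where
  "norms_up_to C D \<longleftrightarrow> C \<ge> 1 \<and> (\<forall>x d. d > 0 \<longrightarrow> (\<exists>f\<in>unit_ball D. norm x \<le> C * norm (f x) + d))"

lemma norming_imp_norms_up_to:
  assumes "D \<subseteq> dual smul" "linear_space D" "norming D"
  obtains C where "norms_up_to C D"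
proof -
  obtain C where C: "C \<ge> 1" "\<And>x. norm x \<le> C * (SUP f\<in>{f\<in>D. onorm f \<le> 1}. norm (f x))"
    using assms(3) by (auto simp: norming_def)
  have sub: "f \<in> unit_ball D" if "f \<in> D" "onorm f \<le> 1" for f
  proof -
    have "norm (f x) \<le> norm x" for x
    proof -
      have "norm (f x) \<le> onorm f * norm x"
        using assms(1) that by (intro onorm dual_bounded_linear) auto
      also have "\<dots> \<le> 1 * norm x" by (rule mult_right_mono) (use that in auto)
      finally show ?thesis by simp
    qed
    then show ?thesis using that by (simp add: unit_ball_def)
  qed
  have "\<exists>f\<in>unit_ball D. norm x \<le> C * norm (f x) + d" if d: "d > 0" for x d
  proof (rule ccontr)
    assume neg: "\<not> ?thesis"
    have "(SUP f\<in>{f\<in>D. onorm f \<le> 1}. norm (f x)) \<le> (norm x - d) / C"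
    proof (rule cSUP_least)
      have "(\<lambda>_. 0) \<in> {f\<in>D. onorm f \<le> 1}"
        using assms(2) by (simp add: linear_space_def onorm_zero)
      then show "{f\<in>D. onorm f \<le> 1} \<noteq> {}" by blast
      fix f assume "f \<in> {f\<in>D. onorm f \<le> 1}"
      then have "\<not> norm x \<le> C * norm (f x) + d" using neg sub by blast
      then show "norm (f x) \<le> (norm x - d) / C" using C(1) by (simp add: field_simps)
    qed
    then have "C * (SUP f\<in>{f\<in>D. onorm f \<le> 1}. norm (f x)) \<le> norm x - d"
      using C(1) by (simp add: field_simps)
    then show False using C(2)[of x] d by linarith
  qed
  then show ?thesis using that[of C] C(1) by (simp add: norms_up_to_def)
qed

lemma norms_up_to_mono:
  "norms_up_to C D \<Longrightarrow> D \<subseteq> D' \<Longrightarrow> norms_up_to C D'"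
  unfolding norms_up_to_def unit_ball_def by blast

text \<open>
  The functional \<open>z + c x \<mapsto> c\<close> on the span of \<open>Z\<close> and \<open>x\<close> is bounded because \<open>x\<close> has positive distance
  from \<open>Z\<close>.
\<close>

lemma separation:
  assumes C: "norms_up_to C (dual smul)" and Z: "closed Z" "subspace Z" and x: "x \<notin> Z"
  obtains f where "f \<in> dual smul" "f x = 1" "\<And>z. z \<in> Z \<Longrightarrow> f z = 0"
proof -
  obtain d where d: "d > 0" "\<And>z. z \<in> Z \<Longrightarrow> dist z x \<ge> d"
    using Z(1) x closed_def open_dist by (metis ComplI Compl_iff linorder_not_less)
  define Y where "Y = {v. \<exists>c. v - smul c x \<in> Z}"
  have uniq: "a = b" if "v - smul a x \<in> Z" "v - smul b x \<in> Z" for a b v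
  proof (rule ccontr)
    assume ne: "a \<noteq> b"
    have "(v - smul a x) - (v - smul b x) \<in> Z" using that Z(2) by (rule_tac subspace_diff)
    then have "smul (b - a) x \<in> Z" by (simp add: scale_left_diff_distrib)
    then have "smul (1 / (b - a)) (smul (b - a) x) \<in> Z" using Z(2) by (rule_tac subspace_scale)
    then show False using ne x by simp
  qed
  define g where "g v = (THE c. v - smul c x \<in> Z)" for v
  have g: "g v = c" if "v - smul c x \<in> Z" for v c
    unfolding g_def using that uniq by (intro the_equality) auto
  have Yg: "v - smul (g v) x \<in> Z" if "v \<in> Y" for v
    using that g by (auto simp: Y_def)
  have add: "(u + v) - smul (a + b) x \<in> Z" if "u - smul a x \<in> Z" "v - smul b x \<in> Z" for u v a b
    using subspace_add[OF Z(2) that] by (simp add: scale_left_distrib algebra_simps)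
  have mult: "smul c v - smul (c * a) x \<in> Z" if "v - smul a x \<in> Z" for v a c
    using subspace_scale[OF Z(2) that, of c] by (simp add: scale_right_diff_distrib)
  have "subspace Y"
    unfolding subspace_def
  proof (intro conjI allI ballI)
    show "0 \<in> Y" using subspace_0[OF Z(2)] by (auto simp: Y_def intro!: exI[of _ 0])
    show "u + v \<in> Y" if "u \<in> Y" "v \<in> Y" for u v
      using add that unfolding Y_def by blast
    show "smul c v \<in> Y" if "v \<in> Y" for c v
      using mult that unfolding Y_def by blast
  qed
  moreover have "norm (g v) \<le> (1 / d) * norm v" if "v \<in> Y" for v
  proof (cases "g v = 0")
    case False
    have "smul (- (1 / g v)) (v - smul (g v) x) \<in> Z"
      using Yg[OF that] Z(2) by (rule_tac subspace_scale)
    then have "d \<le> dist (smul (- (1 / g v)) (v - smul (g v) x)) x" by (rule d)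
    also have "\<dots> = norm (smul (1 / g v) v)"
      using False by (simp add: dist_norm scale_right_diff_distrib)
    also have "\<dots> = norm v / norm (g v)" by (simp add: norm_smul norm_divide)
    finally show ?thesis using False d by (simp add: field_simps)
  qed (use d in simp)
  moreover have "C > 0" using C by (simp add: norms_up_to_def)
  ultimately obtain f where f: "f \<in> dual smul" "\<forall>v\<in>Y. f v = g v"
    using extension[OF closedin_dual linear_space_dual, of Y C g "1 / d"] C add mult g Yg
    by (auto simp: norms_up_to_def)
  have x1: "x - smul 1 x \<in> Z" using subspace_0[OF Z(2)] by simp
  then have "x \<in> Y" unfolding Y_def by blast
  then have "f x = 1" using f(2) g[OF x1] by simp
  moreover have "f z = 0" if "z \<in> Z" for z
  proof -
    have z0: "z - smul 0 x \<in> Z" using that by simp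
    then have "z \<in> Y" unfolding Y_def by blast
    then show ?thesis using f(2) g[OF z0] by simp
  qed
  ultimately show ?thesis using that[of f] f(1) by blast
qed

lemma dual_limit:
  assumes "\<And>n. g n \<in> dual smul" "\<And>x. (\<lambda>n. g n x) \<longlonglongrightarrow> G x"
    and "\<And>x. norm (G x) \<le> B * norm x"
  shows "G \<in> dual smul"
proof (rule dualI)
  show "G (x + y) = G x + G y" for x y
  proof (rule LIMSEQ_unique[OF assms(2)])
    show "(\<lambda>n. g n (x + y)) \<longlonglongrightarrow> G x + G y"
      by (simp only: dual_add[OF assms(1)]) (intro tendsto_add assms)
  qed
  show "G (smul c x) = c * G x" for c x
  proof (rule LIMSEQ_unique[OF assms(2)])
    show "(\<lambda>n. g n (smul c x)) \<longlonglongrightarrow> c * G x"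
      by (simp only: dual_smul[OF assms(1)]) (intro tendsto_mult_left assms)
  qed
qed (rule assms(3))

text \<open>
  The uniform boundedness principle, by a gliding hump: from an unbounded \<open>W\<close> one builds
  partial sums \<open>g k\<close> of a geometric series of functionals whose \<open>k\<close>-th term is large at some \<open>w \<in> W\<close>, the sign of that
  term being chosen so that the earlier terms do not cancel it. The ratio \<open>1 / (8 C)\<close> makes the tail of
  the series smaller than half of what the \<open>k\<close>-th term contributes.
\<close>

lemma weakly_bounded_imp_bounded:
  assumes C: "norms_up_to C (dual smul)"
    and W: "\<And>f. f \<in> dual smul \<Longrightarrow> \<exists>B. \<forall>w\<in>W. norm (f w) \<le> B"
  shows "\<exists>B. \<forall>w\<in>W. norm w \<le> B"
proof (rule ccontr)
  assume "\<not> ?thesis"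
  then have unb: "\<exists>w\<in>W. norm w > B" for B by (meson linorder_not_less)
  have C1: "C \<ge> 1" using C by (simp add: norms_up_to_def)
  define r where "r = 1 / (8 * C)"
  have r: "r > 0" "r \<le> 1 / 8" using C1 by (auto simp: r_def field_simps)
  define Q where "Q k g g' \<longleftrightarrow> (\<forall>x. norm (g' x - g x) \<le> r ^ k * norm x) \<and>
    (\<exists>w\<in>W. norm (g' w) \<ge> r ^ k * norm w / (2 * C) \<and> r ^ k * norm w > 4 * C * (real k + 1))"
    for k and g g' :: "'a \<Rightarrow> 'k"
  have step: "\<exists>g'. g' \<in> dual smul \<and> Q k g g'" if g: "g \<in> dual smul" for g k
  proof -
    obtain w where w: "w \<in> W" "norm w > 4 * C * (real k + 1) / r ^ k" using unb by blast
    then have big: "r ^ k * norm w > 4 * C * (real k + 1)"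
      using r by (simp add: field_simps)
    moreover have "0 < 4 * C * (real k + 1)" using C1 by simp
    ultimately have "0 < r ^ k * norm w" by linarith
    then have "norm w / 2 > 0" using r by (simp add: zero_less_mult_iff)
    then obtain h where h: "h \<in> unit_ball (dual smul)" "norm w \<le> C * norm (h w) + norm w / 2"
      using C unfolding norms_up_to_def by blast
    have hw: "norm (h w) \<ge> norm w / (2 * C)"
      using h(2) C1 by (simp add: field_simps)
    have hd: "h \<in> dual smul" using h by (simp add: unit_ball_def)
    define v where "v = of_real (r ^ k) * h w"
    have nv: "norm v = r ^ k * norm (h w)" using r by (simp add: v_def norm_mult norm_power)
    have "norm v + norm v = norm ((g w + v) - (g w - v))"
      by (metis add_diff_cancel_left diff_minus_eq_add mult_2 norm_mult norm_numeral real_norm_def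
          diff_conv_add_uminus)
    also have "\<dots> \<le> norm (g w + v) + norm (g w - v)" by (rule norm_triangle_ineq4)
    finally have "norm v \<le> norm (g w + 1 * v) \<or> norm v \<le> norm (g w + (- 1) * v)" by auto
    then have "\<exists>s. norm s = 1 \<and> norm (g w + s * v) \<ge> norm v"
      by (metis norm_minus_cancel norm_one)
    then have "\<exists>s. norm s = 1 \<and> norm (g w + s * of_real (r ^ k) * h w) \<ge> r ^ k * norm (h w)"
      unfolding nv by (simp add: v_def mult.assoc)
    then obtain s where s: "norm s = 1" "norm (g w + s * of_real (r ^ k) * h w) \<ge> r ^ k * norm (h w)"
      by blast
    define g' where "g' x = 1 * g x + s * of_real (r ^ k) * h x" for x
    have "g' \<in> dual smul"
      unfolding g'_def by (rule linear_space_combination[OF linear_space_dual g hd])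
    moreover have "norm (g' x - g x) \<le> r ^ k * norm x" for x
    proof -
      have "norm (g' x - g x) = r ^ k * norm (h x)"
        using s r by (simp add: g'_def norm_mult norm_power)
      then show ?thesis using h(1) r by (simp add: unit_ball_def mult_left_mono)
    qed
    moreover have "norm (g' w) \<ge> r ^ k * norm w / (2 * C)"
    proof -
      have "r ^ k * (norm w / (2 * C)) \<le> r ^ k * norm (h w)" using hw r by (intro mult_left_mono) auto
      then show ?thesis using s(2) by (simp add: g'_def)
    qed
    ultimately show ?thesis using w big unfolding Q_def by blast
  qed
  obtain g where g: "\<And>k. g k \<in> dual smul" "\<And>k. Q k (g k) (g (Suc k))"
    using dependent_nat_choice[of "\<lambda>_ g. g \<in> dual smul" Q] step linear_space_dual
    unfolding linear_space_def by blast
  have gap: "norm (g (m + n) x - g m x) \<le> 2 * (r ^ m - r ^ (m + n)) * norm x" for m n x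
  proof (induction n)
    case (Suc n)
    have "norm (g (m + Suc n) x - g m x) \<le> norm (g (Suc (m + n)) x - g (m + n) x) + norm (g (m + n) x - g m x)"
      using norm_triangle_ineq[of "g (Suc (m + n)) x - g (m + n) x" "g (m + n) x - g m x"] by simp
    also have "\<dots> \<le> r ^ (m + n) * norm x + 2 * (r ^ m - r ^ (m + n)) * norm x"
      using g(2)[of "m + n"] Suc by (intro add_mono) (auto simp: Q_def)
    also have "\<dots> = (2 * r ^ m - r ^ (m + n)) * norm x" by (simp add: algebra_simps)
    also have "\<dots> \<le> 2 * (r ^ m - r ^ (m + Suc n)) * norm x"
    proof (rule mult_right_mono)
      have "r ^ (m + n) * (2 * r) \<le> r ^ (m + n) * 1" using r by (intro mult_left_mono) auto
      then show "2 * r ^ m - r ^ (m + n) \<le> 2 * (r ^ m - r ^ (m + Suc n))" by (simp add: mult_ac)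
    qed simp
    finally show ?case .
  qed simp
  have gap': "norm (g n x - g m x) \<le> 2 * r ^ m * norm x" if "n \<ge> m" for m n x
  proof -
    have "norm (g n x - g m x) \<le> 2 * (r ^ m - r ^ n) * norm x"
      using gap[of m "n - m" x] that by simp
    also have "\<dots> \<le> 2 * r ^ m * norm x" using r by (intro mult_right_mono) auto
    finally show ?thesis .
  qed
  have "convergent (\<lambda>n. g n x)" for x
  proof (rule Cauchy_convergent, unfold Cauchy_altdef2, intro allI impI)
    fix e :: real assume "e > 0"
    moreover have "(\<lambda>m. 2 * r ^ m * norm x) \<longlonglongrightarrow> 2 * 0 * norm x"
      using r by (intro tendsto_intros LIMSEQ_realpow_zero) auto
    ultimately have "\<forall>\<^sub>F m in sequentially. 2 * r ^ m * norm x < e"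
      by (simp add: order_tendstoD)
    then obtain m where m: "2 * r ^ m * norm x < e"
      using eventually_happens'[OF sequentially_bot] by blast
    have "dist (g n x) (g m x) < e" if "n \<ge> m" for n
      using gap'[OF that, of x] m by (simp add: dist_norm)
    then show "\<exists>m. \<forall>n\<ge>m. dist (g n x) (g m x) < e" by blast
  qed
  then obtain G where G: "\<And>x. (\<lambda>n. g n x) \<longlonglongrightarrow> G x"
    unfolding convergent_def by metis
  have lim: "norm (G x - g m x) \<le> 2 * r ^ m * norm x" for m x
  proof (rule tendsto_upperbound)
    show "(\<lambda>n. norm (g n x - g m x)) \<longlonglongrightarrow> norm (G x - g m x)"
      by (intro tendsto_intros G)
    show "\<forall>\<^sub>F n in sequentially. norm (g n x - g m x) \<le> 2 * r ^ m * norm x"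
      using gap' eventually_sequentially by auto
  qed simp
  obtain B0 where B0: "\<And>x. norm (g 0 x) \<le> B0 * norm x" using dual_bound[OF g(1)] by blast
  have "norm (G x) \<le> (B0 + 2) * norm x" for x
    using lim[of x 0] B0[of x] norm_triangle_ineq[of "G x - g 0 x" "g 0 x"]
    by (simp add: algebra_simps)
  then have "G \<in> dual smul" by (rule dual_limit[OF g(1) G])
  then obtain B where B: "\<And>w. w \<in> W \<Longrightarrow> norm (G w) \<le> B" using W by blast
  obtain k :: nat where k: "B < real k" using reals_Archimedean2 by blast
  obtain w where w: "w \<in> W" "norm (g (Suc k) w) \<ge> r ^ k * norm w / (2 * C)"
    "r ^ k * norm w > 4 * C * (real k + 1)"
    using g(2)[of k] unfolding Q_def by blast
  have "norm (g (Suc k) w) \<le> norm (G w) + norm (G w - g (Suc k) w)"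
    using norm_triangle_ineq4[of "G w" "G w - g (Suc k) w"] by simp
  moreover have "norm (G w - g (Suc k) w) \<le> r ^ k * norm w / (4 * C)"
    using lim[of w "Suc k"] by (simp add: r_def field_simps)
  ultimately have "r ^ k * norm w / (2 * C) - r ^ k * norm w / (4 * C) \<le> norm (G w)"
    using w(2) by linarith
  then have "r ^ k * norm w / (4 * C) \<le> norm (G w)"
    by (simp add: mult.commute)
  moreover have "r ^ k * norm w / (4 * C) > real k + 1"
    using w(3) C1 by (simp add: field_simps)
  ultimately show False using B[OF w(1)] k by linarith
qed

definition annihilator :: "('a \<Rightarrow> 'k) set \<Rightarrow> 'a set" where
  "annihilator E = {x. \<forall>e\<in>E. e x = 0}"

lemma subspace_annihilator: "E \<subseteq> dual smul \<Longrightarrow> subspace (annihilator E)"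
  unfolding subspace_def annihilator_def by (auto simp: dual_add dual_smul dual_zero subset_iff)

lemma closed_annihilator:
  assumes "E \<subseteq> dual smul" shows "closed (annihilator E)"
proof -
  have "closed {x. e x = 0}" if "e \<in> E" for e
    using that assms by (intro closed_Collect_eq continuous_on_dual continuous_on_const) auto
  moreover have "annihilator E = (\<Inter>e\<in>E. {x. e x = 0})" by (auto simp: annihilator_def)
  ultimately show ?thesis by auto
qed

lemma restrict_dual:
  assumes Y: "subspace Y" and f: "f \<in> dual smul"
  shows "restrict f Y \<in> dual_on smul Y"
proof -
  obtain B where "\<And>x. norm (f x) \<le> B * norm x" using dual_bound[OF f] by blast
  then show ?thesis
    using subspace_add[OF Y] subspace_scale[OF Y]
    unfolding dual_on_def by (auto simp: dual_add[OF f] dual_smul[OF f])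
qed

text \<open>
  The decomposition of \<open>X\<close> into \<open>Y\<close> and the annihilator \<open>N\<close> of \<open>E\<close>. The sum is direct, since the
  functionals in \<open>E\<close> restrict to all functionals on \<open>Y\<close>.
\<close>

lemma projection_onto_bijective_subspace:
  assumes C: "norms_up_to C (dual smul)"
    and E: "closedin (weak_star smul) E" "linear_space E"
    and Y: "closed Y" "subspace Y"
    and bij: "bij_betw (\<lambda>f. restrict f Y) E (dual_on smul Y)"
  obtains P where "bounded_projection smul P" "range P = Y" "\<And>x. P x = 0 \<longleftrightarrow> x \<in> annihilator E"
    "(\<lambda>f. f \<circ> P) ` dual smul = E"
proof -
  have E': "E \<subseteq> dual smul" using E by (simp add: closedin_weak_star)
  let ?N = "annihilator E"
  have N: "subspace ?N" "closed ?N"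
    using E' by (auto simp: subspace_annihilator closed_annihilator)
  have ext: "\<exists>e\<in>E. \<forall>y\<in>Y. e y = f y" if f: "f \<in> dual smul" for f
  proof -
    have "restrict f Y \<in> (\<lambda>f. restrict f Y) ` E"
      using bij restrict_dual[OF Y(2) f] unfolding bij_betw_def by blast
    then obtain e where "e \<in> E" "restrict e Y = restrict f Y"
      by auto
    then show ?thesis by (metis restrict_apply')
  qed
  have inj: "e = (\<lambda>_. 0)" if "e \<in> E" "\<And>y. y \<in> Y \<Longrightarrow> e y = 0" for e
  proof (rule inj_onD[of "\<lambda>f. restrict f Y" E])
    show "inj_on (\<lambda>f. restrict f Y) E" using bij by (simp add: bij_betw_def)
    show "restrict e Y = restrict (\<lambda>_. 0) Y" using that(2) by (auto simp: restrict_def)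
  qed (use that E in \<open>auto simp: linear_space_def\<close>)
  define W where "W = {smul (of_real (1 / norm (y + z))) y | y z. y \<in> Y \<and> z \<in> ?N \<and> y + z \<noteq> 0}"
  \<comment> \<open>On \<open>Y\<close> every functional agrees with a member of \<open>E\<close>, which does not see the \<open>z\<close>-component; hence \<open>W\<close> is weakly bounded.\<close>
  have "\<exists>B. \<forall>w\<in>W. norm w \<le> B"
  proof (rule weakly_bounded_imp_bounded[OF C])
    fix f assume "f \<in> dual smul"
    then obtain e where e: "e \<in> E" "\<forall>y\<in>Y. e y = f y" using ext by blast
    then have ed: "e \<in> dual smul" using E' by blast
    then obtain B where B: "\<And>x. norm (e x) \<le> B * norm x" using dual_bound by blast
    have "norm (f w) \<le> B" if "w \<in> W" for w
    proof -
      obtain y z where yz: "w = smul (of_real (1 / norm (y + z))) y" "y \<in> Y" "z \<in> ?N" "y + z \<noteq> 0"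
        using \<open>w \<in> W\<close> by (auto simp: W_def)
      have "w \<in> Y" using yz Y by (simp only: subspace_scale)
      then have "f w = e w" using e by simp
      also have "\<dots> = of_real (1 / norm (y + z)) * e (y + z)"
        using yz e by (simp add: dual_smul[OF ed] dual_add[OF ed] annihilator_def)
      finally have "norm (f w) = norm (e (y + z)) / norm (y + z)"
        by (simp add: norm_divide)
      also have "\<dots> \<le> B" using B[of "y + z"] yz(4) by (simp add: field_simps)
      finally show ?thesis .
    qed
    then show "\<exists>B. \<forall>w\<in>W. norm (f w) \<le> B" by blast
  qed
  then obtain B where B: "\<And>w. w \<in> W \<Longrightarrow> norm w \<le> B" by blast
  have trivial_meet: "y = 0" if "y \<in> Y" "y \<in> ?N" for y
  proof (rule ccontr)
    assume "y \<noteq> 0"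
    then obtain f where "f \<in> dual smul" "f y \<noteq> 0"
      using separation[OF C, of "{0}" y] by (metis closed_singleton singletonD subspace_single_0 zero_neq_one)
    then show False using ext that unfolding annihilator_def by fastforce
  qed
  have bound: "norm y \<le> B * norm (y + z)" if "y \<in> Y" "z \<in> ?N" for y z
  proof (cases "y + z = 0")
    case True
    then have "y = - z" by (simp add: eq_neg_iff_add_eq_0)
    then have "y \<in> ?N" using that subspace_neg[OF N(1)] by simp
    then have "y = 0" using that trivial_meet by blast
    then show ?thesis using True by simp
  next
    case False
    then have "norm (smul (of_real (1 / norm (y + z))) y) \<le> B"
      using that by (intro B) (auto simp: W_def)
    then show ?thesis using False by (simp add: norm_smul norm_divide field_simps)
  qed
  define Z where "Z = {y + z | y z. y \<in> Y \<and> z \<in> ?N}"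
  have "subspace Z" unfolding Z_def using subspace_sums[OF Y(2) N(1)] .
  moreover have "closed Z"
    unfolding closed_sequential_limits
  proof (intro allI impI)
    fix u l assume u: "(\<forall>n. u n \<in> Z) \<and> u \<longlonglongrightarrow> l"
    then have "\<forall>n. \<exists>y z. u n = y + z \<and> y \<in> Y \<and> z \<in> ?N" unfolding Z_def by blast
    then obtain y z where yz: "\<And>n. u n = y n + z n" "\<And>n. y n \<in> Y" "\<And>n. z n \<in> ?N" by metis
    have yb: "norm (y n - y m) \<le> (\<bar>B\<bar> + 1) * norm (u n - u m)" for n m
    proof -
      have "norm (y n - y m) \<le> B * norm ((y n - y m) + (z n - z m))"
        by (intro bound subspace_diff Y N yz)
      also have "\<dots> \<le> (\<bar>B\<bar> + 1) * norm ((y n - y m) + (z n - z m))"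
        by (intro mult_right_mono) auto
      finally show ?thesis by (simp add: yz(1) algebra_simps)
    qed
    have "Cauchy u" using u by (intro LIMSEQ_imp_Cauchy) auto
    have "Cauchy y"
    proof (rule metric_CauchyI)
      fix e :: real assume "e > 0"
      then have "e / (\<bar>B\<bar> + 1) > 0" by simp
      then obtain M where "\<forall>m\<ge>M. \<forall>n\<ge>M. dist (u m) (u n) < e / (\<bar>B\<bar> + 1)"
        using metric_CauchyD[OF \<open>Cauchy u\<close>] by blast
      then have "dist (y m) (y n) < e" if "m \<ge> M" "n \<ge> M" for m n
        using that yb[of m n] by (fastforce simp: dist_norm field_simps)
      then show "\<exists>M. \<forall>m\<ge>M. \<forall>n\<ge>M. dist (y m) (y n) < e" by blast
    qed
    then obtain a where a: "y \<longlonglongrightarrow> a" using Cauchy_convergent convergent_def by blast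
    then have "(\<lambda>n. u n - y n) \<longlonglongrightarrow> l - a" using u by (intro tendsto_diff) auto
    then have "z \<longlonglongrightarrow> l - a" by (simp add: yz(1))
    then have "l - a \<in> ?N" using N(2) yz(3) closed_sequentially by blast
    moreover have "a \<in> Y" using Y(1) yz(2) a closed_sequentially by blast
    moreover have "l = a + (l - a)" by simp
    ultimately show "l \<in> Z" unfolding Z_def by blast
  qed
  \<comment> \<open>The sum is all of \<open>X\<close>: a functional vanishing on \<open>Y\<close> and on the annihilator of \<open>E\<close> is in \<open>E\<close>, hence zero.\<close>
  ultimately have ZU: "x \<in> Z" for x
  proof (rule_tac ccontr)
    assume "x \<notin> Z"
    then obtain f where f: "f \<in> dual smul" "f x = 1" "\<And>z. z \<in> Z \<Longrightarrow> f z = 0"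
      using separation[OF C \<open>closed Z\<close> \<open>subspace Z\<close>] by metis
    have "n \<in> Z" if "n \<in> ?N" for n
      using that subspace_0[OF Y(2)] unfolding Z_def by force
    then have "f \<in> E" using f by (intro bipolar[OF E]) (auto simp: annihilator_def)
    moreover have "y \<in> Z" if "y \<in> Y" for y
      using that subspace_0[OF N(1)] unfolding Z_def by force
    ultimately have "f = (\<lambda>_. 0)" using f by (intro inj) auto
    then show False using f by simp
  qed
  have uniq: "y = y'" if "y \<in> Y" "y' \<in> Y" "x - y \<in> ?N" "x - y' \<in> ?N" for x y y'
  proof -
    have "(x - y') - (x - y) \<in> ?N" by (intro subspace_diff N that)
    moreover have "y - y' \<in> Y" by (intro subspace_diff Y that)
    ultimately have "y - y' = 0" by (intro trivial_meet) auto
    then show ?thesis by simp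
  qed
  have "\<exists>y. y \<in> Y \<and> x - y \<in> ?N" for x
    using ZU[of x] unfolding Z_def by force
  then obtain P where P: "\<And>x. P x \<in> Y" "\<And>x. x - P x \<in> ?N" by metis
  have Peq: "P x = y" if "y \<in> Y" "x - y \<in> ?N" for x y using uniq P that by blast
  have add: "P (x + y) = P x + P y" for x y
  proof (rule Peq)
    show "P x + P y \<in> Y" by (intro subspace_add Y P)
    have "(x - P x) + (y - P y) \<in> ?N" by (intro subspace_add N P)
    then show "x + y - (P x + P y) \<in> ?N" by (simp add: algebra_simps)
  qed
  have mult: "P (smul c x) = smul c (P x)" for c x
  proof (rule Peq)
    show "smul c (P x) \<in> Y" by (intro subspace_scale Y P)
    have "smul c (x - P x) \<in> ?N" by (intro subspace_scale N P)
    then show "smul c x - smul c (P x) \<in> ?N" by (simp add: scale_right_diff_distrib)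
  qed
  have nrm: "norm (P x) \<le> norm x * B" for x
    using bound[OF P(1)[of x] P(2)[of x]] by (simp add: mult.commute)
  have id: "P y = y" if "y \<in> Y" for y
    using that subspace_0[OF N(1)] by (intro Peq) auto
  have lin: "bounded_linear P"
    using mult[of "of_real _"] by (intro bounded_linear_intro[of P B] add nrm) (simp add: smul_of_real)
  show ?thesis
  proof
    show "bounded_projection smul P"
      unfolding bounded_projection_def using lin mult P id by auto
    show "range P = Y"
    proof (intro equalityI subsetI)
      show "y \<in> range P" if "y \<in> Y" for y using id[OF that] by (metis rangeI)
    qed (use P in auto)
    show "P x = 0 \<longleftrightarrow> x \<in> ?N" for x
      using P(2)[of x] Peq[of 0 x] subspace_0[OF Y(2)] by auto
    show "(\<lambda>f. f \<circ> P) ` dual smul = E"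
    proof (intro equalityI subsetI)
      fix e assume e: "e \<in> E"
      then have "e x = e (P x)" for x
        using P(2)[of x] E' by (auto simp: annihilator_def dual_diff subset_iff)
      then have "e = e \<circ> P" by auto
      then show "e \<in> (\<lambda>f. f \<circ> P) ` dual smul" using e E' by blast
    next
      fix h assume "h \<in> (\<lambda>f. f \<circ> P) ` dual smul"
      then obtain f where f: "f \<in> dual smul" "h = f \<circ> P" by blast
      obtain e where e: "e \<in> E" "\<forall>y\<in>Y. e y = f y" using ext[OF f(1)] by blast
      have "e x = h x" for x
        using P[of x] E' e by (auto simp: f annihilator_def dual_diff subset_iff)
      then have "e = h" by auto
      then show "h \<in> E" using e by simp
    qed
  qed
qed

end

section \<open>Closing a set under a finitary operation with countable values\<close>

lemma countable_inj_vimage: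
  assumes "countable A" "inj f"
  shows "countable (f -` A)"
proof (rule countable_image_inj_on)
  show "countable (f ` (f -` A))"
    by (rule countable_subset[OF _ assms(1)]) auto
  show "inj_on f (f -` A)" using assms(2) by (rule inj_on_subset) simp
qed

lemma finite_subset_incseq_UN:
  assumes "finite F" "F \<subseteq> (\<Union>n. B n)" "incseq B"
  shows "\<exists>n. F \<subseteq> B (n::nat)"
  using assms(1,2)
proof induction
  case (insert x F)
  then obtain n m where "F \<subseteq> B n" "x \<in> B m" by auto
  then have "insert x F \<subseteq> B (max n m)"
    using incseqD[OF assms(3), of n "max n m"] incseqD[OF assms(3), of m "max n m"] by auto
  then show ?case by blast
qed simp

definition closing_step :: "('m set \<Rightarrow> 'm set) \<Rightarrow> 'm set \<Rightarrow> 'm set" where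
  "closing_step c B = B \<union> (\<Union>F\<in>{F. finite F \<and> F \<subseteq> B}. c F)"

text \<open>
  The operation \<open>c\<close> sees only finite sets, so \<open>\<omega>\<close> many steps reach a closed set.
\<close>

definition generated :: "('m set \<Rightarrow> 'm set) \<Rightarrow> 'm set \<Rightarrow> 'm set" where
  "generated c A = (\<Union>n. (closing_step c ^^ n) A)"

lemma incseq_closing_steps: "incseq (\<lambda>n. (closing_step c ^^ n) A)"
  by (intro incseq_SucI) (auto simp: closing_step_def)

lemma generated_superset: "A \<subseteq> generated c A"
  unfolding generated_def using UN_upper[of 0 UNIV "\<lambda>n. (closing_step c ^^ n) A"] by simp

lemma generated_closed:
  assumes "finite F" "F \<subseteq> generated c A"
  shows "c F \<subseteq> generated c A"
proof -
  obtain n where "F \<subseteq> (closing_step c ^^ n) A"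
    using finite_subset_incseq_UN[OF assms(1) assms(2)[unfolded generated_def] incseq_closing_steps] ..
  then have "c F \<subseteq> (closing_step c ^^ Suc n) A"
    using assms(1) by (auto simp: closing_step_def)
  then show ?thesis unfolding generated_def by blast
qed

lemma closing_step_UN:
  assumes "incseq B"
  shows "closing_step c (\<Union>n. B n) = (\<Union>n. closing_step c (B n))"
proof
  show "closing_step c (\<Union>n. B n) \<subseteq> (\<Union>n. closing_step c (B n))"
  proof
    fix x assume "x \<in> closing_step c (\<Union>n. B n)"
    then consider n where "x \<in> B n" | F where "finite F" "F \<subseteq> (\<Union>n. B n)" "x \<in> c F"
      by (auto simp: closing_step_def)
    then show "x \<in> (\<Union>n. closing_step c (B n))"
    proof cases
      case 2
      obtain n where "F \<subseteq> B n" using finite_subset_incseq_UN[OF 2(1,2) assms] ..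
      then have "x \<in> closing_step c (B n)" unfolding closing_step_def using 2 by blast
      then show ?thesis by blast
    qed (auto simp: closing_step_def)
  qed
  show "(\<Union>n. closing_step c (B n)) \<subseteq> closing_step c (\<Union>n. B n)"
  proof (rule UN_least)
    show "closing_step c (B n) \<subseteq> closing_step c (\<Union>n. B n)" for n
      unfolding closing_step_def by blast
  qed
qed

lemma closing_step_mono: "A \<subseteq> B \<Longrightarrow> closing_step c A \<subseteq> closing_step c B"
  unfolding closing_step_def by blast

lemma closing_steps_mono: "A \<subseteq> B \<Longrightarrow> (closing_step c ^^ n) A \<subseteq> (closing_step c ^^ n) B"
  by (induction n) (auto intro: closing_step_mono[THEN subsetD])

lemma generated_mono: "A \<subseteq> B \<Longrightarrow> generated c A \<subseteq> generated c B"
  unfolding generated_def by (intro UN_mono closing_steps_mono subset_refl)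

lemma generated_UN:
  assumes "incseq A"
  shows "generated c (\<Union>n. A n) = (\<Union>n. generated c (A n))"
proof -
  have "(closing_step c ^^ k) (\<Union>n. A n) = (\<Union>n. (closing_step c ^^ k) (A n))" for k
  proof (induction k)
    case (Suc k)
    have "incseq (\<lambda>n. (closing_step c ^^ k) (A n))"
      using assms by (auto simp: incseq_def closing_steps_mono)
    then show ?case by (simp add: Suc closing_step_UN)
  qed simp
  then show ?thesis unfolding generated_def by auto
qed

lemma generated_countable:
  assumes c: "\<And>F. finite F \<Longrightarrow> F \<subseteq> M \<Longrightarrow> c F \<in> countable_subsets M"
    and A: "A \<in> countable_subsets M"
  shows "generated c A \<in> countable_subsets M"
proof -
  have "(closing_step c ^^ n) A \<in> countable_subsets M" for n
  proof (induction n)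
    case (Suc n)
    define B where "B = (closing_step c ^^ n) A"
    have B: "countable B" "B \<subseteq> M" using Suc by (auto simp: B_def countable_subsets_def)
    have "countable {F. finite F \<and> F \<subseteq> B}"
      using B(1) by (rule countable_Collect_finite_subset)
    moreover have cF: "countable (c F)" "c F \<subseteq> M" if "F \<in> {F. finite F \<and> F \<subseteq> B}" for F
      using c[of F] B that by (auto simp: countable_subsets_def)
    ultimately have "countable (closing_step c B)"
      unfolding closing_step_def using B(1) by (intro countable_Un countable_UN) auto
    moreover have "closing_step c B \<subseteq> M"
      unfolding closing_step_def using B(2) cF(2) by blast
    ultimately show ?case by (simp add: countable_subsets_def B_def)
  qed (use A in simp)
  then show ?thesis by (auto simp: generated_def countable_subsets_def)
qed

lemma omega_monotoneI:
  assumes "\<And>A. A \<in> countable_subsets M1 \<Longrightarrow> \<phi> A \<in> countable_subsets M2"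
    and "\<And>A B. A \<in> countable_subsets M1 \<Longrightarrow> B \<in> countable_subsets M1 \<Longrightarrow> A \<subseteq> B \<Longrightarrow> \<phi> A \<subseteq> \<phi> B"
    and "\<And>A :: nat \<Rightarrow> _. (\<And>n. A n \<in> countable_subsets M1) \<Longrightarrow> incseq A \<Longrightarrow> \<phi> (\<Union>n. A n) = (\<Union>n. \<phi> (A n))"
  shows "omega_monotone M1 M2 \<phi>"
  unfolding omega_monotone_def using assms by (simp add: image_subset_iff)

lemma omega_monotone_countable:
  "omega_monotone M1 M2 \<phi> \<Longrightarrow> A \<in> countable_subsets M1 \<Longrightarrow> \<phi> A \<in> countable_subsets M2"
  unfolding omega_monotone_def by (simp add: image_subset_iff)

lemma omega_monotone_mono:
  "omega_monotone M1 M2 \<phi> \<Longrightarrow> A \<in> countable_subsets M1 \<Longrightarrow> B \<in> countable_subsets M1 \<Longrightarrow> A \<subseteq> B \<Longrightarrow> \<phi> A \<subseteq> \<phi> B"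
  unfolding omega_monotone_def by simp

lemma omega_monotone_UN:
  "omega_monotone M1 M2 \<phi> \<Longrightarrow> (\<And>n. A n \<in> countable_subsets M1) \<Longrightarrow> incseq A \<Longrightarrow> \<phi> (\<Union>n::nat. A n) = (\<Union>n. \<phi> (A n))"
  unfolding omega_monotone_def by simp

lemma omega_monotone_generated:
  assumes "\<And>F. finite F \<Longrightarrow> F \<subseteq> M \<Longrightarrow> c F \<in> countable_subsets M"
  shows "omega_monotone M M (generated c)"
  by (intro omega_monotoneI generated_countable generated_mono generated_UN assms)

text \<open>
  Used with \<open>a f\<close> the closed sets attached to a functional \<open>f\<close>: networks indexed by countable
  families of closed sets become networks indexed by countable sets of functionals.
\<close>

lemma omega_monotone_UN_index:
  assumes N: "omega_monotone M1 M2 N" and a: "\<And>f. f \<in> D \<Longrightarrow> a f \<in> countable_subsets M1"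
  shows "omega_monotone D M2 (\<lambda>A. N (\<Union>f\<in>A. a f))"
proof -
  have cs: "(\<Union>f\<in>A. a f) \<in> countable_subsets M1" if "A \<in> countable_subsets D" for A
    using that a by (fastforce simp: countable_subsets_def)
  have mono: "(\<Union>f\<in>A. a f) \<subseteq> (\<Union>f\<in>B. a f)" if "A \<subseteq> B" for A B
    using that by blast
  show ?thesis
  proof (rule omega_monotoneI)
    show "N (\<Union>f\<in>A. a f) \<in> countable_subsets M2" if "A \<in> countable_subsets D" for A
      by (intro omega_monotone_countable[OF N] cs that)
    show "N (\<Union>f\<in>A. a f) \<subseteq> N (\<Union>f\<in>B. a f)"
      if "A \<in> countable_subsets D" "B \<in> countable_subsets D" "A \<subseteq> B" for A B
      by (intro omega_monotone_mono[OF N] cs mono that)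
    fix A :: "nat \<Rightarrow> _" assume A: "\<And>n. A n \<in> countable_subsets D" "incseq A"
    have "incseq (\<lambda>n. \<Union>f\<in>A n. a f)"
      using A(2) mono by (simp add: incseq_def)
    then have "N (\<Union>n. \<Union>f\<in>A n. a f) = (\<Union>n. N (\<Union>f\<in>A n. a f))"
      by (intro omega_monotone_UN[OF N] cs A)
    then show "N (\<Union>f\<in>\<Union>n. A n. a f) = (\<Union>n. N (\<Union>f\<in>A n. a f))"
      by simp
  qed
qed

text \<open>
  Every element of a value is already produced by a finite set. This turns \<open>\<omega>\<close>-monotone
  mappings into the finitary operations to which \<open>generated\<close> applies.
\<close>

lemma omega_monotone_finite_support:
  assumes N: "omega_monotone M1 M2 N" and A: "A \<in> countable_subsets M1" and x: "x \<in> N A"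
  obtains F where "finite F" "F \<subseteq> A" "x \<in> N F"
proof (cases "A = {}")
  case True
  then show ?thesis using that[of "{}"] x by simp
next
  case False
  define F where "F n = from_nat_into A ` {..n}" for n
  have FA: "F n \<subseteq> A" for n
    unfolding F_def by (intro image_subsetI from_nat_into False)
  have "incseq F" by (auto simp: incseq_def F_def)
  moreover have "F n \<in> countable_subsets M1" for n
    using FA[of n] A by (auto simp: countable_subsets_def dest: countable_subset)
  ultimately have "N (\<Union>n. F n) = (\<Union>n. N (F n))"
    by (intro omega_monotone_UN[OF N])
  moreover have "(\<Union>n. F n) = A"
  proof
    show "A \<subseteq> (\<Union>n. F n)"
    proof
      fix a assume "a \<in> A"
      then obtain n where "from_nat_into A n = a"
        using A from_nat_into_surj by (fastforce simp: countable_subsets_def)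
      then show "a \<in> (\<Union>n. F n)" by (auto simp: F_def)
    qed
  qed (use FA in blast)
  ultimately obtain n where "x \<in> N (F n)" using x by auto
  then show ?thesis using that[of "F n"] FA by (simp add: F_def)
qed

section \<open>Closed spans\<close>

context banach_over
begin

text \<open>
  Closing a countable set under addition and multiplication by a countable dense set of scalars keeps it
  countable, and is enough to make its closure a subspace.
\<close>

lemma closure_subspace_of_dense_combinations:
  assumes "0 \<in> B" "\<And>x y. x \<in> B \<Longrightarrow> y \<in> B \<Longrightarrow> x + y \<in> B"
    and "\<And>q x. q \<in> dense_scalars \<Longrightarrow> x \<in> B \<Longrightarrow> smul q x \<in> B"
  shows "subspace (closure B)"
  unfolding subspace_def
proof (intro conjI allI ballI)
  show "0 \<in> closure B" using assms(1) closure_subset by blast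
  fix x assume x: "x \<in> closure B"
  {
    fix y assume y: "y \<in> closure B"
    obtain u v where uv: "\<And>n. u n \<in> B" "u \<longlonglongrightarrow> x" "\<And>n. v n \<in> B" "v \<longlonglongrightarrow> y"
      using x y unfolding closure_sequential by blast
    then have "(\<lambda>n. u n + v n) \<longlonglongrightarrow> x + y" by (intro tendsto_add)
    then show "x + y \<in> closure B"
      unfolding closure_sequential by (intro exI[of _ "\<lambda>n. u n + v n"] conjI allI assms(2) uv)
  }
  fix c
  show "smul c x \<in> closure B"
    unfolding closure_approachable
  proof (intro allI impI)
    fix e :: real assume e: "e > 0"
    define d where "d = e / (2 * (norm c + 1))"
    have c: "norm c + 1 > 0" using norm_ge_zero[of c] by linarith
    then have d: "d > 0" using e by (simp add: d_def)
    then obtain z where z: "z \<in> B" "dist z x < d"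
      using x unfolding closure_approachable by blast
    have z1: "norm z + 1 > 0" using norm_ge_zero[of z] by linarith
    then have "e / (2 * (norm z + 1)) > 0" using e by simp
    then obtain q where q: "q \<in> dense_scalars" "dist q c < e / (2 * (norm z + 1))"
      using dense_scalars_approx by blast
    have "smul q z - smul c x = smul (q - c) z + smul c (z - x)"
      by (simp add: scale_left_diff_distrib scale_right_diff_distrib)
    then have "dist (smul q z) (smul c x) \<le> norm (q - c) * norm z + norm c * norm (z - x)"
      by (metis dist_norm norm_smul norm_triangle_ineq)
    also have "\<dots> \<le> norm (q - c) * (norm z + 1) + (norm c + 1) * norm (z - x)"
      by (simp add: algebra_simps)
    also have "norm (q - c) * (norm z + 1) < e / 2"
      using q(2) z1 by (simp add: dist_norm field_simps)
    also have "(norm c + 1) * norm (z - x) < e / 2"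
      using z(2) c by (simp add: dist_norm d_def field_simps)
    finally have "dist (smul q z) (smul c x) < e" by simp
    then show "\<exists>y\<in>B. dist y (smul c x) < e" using assms(3) q(1) z(1) by blast
  qed
qed

lemma closure_eq_closed_span:
  assumes "0 \<in> B" "\<And>x y. x \<in> B \<Longrightarrow> y \<in> B \<Longrightarrow> x + y \<in> B"
    and "\<And>q x. q \<in> dense_scalars \<Longrightarrow> x \<in> B \<Longrightarrow> smul q x \<in> B"
  shows "closure B = closed_span smul B"
proof
  show "closure B \<subseteq> closed_span smul B"
    by (intro closure_mono span_superset)
  have "span B \<subseteq> closure B"
    using assms by (intro span_minimal closure_subset closure_subspace_of_dense_combinations)
  then show "closed_span smul B \<subseteq> closure B"
    by (simp add: closure_minimal)
qed

lemma subspace_closed_span: "subspace (closed_span smul S)"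
  by (intro closure_subspace_of_dense_combinations)
    (auto intro: span_zero span_add span_scale)

lemma countable_dense_in_closed_span:
  assumes "countable S"
  obtains B where "countable B" "closure B = closed_span smul S" "S \<subseteq> B"
proof -
  define c where "c F = {0} \<union> (\<lambda>(x, y). x + y) ` (F \<times> F) \<union> (\<lambda>(q, x). smul q x) ` (dense_scalars \<times> F)" for F
  define B where "B = generated c S"
  have "c F \<in> countable_subsets (span S)" if "finite F" "F \<subseteq> span S" for F
  proof -
    have "countable (c F)"
      unfolding c_def using that countable_dense_scalars
      by (intro countable_Un countable_image countable_SIGMA) (auto intro: countable_finite)
    moreover have "c F \<subseteq> span S"
      using that by (auto simp: c_def intro: span_zero span_add span_scale)
    ultimately show ?thesis by (simp add: countable_subsets_def)
  qed
  then have cB: "B \<in> countable_subsets (span S)"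
    unfolding B_def using assms span_superset by (intro generated_countable) (auto simp: countable_subsets_def)
  have SB: "S \<subseteq> B" by (simp add: B_def generated_superset)
  have cF: "c F \<subseteq> B" if "finite F" "F \<subseteq> B" for F
    using that generated_closed unfolding B_def by blast
  have "0 \<in> B" using cF[of "{}"] by (auto simp: c_def)
  moreover have "x + y \<in> B" if "x \<in> B" "y \<in> B" for x y
    using cF[of "{x, y}"] that by (auto simp: c_def)
  moreover have "smul q x \<in> B" if "q \<in> dense_scalars" "x \<in> B" for q x
    using cF[of "{x}"] that by (auto simp: c_def)
  ultimately have eq: "closure B = closed_span smul B" by (rule closure_eq_closed_span)
  have "span B \<subseteq> span S"
    using cB by (intro span_minimal) (auto simp: countable_subsets_def)
  moreover have "span S \<subseteq> span B" using SB by (rule span_mono)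
  ultimately have "closure B = closed_span smul S" using eq by simp
  then show ?thesis using that[of B] cB SB by (simp add: countable_subsets_def)
qed

lemma closed_span_UN:
  assumes "incseq V"
  shows "closed_span smul (\<Union>n. V n) = closure (\<Union>n. closed_span smul (V n))"
proof
  have "subspace (\<Union>n. span (V n))"
    unfolding subspace_def
  proof (intro conjI allI ballI)
    fix x assume x: "x \<in> (\<Union>n. span (V n))"
    {
      fix y assume "y \<in> (\<Union>n. span (V n))"
      then obtain n m where "x \<in> span (V n)" "y \<in> span (V m)" using x by blast
      moreover have "span (V n) \<subseteq> span (V (max n m))" "span (V m) \<subseteq> span (V (max n m))"
        using incseqD[OF assms] by (simp_all add: span_mono)
      ultimately have "x + y \<in> span (V (max n m))" by (intro span_add) auto
      then show "x + y \<in> (\<Union>n. span (V n))" by blast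
    }
    show "smul c x \<in> (\<Union>n. span (V n))" for c
      using x span_scale by blast
  qed (auto intro: span_zero)
  then have "span (\<Union>n. V n) \<subseteq> (\<Union>n. span (V n))"
    using span_superset by (intro span_minimal) blast
  also have "\<dots> \<subseteq> (\<Union>n. closed_span smul (V n))"
    using closure_subset by blast
  finally show "closed_span smul (\<Union>n. V n) \<subseteq> closure (\<Union>n. closed_span smul (V n))"
    by (rule closure_mono)
  have "closed_span smul (V n) \<subseteq> closed_span smul (\<Union>n. V n)" for n
    by (intro closure_mono span_mono) blast
  then show "closure (\<Union>n. closed_span smul (V n)) \<subseteq> closed_span smul (\<Union>n. V n)"
    by (intro closure_minimal) auto
qed

lemma separable_closed_span:
  assumes "countable S"
  shows "separable_space (top_of_set (closed_span smul S))"
proof -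
  obtain B where B: "countable B" "closure B = closed_span smul S"
    using countable_dense_in_closed_span[OF assms] by metis
  then have "B \<subseteq> closed_span smul S" using closure_subset by blast
  then show ?thesis
    unfolding separable_space_def using B
    by (intro exI[of _ B]) (auto simp: closure_of_subtopology Int_absorb1)
qed

section \<open>From monotone dual pairs to a skeleton\<close>

abbreviation functional_closure :: "(('a \<Rightarrow> 'k) + 'a) set \<Rightarrow> ('a \<Rightarrow> 'k) set" where
  "functional_closure B \<equiv> weak_star smul closure_of functional_part B"

abbreviation vector_closure :: "(('a \<Rightarrow> 'k) + 'a) set \<Rightarrow> 'a set" where
  "vector_closure B \<equiv> closed_span smul (vector_part B)"

text \<open>
  The subspaces \<open>E\<close> and \<open>Y\<close> encoded by a countable subset of the disjoint union of \<open>D\<close> and \<open>X\<close> are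
  required to be in duality by restriction.
\<close>

definition dual_pair :: "(('a \<Rightarrow> 'k) + 'a) set \<Rightarrow> bool" where
  "dual_pair B \<longleftrightarrow> linear_space (functional_closure B) \<and>
     bij_betw (\<lambda>f. restrict f (vector_closure B)) (functional_closure B) (dual_on smul (vector_closure B))"

definition monotone_dual_pairs :: "('a \<Rightarrow> 'k) set \<Rightarrow> bool" where
  "monotone_dual_pairs D \<longleftrightarrow> (\<exists>\<psi>. omega_monotone (D <+> UNIV) (D <+> UNIV) \<psi> \<and>
     (\<forall>A \<in> countable_subsets (D <+> UNIV). A \<subseteq> \<psi> A \<and> functional_closure (\<psi> A) \<subseteq> D \<and> dual_pair (\<psi> A)))"

definition monotone_dual_pairs_over_vectors :: "('a \<Rightarrow> 'k) set \<Rightarrow> bool" where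
  "monotone_dual_pairs_over_vectors D \<longleftrightarrow> (\<exists>\<theta>. omega_monotone (UNIV :: 'a set) (D <+> UNIV) \<theta> \<and>
     D = (\<Union>A \<in> countable_subsets UNIV. functional_closure (\<theta> A)) \<and>
     (\<forall>A \<in> countable_subsets UNIV. Inr ` A \<subseteq> \<theta> A \<and> dual_pair (\<theta> A)))"

text \<open>
  Two spaces that restrict bijectively onto the same dual, one contained in the other, are equal.
\<close>

lemma dual_pair_unique:
  assumes "dual_pair A" "dual_pair B" "functional_part A \<subseteq> functional_part B"
    and "vector_closure A = vector_closure B"
  shows "functional_closure A = functional_closure B"
proof
  show sub: "functional_closure A \<subseteq> functional_closure B" using assms(3) by (rule closure_of_mono)
  show "functional_closure B \<subseteq> functional_closure A"
  proof
    fix f assume f: "f \<in> functional_closure B"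
    let ?r = "\<lambda>f. restrict f (vector_closure B)"
    have "?r f \<in> dual_on smul (vector_closure B)"
      using assms(2) f unfolding dual_pair_def bij_betw_def by blast
    then have "?r f \<in> ?r ` functional_closure A"
      using assms(1,4) unfolding dual_pair_def bij_betw_def by metis
    then obtain g where g: "g \<in> functional_closure A" "?r f = ?r g" by (elim imageE)
    moreover have "inj_on ?r (functional_closure B)"
      using assms(2) unfolding dual_pair_def bij_betw_def by blast
    ultimately have "f = g" using f sub by (meson inj_onD subsetD)
    then show "f \<in> functional_closure A" using g by simp
  qed
qed

text \<open>
  To reach \<open>f \<in> D\<close> from vectors alone, iterate \<open>A \<mapsto> vector_part (\<psi> ({f} \<union> A))\<close>. For the union \<open>A\<close> of the
  iterates the vector parts of \<open>\<psi> A\<close> and \<open>\<psi> ({f} \<union> A)\<close> coincide, hence so do the spaces of functionals,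
  and the second one contains \<open>f\<close>.
\<close>

lemma monotone_dual_pairs_imp_monotone_dual_pairs_over_vectors:
  assumes D: "D \<subseteq> dual smul" and "monotone_dual_pairs D"
  shows "monotone_dual_pairs_over_vectors D"
proof -
  obtain \<psi> where \<psi>: "omega_monotone (D <+> UNIV) (D <+> UNIV) \<psi>"
    and \<psi>A: "\<And>A. A \<in> countable_subsets (D <+> UNIV) \<Longrightarrow> A \<subseteq> \<psi> A \<and> functional_closure (\<psi> A) \<subseteq> D \<and> dual_pair (\<psi> A)"
    using assms(2) unfolding monotone_dual_pairs_def by blast
  note cs = omega_monotone_countable[OF \<psi>] and mono = omega_monotone_mono[OF \<psi>]
    and cont = omega_monotone_UN[OF \<psi>]
  define \<theta> where "\<theta> A = \<psi> (Inr ` A)" for A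
  have Inr: "Inr ` A \<in> countable_subsets (D <+> UNIV)" if "A \<in> countable_subsets UNIV" for A
    using that by (auto simp: countable_subsets_def)
  have "omega_monotone (UNIV :: 'a set) (D <+> UNIV) \<theta>"
  proof (rule omega_monotoneI)
    show "\<theta> A \<in> countable_subsets (D <+> UNIV)" if "A \<in> countable_subsets UNIV" for A
      unfolding \<theta>_def by (intro cs Inr that)
    show "\<theta> A \<subseteq> \<theta> B" if "A \<in> countable_subsets UNIV" "B \<in> countable_subsets UNIV" "A \<subseteq> B" for A B
      unfolding \<theta>_def using that by (intro mono Inr image_mono)
    fix A :: "nat \<Rightarrow> 'a set" assume A: "\<And>n. A n \<in> countable_subsets UNIV" "incseq A"
    show "\<theta> (\<Union>n. A n) = (\<Union>n. \<theta> (A n))"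
      unfolding \<theta>_def image_UN using A(2) by (intro cont Inr A) (auto simp: incseq_def)
  qed
  moreover have "\<exists>A\<in>countable_subsets UNIV. f \<in> functional_closure (\<theta> A)" if f: "f \<in> D" for f
  proof -
    define S where "S = rec_nat {} (\<lambda>n A. vector_part (\<psi> (insert (Inl f) (Inr ` A))))"
    have S0: "S 0 = {}" and SS: "S (Suc n) = vector_part (\<psi> (insert (Inl f) (Inr ` S n)))" for n
      by (simp_all add: S_def)
    define I where "I n = insert (Inl f) (Inr ` S n)" for n
    have cSI: "S n \<in> countable_subsets UNIV \<and> I n \<in> countable_subsets (D <+> UNIV)" for n
    proof (induction n)
      case 0
      then show ?case using f by (auto simp: S0 I_def countable_subsets_def)
    next
      case (Suc n)
      then have "\<psi> (I n) \<in> countable_subsets (D <+> UNIV)" using cs by blast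
      then have "countable (S (Suc n))"
        by (simp add: SS I_def[symmetric] countable_subsets_def countable_inj_vimage[OF _ inj_Inr])
      then show ?case using f by (auto simp: I_def countable_subsets_def)
    qed
    have "S n \<subseteq> S (Suc n)" for n
      using \<psi>A[of "I n"] cSI[of n] by (auto simp: SS I_def)
    then have incS: "incseq S" by (rule incseq_SucI)
    define A where "A = (\<Union>n. S n)"
    have cA: "A \<in> countable_subsets UNIV"
      using cSI by (auto simp: A_def countable_subsets_def)
    have IA: "insert (Inl f) (Inr ` A) = (\<Union>n. I n)"
      by (auto simp: A_def I_def)
    define B where "B = insert (Inl f) (Inr ` A)"
    have cB: "B \<in> countable_subsets (D <+> UNIV)"
      using cA f by (auto simp: B_def countable_subsets_def)
    have "incseq I"
      using incseqD[OF incS] unfolding incseq_def I_def by (intro allI impI insert_mono image_mono)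
    then have "\<psi> B = (\<Union>n. \<psi> (I n))"
      unfolding B_def IA using cSI by (intro cont) auto
    then have "vector_part (\<psi> B) = (\<Union>n. S (Suc n))"
      by (auto simp: SS I_def)
    also have "\<dots> \<subseteq> A" unfolding A_def by blast
    finally have "vector_part (\<psi> B) \<subseteq> A" .
    moreover have "A \<subseteq> vector_part (\<theta> A)"
      using \<psi>A[OF Inr[OF cA]] unfolding \<theta>_def by blast
    moreover have sub: "\<theta> A \<subseteq> \<psi> B"
      unfolding \<theta>_def using Inr[OF cA] cB by (intro mono) (auto simp: B_def)
    ultimately have "vector_part (\<psi> B) = vector_part (\<theta> A)" by blast
    then have "functional_closure (\<theta> A) = functional_closure (\<psi> B)"
      using \<psi>A[OF Inr[OF cA]] \<psi>A[OF cB] sub by (intro dual_pair_unique) (auto simp: \<theta>_def)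
    moreover have "f \<in> functional_part (\<psi> B)"
      using \<psi>A[OF cB] by (auto simp: B_def)
    then have "f \<in> functional_closure (\<psi> B)"
      using f D by (auto simp: in_closure_of)
    ultimately show ?thesis using cA by blast
  qed
  moreover have "functional_closure (\<theta> A) \<subseteq> D" "Inr ` A \<subseteq> \<theta> A" "dual_pair (\<theta> A)" if "A \<in> countable_subsets UNIV" for A
    using \<psi>A[OF Inr[OF that]] unfolding \<theta>_def by auto
  ultimately show ?thesis
    unfolding monotone_dual_pairs_over_vectors_def by (intro exI[of _ \<theta>]) blast
qed

text \<open>
  The index set consists of all countable subsets of \<open>X\<close>, ordered by inclusion. Larger index sets have larger
  ranges and smaller kernels, which is the commutation property; suprema of sequences are unions.
\<close>

lemma monotone_dual_pairs_over_vectors_imp_skeleton: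
  assumes C: "norms_up_to C (dual smul)" and "monotone_dual_pairs_over_vectors D"
  shows "induced_by_skeleton TYPE('a set) smul D"
proof -
  obtain \<theta> where \<theta>: "omega_monotone (UNIV :: 'a set) (D <+> UNIV) \<theta>"
    and D: "D = (\<Union>A \<in> countable_subsets UNIV. functional_closure (\<theta> A))"
    and \<theta>A: "\<And>A. A \<in> countable_subsets UNIV \<Longrightarrow> Inr ` A \<subseteq> \<theta> A \<and> dual_pair (\<theta> A)"
    using assms(2) unfolding monotone_dual_pairs_over_vectors_def by blast
  define \<Gamma> where "\<Gamma> = countable_subsets (UNIV :: 'a set)"
  define r where "r = {(A, B). A \<in> \<Gamma> \<and> B \<in> \<Gamma> \<and> A \<subseteq> B}"
  have "\<exists>P. bounded_projection smul P \<and> range P = vector_closure (\<theta> A) \<and>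
      (\<forall>x. P x = 0 \<longleftrightarrow> x \<in> annihilator (functional_closure (\<theta> A))) \<and>
      (\<lambda>f. f \<circ> P) ` dual smul = functional_closure (\<theta> A)" if "A \<in> \<Gamma>" for A
  proof -
    have "dual_pair (\<theta> A)" using \<theta>A that by (simp add: \<Gamma>_def)
    then show ?thesis
      unfolding dual_pair_def
      using projection_onto_bijective_subspace[OF C closedin_closure_of _ closed_closure subspace_closed_span,
          of "functional_part (\<theta> A)" "vector_part (\<theta> A)"]
      by metis
  qed
  then obtain P where P: "\<And>A. A \<in> \<Gamma> \<Longrightarrow> bounded_projection smul (P A)"
    "\<And>A. A \<in> \<Gamma> \<Longrightarrow> range (P A) = vector_closure (\<theta> A)"
    "\<And>A x. A \<in> \<Gamma> \<Longrightarrow> P A x = 0 \<longleftrightarrow> x \<in> annihilator (functional_closure (\<theta> A))"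
    "\<And>A. A \<in> \<Gamma> \<Longrightarrow> (\<lambda>f. f \<circ> P A) ` dual smul = functional_closure (\<theta> A)"
    by metis
  have mono: "\<theta> A \<subseteq> \<theta> B" if "(A, B) \<in> r" for A B
    using that by (intro omega_monotone_mono[OF \<theta>]) (auto simp: r_def \<Gamma>_def)
  have \<theta>c: "countable (vector_part (\<theta> A))" if "A \<in> \<Gamma>" for A
  proof -
    have "countable (\<theta> A)"
      using omega_monotone_countable[OF \<theta>, of A] that by (simp add: \<Gamma>_def countable_subsets_def)
    then show ?thesis by (rule countable_inj_vimage[OF _ inj_Inr])
  qed
  have "projectional_skeleton smul \<Gamma> r P"
    unfolding projectional_skeleton_def
  proof (intro conjI ballI allI impI)
    show "partial_order_on \<Gamma> r"
      by (auto simp: partial_order_on_def preorder_on_def refl_on_def trans_def antisym_def r_def)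
    show "\<exists>u\<in>\<Gamma>. (s, u) \<in> r \<and> (t, u) \<in> r" if "s \<in> \<Gamma>" "t \<in> \<Gamma>" for s t
      using that by (intro bexI[of _ "s \<union> t"]) (auto simp: r_def \<Gamma>_def countable_subsets_def)
    show "bounded_projection smul (P s)" if "s \<in> \<Gamma>" for s using P(1) that .
    show "separable_space (top_of_set (range (P s)))" if "s \<in> \<Gamma>" for s
      using separable_closed_span[OF \<theta>c[OF that]] P(2)[OF that] by simp
    fix s t assume st: "s \<in> \<Gamma>" "t \<in> \<Gamma>" "(s, t) \<in> r"
    have lin: "bounded_linear (P s)" and idem: "\<And>x. P t (P t x) = P t x"
      using P(1)[OF st(1)] P(1)[OF st(2)] unfolding bounded_projection_def by (auto simp: fun_eq_iff)
    have lin_t: "bounded_linear (P t)" using P(1)[OF st(2)] unfolding bounded_projection_def by blast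
    show "P s \<circ> P t = P s"
    proof
      fix x
      have "P t (x - P t x) = 0" using idem lin_t by (simp add: linear_diff bounded_linear.linear)
      then have "x - P t x \<in> annihilator (functional_closure (\<theta> t))" using P(3) st by blast
      moreover have "functional_closure (\<theta> s) \<subseteq> functional_closure (\<theta> t)"
        using mono[OF st(3)] by (intro closure_of_mono) auto
      ultimately have "x - P t x \<in> annihilator (functional_closure (\<theta> s))"
        by (auto simp: annihilator_def)
      then have "P s (x - P t x) = 0" using P(3) st by blast
      then show "(P s \<circ> P t) x = P s x" using lin by (simp add: linear_diff bounded_linear.linear)
    qed
    have "vector_closure (\<theta> s) \<subseteq> vector_closure (\<theta> t)"
      using mono[OF st(3)] by (intro closure_mono span_mono) auto
    then have "P s x \<in> range (P t)" for x using P(2) st by blast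
    then have "P t (P s x) = P s x" for x using idem by (metis rangeE)
    then show "P t \<circ> P s = P s" by (simp add: fun_eq_iff)
  next
    fix \<sigma> :: "nat \<Rightarrow> 'a set" assume \<sigma>: "(\<forall>n. \<sigma> n \<in> \<Gamma>) \<and> (\<forall>n. (\<sigma> n, \<sigma> (Suc n)) \<in> r)"
    define s where "s = (\<Union>n. \<sigma> n)"
    have s: "s \<in> \<Gamma>" using \<sigma> by (auto simp: s_def \<Gamma>_def countable_subsets_def)
    have inc: "incseq \<sigma>" using \<sigma> by (intro incseq_SucI) (auto simp: r_def)
    have "is_sup_in \<Gamma> r (range \<sigma>) s"
      using \<sigma> s unfolding is_sup_in_def r_def by (auto simp: s_def)
    moreover have "range (P s) = closure (\<Union>n. range (P (\<sigma> n)))"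
    proof -
      have "\<theta> s = (\<Union>n. \<theta> (\<sigma> n))"
        unfolding s_def using \<sigma> inc by (intro omega_monotone_UN[OF \<theta>]) (auto simp: \<Gamma>_def)
      then have "vector_part (\<theta> s) = (\<Union>n. vector_part (\<theta> (\<sigma> n)))" by auto
      moreover have "incseq (\<lambda>n. vector_part (\<theta> (\<sigma> n)))"
        using mono \<sigma> by (intro incseq_SucI vimage_mono) blast
      ultimately have "vector_closure (\<theta> s) = closure (\<Union>n. vector_closure (\<theta> (\<sigma> n)))"
        using closed_span_UN by simp
      then show ?thesis using P(2) s \<sigma> by simp
    qed
    ultimately show "\<exists>s. is_sup_in \<Gamma> r (range \<sigma>) s \<and> range (P s) = closure (\<Union>n. range (P (\<sigma> n)))"
      by blast
  next
    show "(\<Union>s\<in>\<Gamma>. range (P s)) = UNIV"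
    proof (intro equalityI subsetI)
      fix x :: 'a
      have x: "{x} \<in> \<Gamma>" by (simp add: \<Gamma>_def countable_subsets_def)
      then have "x \<in> vector_part (\<theta> {x})" using \<theta>A unfolding \<Gamma>_def by blast
      then have "x \<in> range (P {x})"
        unfolding P(2)[OF x] by (meson closure_subset span_base subsetD)
      then show "x \<in> (\<Union>s\<in>\<Gamma>. range (P s))" using x by blast
    qed simp
  qed
  moreover have "D = induced_subspace smul \<Gamma> P"
    unfolding induced_subspace_def D using P(4) by (simp add: \<Gamma>_def)
  ultimately show ?thesis unfolding induced_by_skeleton_def by blast
qed

end

section \<open>A skeleton yields a monotone family of retractions\<close>

lemma dominating_sequence:
  assumes S: "countable S" "S \<noteq> {}" "S \<subseteq> S'"
    and dir: "\<And>s t. s \<in> S' \<Longrightarrow> t \<in> S' \<Longrightarrow> \<exists>u\<in>S'. (s, u) \<in> r \<and> (t, u) \<in> r"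
  obtains \<sigma> :: "nat \<Rightarrow> 'i" where "\<And>n. \<sigma> n \<in> S'" "\<And>n. (\<sigma> n, \<sigma> (Suc n)) \<in> r"
    "\<And>s. s \<in> S \<Longrightarrow> \<exists>n. (s, \<sigma> n) \<in> r"
proof -
  define e where "e = from_nat_into S"
  have e: "e n \<in> S'" for n
    using from_nat_into[OF S(2)] S(3) by (auto simp: e_def)
  have "\<exists>\<sigma>. \<forall>n. (\<sigma> n \<in> S' \<and> (e n, \<sigma> n) \<in> r) \<and> (\<sigma> n, \<sigma> (Suc n)) \<in> r"
  proof (rule dependent_nat_choice)
    show "\<exists>x. x \<in> S' \<and> (e 0, x) \<in> r" using dir[OF e[of 0] e[of 0]] by blast
    fix x n assume "x \<in> S' \<and> (e n, x) \<in> r"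
    then show "\<exists>y. (y \<in> S' \<and> (e (Suc n), y) \<in> r) \<and> (x, y) \<in> r"
      using dir[of x "e (Suc n)"] e by blast
  qed
  then obtain \<sigma> where \<sigma>: "\<And>n. (\<sigma> n \<in> S' \<and> (e n, \<sigma> n) \<in> r) \<and> (\<sigma> n, \<sigma> (Suc n)) \<in> r" by blast
  have "\<exists>n. (s, \<sigma> n) \<in> r" if s: "s \<in> S" for s
  proof -
    obtain n where "e n = s" using from_nat_into_surj[OF S(1) s] by (auto simp: e_def)
    then show ?thesis using \<sigma>[of n] by blast
  qed
  then show ?thesis using that[of \<sigma>] \<sigma> by blast
qed

text \<open>
  Functionals, vectors, indices of the skeleton and closed sets are collected in one type, so that one
  closure operation treats all of them simultaneously.
\<close>

datatype ('f, 'x, 'i, 'c) item = Fun 'f | Vec 'x | Idx 'i | Cls 'c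

context banach_over
begin

context
  fixes \<Gamma> :: "'i set" and r P
  assumes skel: "projectional_skeleton smul \<Gamma> r P"
begin

lemma skeleton_directed: "s \<in> \<Gamma> \<Longrightarrow> t \<in> \<Gamma> \<Longrightarrow> \<exists>u\<in>\<Gamma>. (s, u) \<in> r \<and> (t, u) \<in> r"
  using skel unfolding projectional_skeleton_def by blast

lemma skeleton_projection: "s \<in> \<Gamma> \<Longrightarrow> bounded_projection smul (P s)"
  using skel unfolding projectional_skeleton_def by blast

lemma skeleton_idem: "s \<in> \<Gamma> \<Longrightarrow> P s (P s x) = P s x"
  using skeleton_projection[of s] unfolding bounded_projection_def by (metis comp_apply)

lemma skeleton_comp:
  assumes "s \<in> \<Gamma>" "t \<in> \<Gamma>" "(s, t) \<in> r"
  shows "P s (P t x) = P s x" "P t (P s x) = P s x"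
proof -
  have "P s \<circ> P t = P s \<and> P t \<circ> P s = P s"
    using skel assms unfolding projectional_skeleton_def by blast
  then show "P s (P t x) = P s x" "P t (P s x) = P s x" by (auto simp: fun_eq_iff)
qed

text \<open>
  The skeleton has suprema of sequences only, so a countable directed set is replaced by a dominating sequence.
  It is applied both with \<open>S' = S\<close>, to control the range from above, and with \<open>S' = \<Gamma>\<close>, to obtain a
  mere upper bound.
\<close>

lemma skeleton_sup:
  assumes S: "countable S" "S \<noteq> {}" "S \<subseteq> S'" "S' \<subseteq> \<Gamma>"
    and dir: "\<And>s t. s \<in> S' \<Longrightarrow> t \<in> S' \<Longrightarrow> \<exists>u\<in>S'. (s, u) \<in> r \<and> (t, u) \<in> r"
  obtains s where "s \<in> \<Gamma>" "\<And>t. t \<in> S \<Longrightarrow> (t, s) \<in> r"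
    "range (P s) \<subseteq> closure (\<Union>t\<in>S'. range (P t))"
proof -
  obtain \<sigma> where \<sigma>: "\<And>n. \<sigma> n \<in> S'" "\<And>n. (\<sigma> n, \<sigma> (Suc n)) \<in> r" "\<And>s. s \<in> S \<Longrightarrow> \<exists>n. (s, \<sigma> n) \<in> r"
    using dominating_sequence[OF S(1-3) dir] by blast
  have "(\<forall>n. \<sigma> n \<in> \<Gamma>) \<and> (\<forall>n. (\<sigma> n, \<sigma> (Suc n)) \<in> r)" using \<sigma> S(4) by blast
  then have "\<exists>s. is_sup_in \<Gamma> r (range \<sigma>) s \<and> range (P s) = closure (\<Union>n. range (P (\<sigma> n)))"
    using skel unfolding projectional_skeleton_def by simp
  then obtain s where s: "is_sup_in \<Gamma> r (range \<sigma>) s" "range (P s) = closure (\<Union>n. range (P (\<sigma> n)))"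
    by blast
  have tr: "trans r" using skel unfolding projectional_skeleton_def partial_order_on_def preorder_on_def by blast
  show ?thesis
  proof
    show "s \<in> \<Gamma>" using s(1) by (simp add: is_sup_in_def)
    show "(t, s) \<in> r" if t: "t \<in> S" for t
    proof -
      obtain n where "(t, \<sigma> n) \<in> r" using \<sigma>(3)[OF t] by blast
      moreover have "(\<sigma> n, s) \<in> r" using s(1) by (simp add: is_sup_in_def)
      ultimately show ?thesis using tr by (meson transD)
    qed
    show "range (P s) \<subseteq> closure (\<Union>t\<in>S'. range (P t))"
      unfolding s(2) using \<sigma>(1) by (intro closure_mono) blast
  qed
qed

lemma induced_subspace_iff:
  "f \<in> induced_subspace smul \<Gamma> P \<longleftrightarrow> f \<in> dual smul \<and> (\<exists>s\<in>\<Gamma>. \<forall>x. f (P s x) = f x)"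
proof
  assume "f \<in> induced_subspace smul \<Gamma> P"
  then obtain s g where s: "s \<in> \<Gamma>" and g: "g \<in> dual smul" "f = g \<circ> P s"
    unfolding induced_subspace_def by blast
  have lin: "bounded_linear (P s)" and sm: "\<And>c x. P s (smul c x) = smul c (P s x)"
    using skeleton_projection[OF s] unfolding bounded_projection_def by auto
  have "bounded_linear (\<lambda>x. g (P s x))"
    using bounded_linear_compose[OF dual_bounded_linear[OF g(1)] lin] .
  then obtain K where "\<And>x. norm (g (P s x)) \<le> norm x * K" using bounded_linear.bounded by blast
  then have "norm (f x) \<le> K * norm x" for x by (simp add: g(2) mult.commute)
  moreover have "P s (x + y) = P s x + P s y" for x y
    using lin by (simp add: linear_add bounded_linear.linear)
  ultimately have "f \<in> dual smul"
    by (intro dualI[of f K]) (simp_all add: g(2) sm dual_add[OF g(1)] dual_smul[OF g(1)])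
  moreover have "\<forall>x. f (P s x) = f x" using skeleton_idem[OF s] by (simp add: g(2))
  ultimately show "f \<in> dual smul \<and> (\<exists>s\<in>\<Gamma>. \<forall>x. f (P s x) = f x)" using s by blast
next
  assume "f \<in> dual smul \<and> (\<exists>s\<in>\<Gamma>. \<forall>x. f (P s x) = f x)"
  then obtain s where "f \<in> dual smul" "s \<in> \<Gamma>" "f = f \<circ> P s" by (auto simp: fun_eq_iff)
  then show "f \<in> induced_subspace smul \<Gamma> P" unfolding induced_subspace_def by blast
qed

lemma comp_in_induced_subspace:
  "f \<in> dual smul \<Longrightarrow> s \<in> \<Gamma> \<Longrightarrow> (\<lambda>x. f (P s x)) \<in> induced_subspace smul \<Gamma> P"
  unfolding induced_subspace_def comp_def by blast

lemma skeleton_fixed_functional_mono: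
  assumes "s \<in> \<Gamma>" "t \<in> \<Gamma>" "(s, t) \<in> r" "\<And>x. f (P s x) = f x"
  shows "f (P t x) = f x"
  by (metis assms skeleton_comp(1))

text \<open>
  Countably many functionals of \<open>D\<close> are fixed by the adjoint of one common projection, and being fixed passes to
  pointwise limits.
\<close>

lemma skeleton_countably_closed:
  assumes D: "D = induced_subspace smul \<Gamma> P"
  shows "weak_star_countably_closed smul D"
  unfolding weak_star_countably_closed_def
proof (intro allI impI subsetI)
  fix S f assume S: "S \<subseteq> D \<and> countable S" and f: "f \<in> weak_star smul closure_of S"
  have Sd: "S \<subseteq> dual smul" using S D induced_subspace_iff by blast
  have "\<forall>g\<in>S. \<exists>s\<in>\<Gamma>. \<forall>x. g (P s x) = g x" using S D induced_subspace_iff by blast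
  then obtain i where i: "\<And>g. g \<in> S \<Longrightarrow> i g \<in> \<Gamma>" "\<And>g x. g \<in> S \<Longrightarrow> g (P (i g) x) = g x" by metis
  have "S \<noteq> {}" using f by auto
  then obtain s where s: "s \<in> \<Gamma>" "\<And>t. t \<in> i ` S \<Longrightarrow> (t, s) \<in> r"
    using skeleton_sup[of "i ` S" \<Gamma>] S i(1) skeleton_directed by (metis countable_image image_is_empty image_subsetI subset_refl)
  have g: "g (P s x) = g x" if "g \<in> S" for g x
    using skeleton_fixed_functional_mono[OF i(1)[OF that] s(1)] i(2)[OF that] s(2) that by blast
  have fd: "f \<in> dual smul" using f weak_star_closure[OF Sd] by blast
  have "f (P s x) = f x" for x
  proof (rule ccontr)
    assume "f (P s x) \<noteq> f x"
    then have "dist (f (P s x)) (f x) / 2 > 0" by simp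
    then obtain h where h: "h \<in> S" "\<forall>y\<in>{x, P s x}. dist (h y) (f y) < dist (f (P s x)) (f x) / 2"
      using f unfolding weak_star_closure[OF Sd] by (meson finite.emptyI finite.insertI)
    then have "dist (h x) (f x) < dist (f (P s x)) (f x) / 2"
      "dist (h (P s x)) (f (P s x)) < dist (f (P s x)) (f x) / 2" by simp_all
    moreover have "h (P s x) = h x" using g[OF h(1)] .
    ultimately have "dist (h x) (f x) < dist (f (P s x)) (f x) / 2"
      "dist (h x) (f (P s x)) < dist (f (P s x)) (f x) / 2" by simp_all
    then show False
      using dist_triangle3[of "f (P s x)" "f x" "h x"] by simp
  qed
  then show "f \<in> D" using D fd s(1) induced_subspace_iff by blast
qed

text \<open>
  The closure of a family of closed sets is taken under: an index for each vector and each functional, upper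
  bounds of indices, dense sequences in the ranges, and selected functionals that separate points of the
  range from the closed sets. The indices so obtained have a supremum, whose projection is the retraction. Since
  \<open>\<sigma>(X,D)\<close> is coarser than the norm topology, balls around the countably many vectors form the network.
\<close>

lemma skeleton_monotonically_Sokolov:
  assumes D: "D = induced_subspace smul \<Gamma> P"
  shows "monotonically_Sokolov (sigma_top D)"
proof -
  define \<F> where "\<F> = {F. closedin (sigma_top D) F \<and> F \<noteq> {}}"
  have Dd: "D \<subseteq> dual smul" using D induced_subspace_iff by blast
  have UN: "(\<Union>s\<in>\<Gamma>. range (P s)) = UNIV" using skel unfolding projectional_skeleton_def by blast
  have "\<forall>x. \<exists>s\<in>\<Gamma>. x \<in> range (P s)" using UN by blast
  then obtain sx where sx: "\<And>x. sx x \<in> \<Gamma>" "\<And>x. x \<in> range (P (sx x))" by metis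
  have "\<forall>f\<in>D. \<exists>s\<in>\<Gamma>. \<forall>x. f (P s x) = f x" using D induced_subspace_iff by blast
  then obtain sf where sf: "\<And>f. f \<in> D \<Longrightarrow> sf f \<in> \<Gamma>" "\<And>f x. f \<in> D \<Longrightarrow> f (P (sf f) x) = f x" by metis
  obtain ub where ub: "\<And>s t. s \<in> \<Gamma> \<Longrightarrow> t \<in> \<Gamma> \<Longrightarrow> ub s t \<in> \<Gamma> \<and> (s, ub s t) \<in> r \<and> (t, ub s t) \<in> r"
    using skeleton_directed by metis
  have "\<exists>C. countable C \<and> C \<subseteq> range (P s) \<and> range (P s) \<subseteq> closure C" if "s \<in> \<Gamma>" for s
  proof -
    have "separable_space (top_of_set (range (P s)))"
      using skel that unfolding projectional_skeleton_def by blast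
    then obtain C where C: "countable C" "C \<subseteq> range (P s)" "top_of_set (range (P s)) closure_of C = range (P s)"
      unfolding separable_space_def by auto
    then have "range (P s) \<subseteq> closure C"
      by (metis closure_of_subtopology_subset euclidean_closure_of)
    then show ?thesis using C by blast
  qed
  then obtain dn where dn: "\<And>s. s \<in> \<Gamma> \<Longrightarrow> countable (dn s)" "\<And>s. s \<in> \<Gamma> \<Longrightarrow> range (P s) \<subseteq> closure (dn s)"
    by metis
  \<comment> \<open>The functionals \<open>fs\<close> are \<open>1 / (k + 1)\<close>-close to \<open>qs\<close> at \<open>z\<close>, but nowhere on \<open>G\<close> are they all \<open>2 / (k + 1)\<close>-close.\<close>
  define good where "good G z m k qs fs \<longleftrightarrow> set fs \<subseteq> D \<and> length fs = length qs \<and>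
      (\<forall>f\<in>set fs. \<forall>x. norm (f x) \<le> real m * norm x) \<and>
      (\<forall>i<length qs. dist ((fs ! i) z) (qs ! i) < 1 / Suc k) \<and>
      (\<forall>y\<in>G. \<exists>i<length qs. dist ((fs ! i) y) (qs ! i) \<ge> 2 / Suc k)"
    for G z and m k :: nat and qs :: "'k list" and fs :: "('a \<Rightarrow> 'k) list"
  \<comment> \<open>The empty list is a harmless default when nothing can be selected.\<close>
  define sel where "sel G z m k qs = (if \<exists>fs. good G z m k qs fs then SOME fs. good G z m k qs fs else [])"
    for G z m k qs
  have sel: "good G z m k qs (sel G z m k qs)" if "good G z m k qs fs" for G z m k qs fs
    unfolding sel_def using that someI_ex[of "good G z m k qs"] by auto
  have selD: "set (sel G z m k qs) \<subseteq> D" for G z m k qs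
  proof (cases "\<exists>fs. good G z m k qs fs")
    case True
    then show ?thesis using sel[of G z m k qs] unfolding good_def by blast
  qed (simp add: sel_def)
  define c :: "('a \<Rightarrow> 'k, 'a, 'i, 'a set) item set \<Rightarrow> ('a \<Rightarrow> 'k, 'a, 'i, 'a set) item set" where "c F = {Vec 0} \<union> Idx ` sx ` (Vec -` F) \<union> Idx ` sf ` (Fun -` F) \<union>
      (\<Union>s\<in>Idx -` F. (\<lambda>t. Idx (ub s t)) ` (Idx -` F)) \<union> (\<Union>s\<in>Idx -` F. Vec ` dn s) \<union>
      (\<Union>G\<in>Cls -` F. \<Union>z\<in>Vec -` F. \<Union>m. \<Union>k. \<Union>qs\<in>lists dense_scalars. Fun ` set (sel G z m k qs))"
    for F
  define M :: "('a \<Rightarrow> 'k, 'a, 'i, 'a set) item set" where "M = Fun ` D \<union> range Vec \<union> Idx ` \<Gamma> \<union> Cls ` \<F>"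
  have cM: "c F \<in> countable_subsets M" if F: "finite F" "F \<subseteq> M" for F
  proof -
    have inj: "inj Vec" "inj Fun" "inj Idx" "inj Cls" by (auto intro!: injI)
    have fin: "finite (Vec -` F)" "finite (Fun -` F)" "finite (Idx -` F)" "finite (Cls -` F)"
      using F(1) inj by (auto intro: finite_vimageI)
    have IF: "Idx -` F \<subseteq> \<Gamma>" "Fun -` F \<subseteq> D" using F(2) by (auto simp: M_def)
    have "countable (c F)"
      unfolding c_def using fin IF dn(1) countable_dense_scalars
      by (intro countable_Un countable_image countable_UN countable_SIGMA countable_lists)
        (auto intro: countable_finite)
    moreover have "c F \<subseteq> M"
    proof -
      have m1: "Idx ` sx ` (Vec -` F) \<subseteq> M" "Idx ` sf ` (Fun -` F) \<subseteq> M"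
        using sx(1) sf(1) IF by (auto simp: M_def)
      have m2: "(\<lambda>t. Idx (ub s t)) ` (Idx -` F) \<subseteq> M" if "s \<in> Idx -` F" for s
      proof clarify
        fix t assume "Idx t \<in> F"
        then have "s \<in> \<Gamma>" "t \<in> \<Gamma>" using that IF(1) by auto
        then show "Idx (ub s t) \<in> M" using ub[of s t] by (simp add: M_def)
      qed
      have m3: "Fun ` set (sel G z m k qs) \<subseteq> M" for G z m k qs
        using selD[of G z m k qs] unfolding M_def by blast
      have m4: "{Vec 0} \<subseteq> M" "Vec ` dn s \<subseteq> M" for s by (auto simp: M_def)
      show ?thesis unfolding c_def by (intro Un_least UN_least m1 m2 m3 m4) assumption
    qed
    ultimately show ?thesis by (simp add: countable_subsets_def)
  qed
  define B where "B \<A> = generated c (Cls ` \<A>)" for \<A>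
  have CM: "Cls ` \<A> \<in> countable_subsets M" if "\<A> \<in> countable_subsets \<F>" for \<A>
    using that by (auto simp: countable_subsets_def M_def)
  have BM: "B \<A> \<in> countable_subsets M" if "\<A> \<in> countable_subsets \<F>" for \<A>
    unfolding B_def by (rule generated_countable[OF cM CM[OF that]])
  define \<N> where "\<N> \<A> = (\<Union>z\<in>Vec -` B \<A>. range (\<lambda>n. ball z (1 / Suc n)))" for \<A>
  have ball: "ball z (1 / Suc n) \<in> Pow (topspace (sigma_top D))" for z n by simp
  have "omega_monotone \<F> (Pow (topspace (sigma_top D))) \<N>"
  proof (rule omega_monotoneI)
    show "\<N> \<A> \<in> countable_subsets (Pow (topspace (sigma_top D)))" if "\<A> \<in> countable_subsets \<F>" for \<A>
    proof -
      have "countable (Vec -` B \<A>)"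
        using BM[OF that] by (intro countable_inj_vimage) (auto simp: countable_subsets_def intro: injI)
      then show ?thesis by (auto simp: countable_subsets_def \<N>_def)
    qed
    show "\<N> \<A> \<subseteq> \<N> \<B>" if "\<A> \<subseteq> \<B>" for \<A> \<B>
    proof -
      have "B \<A> \<subseteq> B \<B>" unfolding B_def using that by (intro generated_mono image_mono)
      then show ?thesis unfolding \<N>_def by blast
    qed
    fix \<A> :: "nat \<Rightarrow> 'a set set" assume "incseq \<A>"
    then have "incseq (\<lambda>n. Cls ` \<A> n :: ('a \<Rightarrow> 'k, 'a, 'i, 'a set) item set)"
      unfolding incseq_def by (blast intro: image_mono)
    then have "B (\<Union>n. \<A> n) = (\<Union>n. B (\<A> n))"
      unfolding B_def image_UN by (rule generated_UN)
    then show "\<N> (\<Union>n. \<A> n) = (\<Union>n. \<N> (\<A> n))"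
      unfolding \<N>_def by auto
  qed
  moreover have "\<exists>p. continuous_retraction (sigma_top D) p \<and> (\<forall>F\<in>\<A>. p ` F \<subseteq> F) \<and>
      countable (\<N> \<A>) \<and> outer_network (sigma_top D) (p ` topspace (sigma_top D)) (\<N> \<A>)"
    if \<A>: "\<A> \<in> countable_subsets \<F>" for \<A>
  proof -
    define V where "V = Vec -` B \<A>"
    define I where "I = Idx -` B \<A>"
    have cB: "countable (B \<A>)" "B \<A> \<subseteq> M" using BM[OF \<A>] by (auto simp: countable_subsets_def)
    have cl: "c F \<subseteq> B \<A>" if "finite F" "F \<subseteq> B \<A>" for F
      using that unfolding B_def by (rule generated_closed)
    have V0: "0 \<in> V" using cl[of "{}"] by (simp add: V_def c_def)
    have VI: "sx x \<in> I" if "x \<in> V" for x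
      using cl[of "{Vec x}"] that by (auto simp: V_def I_def c_def)
    have FI: "sf f \<in> I" if "Fun f \<in> B \<A>" for f
      using cl[of "{Fun f}"] that by (auto simp: I_def c_def)
    have II: "ub s t \<in> I" if "s \<in> I" "t \<in> I" for s t
    proof -
      have "Idx (ub s t) \<in> c {Idx s, Idx t}"
        unfolding c_def by (rule UnI1, rule UnI1, rule UnI2, rule UN_I[of s], simp, rule imageI, simp)
      then show ?thesis using cl[of "{Idx s, Idx t}"] that by (auto simp: I_def)
    qed
    have IV: "dn s \<subseteq> V" if "s \<in> I" for s
    proof -
      have "Vec ` dn s \<subseteq> c {Idx s}"
        unfolding c_def by (rule subsetI, rule UnI1, rule UnI2, rule UN_I[of s]) simp_all
      then show ?thesis using cl[of "{Idx s}"] that by (auto simp: I_def V_def)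
    qed
    have AF: "f \<in> D \<and> Fun f \<in> B \<A>" if "G \<in> \<A>" "z \<in> V" "qs \<in> lists dense_scalars" "f \<in> set (sel G z m k qs)"
      for G z m k qs f
    proof -
      have "Cls G \<in> B \<A>" using that(1) generated_superset[of "Cls ` \<A>" c] unfolding B_def by blast
      then have "c {Cls G, Vec z} \<subseteq> B \<A>" using that(2) by (intro cl) (auto simp: V_def)
      moreover have "Fun f \<in> c {Cls G, Vec z}"
        unfolding c_def
        by (rule UnI2, rule UN_I[of G], simp, rule UN_I[of z], simp, rule UN_I[of m], simp,
            rule UN_I[of k], simp, rule UN_I[OF that(3)], rule imageI[OF that(4)])
      ultimately show ?thesis using that(4) selD[of G z m k qs] by blast
    qed
    have I\<Gamma>: "I \<subseteq> \<Gamma>" using cB(2) by (auto simp: I_def M_def)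
    have cI: "countable I" unfolding I_def by (intro countable_inj_vimage cB) (auto intro: injI)
    have dirI: "\<exists>u\<in>I. (s, u) \<in> r \<and> (t, u) \<in> r" if "s \<in> I" "t \<in> I" for s t
      using II[OF that] ub[of s t] that I\<Gamma> by blast
    obtain s where s: "s \<in> \<Gamma>" "\<And>t. t \<in> I \<Longrightarrow> (t, s) \<in> r" "range (P s) \<subseteq> closure (\<Union>t\<in>I. range (P t))"
      using skeleton_sup[of I I] cI VI[OF V0] I\<Gamma> dirI by blast
    define p where "p = P s"
    have "range (P t) \<subseteq> closure V" if "t \<in> I" for t
      using dn(2)[of t] closure_mono[OF IV[OF that]] that I\<Gamma> by blast
    then have "closure (\<Union>t\<in>I. range (P t)) \<subseteq> closure V"
      by (intro closure_minimal) auto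
    then have rV: "range p \<subseteq> closure V" using s(3) by (simp add: p_def)
    have fix_p: "f (p x) = f x" if "f \<in> D" "Fun f \<in> B \<A>" for f x
      unfolding p_def using FI[OF that(2)] I\<Gamma> s(1,2) sf(2)[OF that(1)]
      by (intro skeleton_fixed_functional_mono[of "sf f" s]) auto
    have "continuous_map (sigma_top D) (sigma_top D) p"
    proof (rule continuous_map_into_initial_topology)
      fix f assume "f \<in> D"
      then have "(\<lambda>t. f (p t)) \<in> D"
        unfolding p_def using comp_in_induced_subspace[OF _ s(1)] D Dd by blast
      then show "continuous_map (sigma_top D) euclidean (\<lambda>t. f (p t))"
        by (rule continuous_map_from_initial_topology)
    qed simp
    then have "continuous_retraction (sigma_top D) p"
      unfolding continuous_retraction_def using skeleton_idem[OF s(1)] by (simp add: p_def)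
    moreover have "p x \<in> G" if G: "G \<in> \<A>" and x: "x \<in> G" for G x
    proof (rule ccontr)
      assume "p x \<notin> G"
      have "closedin (sigma_top D) G" using G \<A> by (auto simp: countable_subsets_def \<F>_def)
      then have "openin (sigma_top D) (UNIV - G)" by (simp add: closedin_def)
      then have "\<forall>x\<in>UNIV - G. \<exists>J e. J \<subseteq> D \<and> finite J \<and> e > 0 \<and>
          (\<forall>y\<in>UNIV. (\<forall>f\<in>J. dist (f y) (f x) < e) \<longrightarrow> y \<in> UNIV - G)"
        unfolding openin_initial_topology by (rule conjunct2)
      from bspec[OF this, of "p x"] \<open>p x \<notin> G\<close>
      obtain J e where J: "J \<subseteq> D" "finite J" "e > 0"
        and Jy: "\<And>y. (\<forall>f\<in>J. dist (f y) (f (p x)) < e) \<Longrightarrow> y \<notin> G" by auto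
      obtain fs where fs: "set fs = J" using finite_list[OF J(2)] by blast
      have "\<forall>f\<in>J. \<exists>b. \<forall>x. norm (f x) \<le> b * norm x"
        using J(1) Dd dual_iff by blast
      then obtain b where b: "\<And>f x. f \<in> J \<Longrightarrow> norm (f x) \<le> b f * norm x" by metis
      obtain m :: nat where m: "Max (insert 0 (b ` J)) < real m" using reals_Archimedean2 by blast
      have bm: "norm (f x) \<le> real m * norm x" if "f \<in> J" for f x
      proof -
        have "b f < real m" using m that J(2) by simp
        then have "b f * norm x \<le> real m * norm x" by (intro mult_right_mono) auto
        then show ?thesis using b[OF that, of x] by linarith
      qed
      have "e / 3 > 0" using J(3) by simp
      then obtain k where k: "inverse (real (Suc k)) < e / 3" using reals_Archimedean by blast
      define d where "d = 1 / real (Suc k)"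
      have d: "d > 0" "3 * d < e" using k by (auto simp: d_def field_simps)
      have m1: "real m + 1 > 0" by simp
      have "p x \<in> closure V" using rV by blast
      then obtain z where z: "z \<in> V" "dist z (p x) < d / (2 * (real m + 1))"
        using d(1) m1 unfolding closure_approachable by (meson divide_pos_pos mult_pos_pos zero_less_numeral)
      have zm: "dist (f z) (f (p x)) < d / 2"
        if "f \<in> dual smul" "\<And>x. norm (f x) \<le> real m * norm x" for f
      proof -
        have "dist (f z) (f (p x)) = norm (f (z - p x))" by (simp add: dist_norm dual_diff[OF that(1)])
        also have "\<dots> \<le> (real m + 1) * dist z (p x)"
          using that(2)[of "z - p x"] norm_ge_zero[of "z - p x"]
          unfolding dist_norm distrib_right by linarith
        also have "\<dots> < (real m + 1) * (d / (2 * (real m + 1)))"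
          using z(2) m1 by (rule mult_strict_left_mono)
        also have "\<dots> = d / 2" using m1 by (simp add: field_simps)
        finally show ?thesis .
      qed
      have "\<forall>f :: 'a \<Rightarrow> 'k. \<exists>q\<in>dense_scalars. dist q (f z) < d / 2"
        using d(1) by (intro allI dense_scalars_approx) simp
      then obtain qf :: "('a \<Rightarrow> 'k) \<Rightarrow> 'k" where qf: "\<And>f. qf f \<in> dense_scalars" "\<And>f. dist (qf f) (f z) < d / 2" by metis
      define qs where "qs = map qf fs"
      have qs: "qs \<in> lists dense_scalars" using qf(1) by (auto simp: qs_def)
      \<comment> \<open>The functionals separating \<open>p x\<close> from \<open>G\<close> satisfy the condition for suitable parameters, so a selection was made.\<close>
      have "good G z m k qs fs"
        unfolding good_def
      proof (intro conjI ballI allI impI)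
        show "set fs \<subseteq> D" "length fs = length qs" using fs J(1) by (auto simp: qs_def)
        show "norm (f x) \<le> real m * norm x" if "f \<in> set fs" for f x using bm that fs by blast
        show "dist ((fs ! i) z) (qs ! i) < 1 / Suc k" if "i < length qs" for i
        proof -
          have "dist (qf (fs ! i)) ((fs ! i) z) < d" using qf(2)[of "fs ! i"] d(1) by linarith
          then show ?thesis using that by (simp add: qs_def dist_commute d_def)
        qed
        fix y assume y: "y \<in> G"
        show "\<exists>i<length qs. dist ((fs ! i) y) (qs ! i) \<ge> 2 / Suc k"
        proof (rule ccontr)
          assume neg: "\<not> ?thesis"
          have "dist (f y) (f (p x)) < e" if "f \<in> J" for f
          proof -
            obtain i where i: "i < length fs" "fs ! i = f" using \<open>f \<in> J\<close> fs by (metis in_set_conv_nth)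
            have "\<not> dist ((fs ! i) y) (qs ! i) \<ge> 2 / Suc k" using neg i(1) by (simp add: qs_def)
            then have "dist (f y) (qf f) < 2 * d" using i by (simp add: qs_def d_def)
            moreover have "dist (f z) (f (p x)) < d / 2"
              using zm[of f] bm[OF \<open>f \<in> J\<close>] J(1) Dd \<open>f \<in> J\<close> by blast
            ultimately show ?thesis
              using qf(2)[of f] dist_triangle[of "f y" "f (p x)" "qf f"]
                dist_triangle[of "qf f" "f (p x)" "f z"] d(2) by linarith
          qed
          then show False using Jy y by blast
        qed
      qed
      then have good: "good G z m k qs (sel G z m k qs)" by (rule sel)
      then obtain i where i: "i < length qs" "dist ((sel G z m k qs ! i) x) (qs ! i) \<ge> 2 * d"
        using x unfolding good_def by (auto simp: d_def)
      define h where "h = sel G z m k qs ! i"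
      have hs: "h \<in> set (sel G z m k qs)" using good i(1) by (auto simp: good_def h_def)
      \<comment> \<open>The selected functionals do not distinguish \<open>x\<close> from \<open>p x\<close>, so \<open>x\<close> is too close to \<open>qs\<close> for a point of \<open>G\<close>.\<close>
      then have hD: "h \<in> D" "Fun h \<in> B \<A>" using AF[OF G z(1) qs] by auto
      have "dist (h z) (qs ! i) < d" using good i(1) by (simp add: good_def h_def d_def)
      moreover have "dist (h z) (h (p x)) < d / 2"
        using zm[of h] hD(1) Dd good hs unfolding good_def by blast
      ultimately have "dist (h (p x)) (qs ! i) < 2 * d"
        using dist_triangle3[of "h (p x)" "qs ! i" "h z"] d(1) by linarith
      then show False using i(2) fix_p[OF hD] by (simp add: h_def)
    qed
    moreover have "countable (\<N> \<A>)"
    proof -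
      have "countable V"
        unfolding V_def by (intro countable_inj_vimage cB) (auto intro: injI)
      then show ?thesis by (auto simp: \<N>_def V_def)
    qed
    moreover have "outer_network (sigma_top D) (p ` topspace (sigma_top D)) (\<N> \<A>)"
      unfolding outer_network_def
    proof (intro conjI allI impI ballI)
      fix U x assume U: "openin (sigma_top D) U \<and> x \<in> U \<inter> p ` topspace (sigma_top D)"
      have "continuous_map euclidean (sigma_top D) (\<lambda>x. x)"
        using Dd continuous_on_dual by (intro continuous_map_into_initial_topology) (auto simp: subset_iff)
      then have "open U"
        using openin_continuous_map_preimage[of euclidean "sigma_top D" "\<lambda>x. x" U] U by simp
      then obtain e where e: "e > 0" "ball x e \<subseteq> U" using U open_contains_ball by blast
      then have "e / 2 > 0" by simp
      then obtain n where n: "inverse (real (Suc n)) < e / 2" using reals_Archimedean by blast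
      have "x \<in> closure V" using U rV by auto
      then obtain z where z: "z \<in> V" "dist z x < 1 / Suc n"
        unfolding closure_approachable by (metis of_nat_0_less_iff zero_less_Suc zero_less_divide_1_iff)
      have "ball z (1 / Suc n) \<subseteq> ball x e"
      proof
        fix y assume "y \<in> ball z (1 / Suc n)"
        then have "dist x y < 1 / Suc n + 1 / Suc n"
          using z(2) dist_triangle[of x y z] by (simp add: dist_commute)
        moreover have "1 / Suc n + 1 / Suc n < e" using n unfolding inverse_eq_divide by linarith
        ultimately have "dist x y < e" by linarith
        then show "y \<in> ball x e" by simp
      qed
      then have "x \<in> ball z (1 / Suc n) \<and> ball z (1 / Suc n) \<subseteq> U"
        using z(2) e(2) by auto
      moreover have "ball z (1 / Suc n) \<in> \<N> \<A>" using z(1) by (auto simp: \<N>_def V_def)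
      ultimately show "\<exists>N\<in>\<N> \<A>. x \<in> N \<and> N \<subseteq> U" by blast
    qed simp
    ultimately show ?thesis by blast
  qed
  then have "\<exists>\<rho>. \<forall>\<A>\<in>countable_subsets \<F>. continuous_retraction (sigma_top D) (\<rho> \<A>) \<and> (\<forall>F\<in>\<A>. \<rho> \<A> ` F \<subseteq> F) \<and>
      countable (\<N> \<A>) \<and> outer_network (sigma_top D) (\<rho> \<A> ` topspace (sigma_top D)) (\<N> \<A>)"
    by (intro bchoice ballI)
  ultimately show ?thesis
    unfolding monotonically_Sokolov_def Let_def \<F>_def by blast
qed

end

lemma induced_by_skeleton_imp_monotonically_Sokolov:
  assumes "induced_by_skeleton TYPE('i) smul D"
  shows "weak_star_countably_closed smul D \<and> monotonically_Sokolov (sigma_top D)"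
proof -
  obtain \<Gamma> :: "'i set" and r P where "projectional_skeleton smul \<Gamma> r P" "D = induced_subspace smul \<Gamma> P"
    using assms unfolding induced_by_skeleton_def by blast
  then show ?thesis
    using skeleton_countably_closed skeleton_monotonically_Sokolov by blast
qed

section \<open>Recovering the dual pairs from a monotonically Sokolov space\<close>

text \<open>
  The weak-star counterpart of \<open>closure_subspace_of_dense_combinations\<close>. The factor \<open>q\<close> is chosen after the
  approximating functional, as its precision depends on the size of that functional on \<open>J\<close>.
\<close>

lemma linear_space_weak_star_closure:
  assumes Bd: "B \<subseteq> dual smul" and "(\<lambda>_. 0) \<in> B"
    and add: "\<And>f g. f \<in> B \<Longrightarrow> g \<in> B \<Longrightarrow> (\<lambda>x. f x + g x) \<in> B"
    and mult: "\<And>q f. q \<in> dense_scalars \<Longrightarrow> f \<in> B \<Longrightarrow> (\<lambda>x. q * f x) \<in> B"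
  shows "linear_space (weak_star smul closure_of B)"
  unfolding linear_space_def
proof (intro conjI ballI allI)
  note cl = weak_star_closure[OF Bd]
  have "B \<subseteq> weak_star smul closure_of B" using Bd by (intro closure_of_subset) simp
  then show "(\<lambda>_. 0) \<in> weak_star smul closure_of B" using assms(2) by blast
  fix f assume f: "f \<in> weak_star smul closure_of B"
  then have fd: "f \<in> dual smul" by (simp add: cl)
  have fa: "\<exists>g\<in>B. \<forall>x\<in>J. dist (g x) (f x) < e" if "finite J" "e > 0" for J e
    using f that by (simp add: cl)
  {
    fix g assume g: "g \<in> weak_star smul closure_of B"
    then have gd: "g \<in> dual smul" by (simp add: cl)
    have ga: "\<exists>h\<in>B. \<forall>x\<in>J. dist (h x) (g x) < e" if "finite J" "e > 0" for J e
      using g that by (simp add: cl)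
    have "(\<lambda>x. f x + g x) \<in> dual smul"
      using linear_space_dual fd gd by (simp add: linear_space_def)
    moreover have "\<exists>h\<in>B. \<forall>x\<in>J. dist (h x) (f x + g x) < e" if J: "finite J" "e > 0" for J e
    proof -
      have "e / 2 > 0" using J by simp
      obtain f' where f': "f' \<in> B" "\<forall>x\<in>J. dist (f' x) (f x) < e / 2"
        using fa[OF J(1) \<open>e / 2 > 0\<close>] by blast
      obtain g' where g': "g' \<in> B" "\<forall>x\<in>J. dist (g' x) (g x) < e / 2"
        using ga[OF J(1) \<open>e / 2 > 0\<close>] by blast
      have "dist (f' x + g' x) (f x + g x) < e" if "x \<in> J" for x
        using dist_triangle_add[of "f' x" "g' x" "f x" "g x"] f'(2) g'(2) that by fastforce
      then show ?thesis by (intro bexI[OF _ add[OF f'(1) g'(1)]] ballI)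
    qed
    ultimately show "(\<lambda>x. f x + g x) \<in> weak_star smul closure_of B" by (simp add: cl)
  }
  fix c
  have "(\<lambda>x. c * f x) \<in> dual smul"
    using linear_space_dual fd by (simp add: linear_space_def)
  moreover have "\<exists>h\<in>B. \<forall>x\<in>J. dist (h x) (c * f x) < e" if J: "finite J" "e > 0" for J e
  proof -
    have c1: "norm c + 1 > 0" using norm_ge_zero[of c] by linarith
    then have "e / (2 * (norm c + 1)) > 0" using J by simp
    then obtain g where g: "g \<in> B" "\<forall>x\<in>J. dist (g x) (f x) < e / (2 * (norm c + 1))"
      using fa[OF J(1)] by blast
    define K where "K = (\<Sum>x\<in>J. norm (g x)) + 1"
    have K: "K > 0" by (simp add: K_def sum_nonneg add_nonneg_pos)
    then have "e / (2 * K) > 0" using J by simp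
    then obtain q where q: "q \<in> dense_scalars" "dist q c < e / (2 * K)"
      using dense_scalars_approx by blast
    have "dist (q * g x) (c * f x) < e" if x: "x \<in> J" for x
    proof -
      have "q * g x - c * f x = (q - c) * g x + c * (g x - f x)" by (simp add: algebra_simps)
      then have "dist (q * g x) (c * f x) \<le> norm (q - c) * norm (g x) + norm c * norm (g x - f x)"
        by (metis dist_norm norm_mult norm_triangle_ineq)
      also have "\<dots> \<le> norm (q - c) * K + (norm c + 1) * norm (g x - f x)"
      proof (intro add_mono mult_left_mono mult_right_mono)
        have "norm (g x) \<le> (\<Sum>x\<in>J. norm (g x))" using J(1) x by (intro member_le_sum) auto
        then show "norm (g x) \<le> K" by (simp add: K_def)
      qed auto
      also have "norm (q - c) * K < e / 2"
        using q(2) K by (simp add: dist_norm field_simps)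
      also have "(norm c + 1) * norm (g x - f x) < e / 2"
        using g(2) x c1 by (simp add: dist_norm field_simps)
      finally show ?thesis by simp
    qed
    then show ?thesis by (intro bexI[OF _ mult[OF q(1) g(1)]] ballI)
  qed
  ultimately show "(\<lambda>x. c * f x) \<in> weak_star smul closure_of B" by (simp add: cl)
qed

lemma dual_eq_on_closed_span:
  assumes f: "f \<in> dual smul" and "closed_span smul S = UNIV" "\<And>x. x \<in> S \<Longrightarrow> f x = 0"
  shows "f = (\<lambda>_. 0)"
proof -
  have "S \<subseteq> annihilator {f}" using assms(3) by (auto simp: annihilator_def)
  then have "span S \<subseteq> annihilator {f}" using f by (intro span_minimal subspace_annihilator) auto
  then have "closed_span smul S \<subseteq> annihilator {f}"
    using f by (intro closure_minimal closed_annihilator) auto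
  then show ?thesis using assms(2) by (auto simp: annihilator_def)
qed

text \<open>
  The mapping is the closure under linear combinations with dense scalars, under norming
  functionals of vectors, and under the images of one point from every set of the networks that belong
  to finite sets of functionals.
\<close>

lemma monotonically_Sokolov_image_imp_monotone_dual_pairs:
  fixes T :: "'t topology" and \<phi> :: "'t \<Rightarrow> 'a"
  assumes Dd: "D \<subseteq> dual smul" and Dl: "linear_space D" and C: "norms_up_to C D"
    and wcc: "weak_star_countably_closed smul D"
    and T: "monotonically_Sokolov T"
    and \<phi>: "continuous_map T (sigma_top D) \<phi>"
    and total: "closed_span smul (\<phi> ` topspace T) = UNIV"
  shows "monotone_dual_pairs D"
proof -
  define \<F> where "\<F> = {F. closedin T F \<and> F \<noteq> {}}"
  have "\<exists>(\<rho> :: 't set set \<Rightarrow> 't \<Rightarrow> 't) \<N>.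
      (\<forall>\<A>\<in>countable_subsets \<F>. continuous_retraction T (\<rho> \<A>) \<and> (\<forall>F\<in>\<A>. \<rho> \<A> ` F \<subseteq> F) \<and>
        countable (\<N> \<A>) \<and> outer_network T (\<rho> \<A> ` topspace T) (\<N> \<A>)) \<and>
      omega_monotone \<F> (Pow (topspace T)) \<N>"
    using T unfolding monotonically_Sokolov_def Let_def \<F>_def .
  then obtain \<rho> :: "'t set set \<Rightarrow> 't \<Rightarrow> 't" and \<N>
    where retr: "\<forall>\<A>\<in>countable_subsets \<F>. continuous_retraction T (\<rho> \<A>) \<and> (\<forall>F\<in>\<A>. \<rho> \<A> ` F \<subseteq> F) \<and>
        countable (\<N> \<A>) \<and> outer_network T (\<rho> \<A> ` topspace T) (\<N> \<A>)"
      and \<N>: "omega_monotone \<F> (Pow (topspace T)) \<N>"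
    by (elim exE conjE) (rule that)
  have ret: "continuous_retraction T (\<rho> \<A>)" and net: "outer_network T (\<rho> \<A> ` topspace T) (\<N> \<A>)"
    and inv: "F \<in> \<A> \<Longrightarrow> \<rho> \<A> ` F \<subseteq> F" if "\<A> \<in> countable_subsets \<F>" for \<A> F
    using bspec[OF retr that] by simp_all
  have cont: "continuous_map T euclidean (\<lambda>t. f (\<phi> t))" if "f \<in> D" for f
    using continuous_map_compose[OF \<phi> continuous_map_from_initial_topology[OF that]] by (simp add: comp_def)
  \<comment> \<open>Preservation of all these closed discs forces \<open>f \<circ> \<phi>\<close> to be unchanged by the retraction.\<close>
  define disc where "disc f q n = {t\<in>topspace T. f (\<phi> t) \<in> cball q (1 / Suc n)}"
    for f :: "'a \<Rightarrow> 'k" and q n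
  define a where "a f = (\<Union>q\<in>dense_scalars. range (disc f q)) - {{}}" for f
  have a: "a f \<in> countable_subsets \<F>" if "f \<in> D" for f
  proof -
    have "closedin T (disc f q n)" for q n
      unfolding disc_def using closedin_continuous_map_preimage[OF cont[OF that], of "cball q (1 / Suc n)"] by simp
    then show ?thesis
      using countable_dense_scalars by (auto simp: countable_subsets_def a_def \<F>_def)
  qed
  define Nf where "Nf S = \<N> (\<Union>f\<in>S. a f)" for S
  have Nf: "omega_monotone D (Pow (topspace T)) Nf"
    unfolding Nf_def by (rule omega_monotone_UN_index[OF \<N> a])
  have "\<forall>x k. \<exists>f\<in>unit_ball D. norm x \<le> C * norm (f x) + 1 / Suc k"
    using C by (simp add: norms_up_to_def)
  then obtain nf where nf: "\<And>x k. nf x k \<in> unit_ball D" "\<And>x k. norm x \<le> C * norm (nf x k x) + 1 / Suc k"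
    by metis
  define pt where "pt N = (SOME t. t \<in> N)" for N :: "'t set"
  define c :: "(('a \<Rightarrow> 'k) + 'a) set \<Rightarrow> (('a \<Rightarrow> 'k) + 'a) set" where "c F = {Inl (\<lambda>_. 0), Inr 0} \<union>
      (\<Union>f\<in>functional_part F. (\<lambda>g. Inl (\<lambda>x. f x + g x)) ` functional_part F) \<union>
      (\<Union>q\<in>dense_scalars. (\<lambda>f. Inl (\<lambda>x. q * f x)) ` functional_part F) \<union>
      (\<Union>x\<in>vector_part F. (\<lambda>y. Inr (x + y)) ` vector_part F) \<union>
      (\<Union>q\<in>dense_scalars. (\<lambda>x. Inr (smul q x)) ` vector_part F) \<union>
      (\<Union>x\<in>vector_part F. range (\<lambda>k. Inl (nf x k))) \<union>
      Inr ` \<phi> ` pt ` Nf (functional_part F)" for F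
  have cM: "c F \<in> countable_subsets (D <+> UNIV)" if F: "finite F" "F \<subseteq> D <+> UNIV" for F
  proof -
    have fin: "finite (functional_part F)" "finite (vector_part F)"
      using F(1) by (auto intro!: finite_vimageI)
    have FD: "functional_part F \<subseteq> D" using F(2) by auto
    have "functional_part F \<in> countable_subsets D"
      using FD fin by (simp add: countable_subsets_def countable_finite)
    then have "countable (Nf (functional_part F))"
      using omega_monotone_countable[OF Nf] by (simp add: countable_subsets_def)
    then have "countable (c F)"
      unfolding c_def using fin countable_dense_scalars
      by (intro countable_Un countable_UN countable_image) (auto intro: countable_finite)
    moreover have "c F \<subseteq> D <+> UNIV"
    proof -
      have m1: "{Inl (\<lambda>_. 0), Inr 0} \<subseteq> D <+> UNIV"
        using Dl by (auto simp: linear_space_def)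
      have m2: "(\<lambda>g. Inl (\<lambda>x. f x + g x)) ` functional_part F \<subseteq> D <+> UNIV"
        if "f \<in> functional_part F" for f
      proof (intro image_subsetI InlI)
        fix g assume "g \<in> functional_part F"
        then have "f \<in> D" "g \<in> D" using that FD by blast+
        then show "(\<lambda>x. f x + g x) \<in> D" using Dl unfolding linear_space_def by simp
      qed
      have m3: "(\<lambda>f. Inl (\<lambda>x. q * f x)) ` functional_part F \<subseteq> D <+> UNIV" for q
      proof (intro image_subsetI InlI)
        fix f assume "f \<in> functional_part F"
        then have "f \<in> D" using FD by blast
        then show "(\<lambda>x. q * f x) \<in> D" using Dl unfolding linear_space_def by simp
      qed
      have m4: "range (\<lambda>k. Inl (nf x k)) \<subseteq> D <+> UNIV" for x
        using nf(1) by (intro image_subsetI InlI) (simp add: unit_ball_def)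
      have m5: "Inr ` S \<subseteq> D <+> UNIV" "(\<lambda>y. Inr (h y)) ` S' \<subseteq> D <+> UNIV"
        for S :: "'a set" and S' :: "'a set" and h :: "'a \<Rightarrow> 'a" by auto
      show ?thesis
        unfolding c_def by (intro Un_least UN_least m1 m2 m3 m4 m5) assumption
    qed
    ultimately show ?thesis by (simp add: countable_subsets_def)
  qed
  have main: "functional_closure B \<subseteq> D \<and> dual_pair B"
    if cB: "B \<in> countable_subsets (D <+> UNIV)" and cl: "\<And>F. finite F \<Longrightarrow> F \<subseteq> B \<Longrightarrow> c F \<subseteq> B" for B
  proof -
    define Bd where "Bd = functional_part B"
    define Bv where "Bv = vector_part B"
    define E where "E = weak_star smul closure_of Bd"
    define Y where "Y = closed_span smul Bv"
    have BdD: "Bd \<subseteq> D" using cB by (auto simp: Bd_def countable_subsets_def)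
    then have Bdd: "Bd \<subseteq> dual smul" using Dd by blast
    have cBd: "Bd \<in> countable_subsets D"
      using BdD cB countable_inj_vimage[of B Inl] by (auto simp: Bd_def countable_subsets_def)
    have "(\<lambda>_. 0) \<in> Bd" "0 \<in> Bv" using cl[of "{}"] by (auto simp: c_def Bd_def Bv_def)
    have addB: "(\<lambda>x. f x + g x) \<in> Bd" if "f \<in> Bd" "g \<in> Bd" for f g
    proof -
      have "Inl (\<lambda>x. f x + g x) \<in> c {Inl f, Inl g}"
        unfolding c_def by (rule UnI1, rule UnI1, rule UnI1, rule UnI1, rule UnI1, rule UnI2, rule UN_I[of f], simp, rule imageI, simp)
      then show ?thesis using cl[of "{Inl f, Inl g}"] that by (auto simp: Bd_def)
    qed
    have multB: "(\<lambda>x. q * f x) \<in> Bd" if "q \<in> dense_scalars" "f \<in> Bd" for q f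
    proof -
      have "Inl (\<lambda>x. q * f x) \<in> c {Inl f}"
        unfolding c_def by (rule UnI1, rule UnI1, rule UnI1, rule UnI1, rule UnI2, rule UN_I[OF that(1)], rule imageI, simp)
      then show ?thesis using cl[of "{Inl f}"] that by (auto simp: Bd_def)
    qed
    have addv: "x + y \<in> Bv" if "x \<in> Bv" "y \<in> Bv" for x y
    proof -
      have "Inr (x + y) \<in> c {Inr x, Inr y}"
        unfolding c_def by (rule UnI1, rule UnI1, rule UnI1, rule UnI2, rule UN_I[of x], simp, rule imageI, simp)
      then show ?thesis using cl[of "{Inr x, Inr y}"] that by (auto simp: Bv_def)
    qed
    have multv: "smul q x \<in> Bv" if "q \<in> dense_scalars" "x \<in> Bv" for q x
    proof -
      have "Inr (smul q x) \<in> c {Inr x}"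
        unfolding c_def by (rule UnI1, rule UnI1, rule UnI2, rule UN_I[OF that(1)], rule imageI, simp)
      then show ?thesis using cl[of "{Inr x}"] that by (auto simp: Bv_def)
    qed
    have nfB: "nf x k \<in> Bd" if "x \<in> Bv" for x k
    proof -
      have "Inl (nf x k) \<in> c {Inr x}"
        unfolding c_def by (rule UnI1, rule UnI2, rule UN_I[of x], simp, rule rangeI)
      then show ?thesis using cl[of "{Inr x}"] that by (auto simp: Bv_def Bd_def)
    qed
    have ptB: "\<phi> (pt N) \<in> Bv" if N: "N \<in> Nf Bd" for N
    proof -
      obtain F where F: "finite F" "F \<subseteq> Bd" "N \<in> Nf F"
        using omega_monotone_finite_support[OF Nf cBd N] by blast
      have "functional_part (Inl ` F :: (('a \<Rightarrow> 'k) + 'a) set) = F" by auto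
      then have "Inr (\<phi> (pt N)) \<in> c (Inl ` F)" using F(3) unfolding c_def by auto
      moreover have "c (Inl ` F) \<subseteq> B" using F by (intro cl) (auto simp: Bd_def)
      ultimately show ?thesis by (auto simp: Bv_def)
    qed
    have Y: "Y = closure Bv"
      unfolding Y_def using \<open>0 \<in> Bv\<close> addv multv by (rule closure_eq_closed_span[symmetric])
    have sY: "subspace Y" unfolding Y_def by (rule subspace_closed_span)
    have BvY: "Bv \<subseteq> Y" unfolding Y by (rule closure_subset)
    have BdE: "Bd \<subseteq> E" unfolding E_def using Bdd by (intro closure_of_subset) simp
    have ED: "E \<subseteq> D"
      using wcc BdD cBd unfolding weak_star_countably_closed_def E_def by (auto simp: countable_subsets_def)
    have Ec: "closedin (weak_star smul) E" unfolding E_def by simp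
    have El: "linear_space E"
      unfolding E_def using Bdd \<open>(\<lambda>_. 0) \<in> Bd\<close> addB multB by (rule linear_space_weak_star_closure)
    \<comment> \<open>Surjectivity: \<open>E\<close> norms \<open>Y\<close>, because near-optimal functionals of the dense vectors \<open>Bv\<close> are in \<open>Bd\<close>.\<close>
    have onto: "\<exists>e\<in>E. \<forall>y\<in>Y. e y = g y" if g: "g \<in> dual_on smul Y" for g
    proof -
      obtain K where K: "\<And>y. y \<in> Y \<Longrightarrow> norm (g y) \<le> K * norm y"
        using g unfolding dual_on_def by blast
      have C1: "C \<ge> 1" using C by (simp add: norms_up_to_def)
      have "\<exists>e\<in>unit_ball E. norm y \<le> C * norm (e y) + d" if y: "y \<in> Y" and d: "d > 0" for y d
      proof -
        define \<eta> where "\<eta> = d / (2 * (C + 1))"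
        have \<eta>: "\<eta> > 0" using d C1 by (simp add: \<eta>_def)
        then obtain x where x: "x \<in> Bv" "dist x y < \<eta>"
          using y unfolding Y closure_approachable by blast
        have "d / 2 > 0" using d by simp
        then obtain k where k: "inverse (real (Suc k)) < d / 2" using reals_Archimedean by blast
        define e where "e = nf x k"
        have eB: "e \<in> Bd" using nfB[OF x(1)] by (simp add: e_def)
        have e1: "norm (e v) \<le> norm v" for v using nf(1)[of x k] by (simp add: e_def unit_ball_def)
        have "e x = e y + e (x - y)"
          using dual_diff[of e x y] Bdd eB by auto
        then have "norm (e x) \<le> norm (e y) + norm (x - y)"
          using norm_triangle_ineq[of "e y" "e (x - y)"] e1[of "x - y"] by simp
        then have "norm (e x) \<le> norm (e y) + \<eta>" using x(2) by (simp add: dist_norm)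
        then have "C * norm (e x) \<le> C * norm (e y) + C * \<eta>"
          using C1 mult_left_mono[of "norm (e x)" "norm (e y) + \<eta>" C] by (simp add: algebra_simps)
        moreover have "norm y \<le> norm x + \<eta>"
          using x(2) norm_triangle_ineq4[of x "x - y"] by (simp add: dist_norm)
        moreover have "norm x \<le> C * norm (e x) + 1 / Suc k" using nf(2)[of x k] by (simp add: e_def)
        moreover have "1 / Suc k < d / 2" using k by (simp add: inverse_eq_divide)
        moreover have "C * \<eta> + \<eta> = d / 2"
        proof -
          have "(C + 1) * (2 * \<eta>) = d" using C1 by (simp add: \<eta>_def field_simps)
          then show ?thesis by (simp add: algebra_simps)
        qed
        ultimately have "norm y \<le> C * norm (e y) + d" by linarith
        moreover have "e \<in> unit_ball E" using eB BdE e1 by (auto simp: unit_ball_def)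
        ultimately show ?thesis by blast
      qed
      moreover have "C > 0" using C1 by simp
      ultimately show ?thesis
        using extension[OF Ec El sY, of C g K] g K by (simp add: dual_on_def)
    qed
    define \<A> where "\<A> = (\<Union>f\<in>Bd. a f)"
    have \<A>: "\<A> \<in> countable_subsets \<F>"
      using a BdD cBd unfolding \<A>_def countable_subsets_def by (auto intro!: countable_UN)
    define \<rho>' where "\<rho>' = \<rho> \<A>"
    have \<rho>T: "\<rho>' t \<in> topspace T" if "t \<in> topspace T" for t
      using ret[OF \<A>] that unfolding continuous_retraction_def \<rho>'_def continuous_map_def by auto
    have fixB: "f (\<phi> (\<rho>' t)) = f (\<phi> t)" if f: "f \<in> Bd" and t: "t \<in> topspace T" for f t
    proof (rule ccontr)
      assume "f (\<phi> (\<rho>' t)) \<noteq> f (\<phi> t)"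
      then have "dist (f (\<phi> (\<rho>' t))) (f (\<phi> t)) / 2 > 0" by simp
      then obtain n where n: "inverse (real (Suc n)) < dist (f (\<phi> (\<rho>' t))) (f (\<phi> t)) / 2"
        using reals_Archimedean by blast
      obtain q where q: "q \<in> dense_scalars" "dist q (f (\<phi> t)) < 1 / Suc n"
        using dense_scalars_approx[of "1 / Suc n" "f (\<phi> t)"] by auto
      have "t \<in> disc f q n" using t q(2) by (simp add: disc_def)
      then have "disc f q n \<in> \<A>" using f q(1) by (auto simp: \<A>_def a_def)
      then have "\<rho>' t \<in> disc f q n" using inv[OF \<A>] \<open>t \<in> disc f q n\<close> unfolding \<rho>'_def by blast
      then have "dist q (f (\<phi> (\<rho>' t))) \<le> 1 / Suc n" by (simp add: disc_def)
      then have "dist (f (\<phi> (\<rho>' t))) (f (\<phi> t)) < 2 * (1 / Suc n)"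
        using dist_triangle3[of "f (\<phi> (\<rho>' t))" "f (\<phi> t)" q] q(2) by linarith
      then show False using n by (simp add: inverse_eq_divide)
    qed
    have fixE: "f (\<phi> (\<rho>' t)) = f (\<phi> t)" if f: "f \<in> E" and t: "t \<in> topspace T" for f t
    proof (rule ccontr)
      define e where "e = dist (f (\<phi> (\<rho>' t))) (f (\<phi> t)) / 2"
      assume "f (\<phi> (\<rho>' t)) \<noteq> f (\<phi> t)"
      then have e: "e > 0" by (simp add: e_def)
      have "\<exists>g\<in>Bd. \<forall>x\<in>{\<phi> (\<rho>' t), \<phi> t}. dist (g x) (f x) < e"
        using f[unfolded E_def weak_star_closure[OF Bdd], THEN conjunct2, rule_format,
            of "{\<phi> (\<rho>' t), \<phi> t}" e] e by simp
      then obtain g where g: "g \<in> Bd" "dist (g (\<phi> (\<rho>' t))) (f (\<phi> (\<rho>' t))) < e" "dist (g (\<phi> t)) (f (\<phi> t)) < e"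
        by auto
      then show False
        using fixB[OF g(1) t] dist_triangle3[of "f (\<phi> (\<rho>' t))" "f (\<phi> t)" "g (\<phi> t)"] by (simp add: e_def)
    qed
    \<comment> \<open>Injectivity: if \<open>f\<close> is nonzero at \<open>\<phi> t\<close>, it is nonzero on some network set around \<open>\<rho>' t\<close>, in particular at its chosen point, whose image is in \<open>Y\<close>.\<close>
    have inj0: "f = (\<lambda>_. 0)" if f: "f \<in> E" and f0: "\<And>y. y \<in> Y \<Longrightarrow> f y = 0" for f
    proof (rule dual_eq_on_closed_span[OF _ total])
      show "f \<in> dual smul" using f ED Dd by blast
      fix x assume "x \<in> \<phi> ` topspace T"
      then obtain t where t: "t \<in> topspace T" "x = \<phi> t" by blast
      show "f x = 0"
      proof (rule ccontr)
        assume "f x \<noteq> 0"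
        then have nz: "f (\<phi> (\<rho>' t)) \<noteq> 0" using fixE[OF f t(1)] t(2) by simp
        define U where "U = {t\<in>topspace T. f (\<phi> t) \<in> - {0}}"
        have "openin T U"
          unfolding U_def using f ED by (intro openin_continuous_map_preimage[OF cont]) auto
        moreover have "\<rho>' t \<in> U \<inter> \<rho>' ` topspace T" using nz t(1) \<rho>T by (auto simp: U_def)
        ultimately obtain N where N: "N \<in> \<N> \<A>" "\<rho>' t \<in> N" "N \<subseteq> U"
          using net[OF \<A>] unfolding outer_network_def \<rho>'_def by blast
        have "pt N \<in> N" unfolding pt_def using N(2) by (rule someI)
        then have "f (\<phi> (pt N)) \<noteq> 0" using N(3) by (auto simp: U_def)
        moreover have "N \<in> Nf Bd" using N(1) by (simp add: Nf_def \<A>_def)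
        ultimately show False using f0 ptB BvY by blast
      qed
    qed
    have "bij_betw (\<lambda>f. restrict f Y) E (dual_on smul Y)"
      unfolding bij_betw_def
    proof (intro conjI inj_onI equalityI subsetI)
      fix f g assume fg: "f \<in> E" "g \<in> E" "restrict f Y = restrict g Y"
      have "f y = g y" if "y \<in> Y" for y using fg(3) that by (metis restrict_apply')
      then have "(\<lambda>x. f x - g x) = (\<lambda>_. 0)"
        using linear_space_diff[OF El fg(1,2)] by (intro inj0) auto
      then show "f = g" by (simp add: fun_eq_iff)
    next
      fix h assume "h \<in> (\<lambda>f. restrict f Y) ` E"
      then show "h \<in> dual_on smul Y" using restrict_dual[OF sY] ED Dd by blast
    next
      fix h assume h: "h \<in> dual_on smul Y"
      then obtain e where e: "e \<in> E" "\<forall>y\<in>Y. e y = h y" using onto by blast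
      have "h \<in> extensional Y" using h by (simp add: dual_on_def)
      then have "restrict e Y = h"
        using e(2) by (intro extensionalityI[of _ Y]) auto
      then show "h \<in> (\<lambda>f. restrict f Y) ` E" using e(1) by blast
    qed
    then show ?thesis
      using ED El unfolding dual_pair_def E_def Y_def Bd_def Bv_def by blast
  qed
  have gen: "A \<subseteq> generated c A \<and> functional_closure (generated c A) \<subseteq> D \<and> dual_pair (generated c A)"
    if "A \<in> countable_subsets (D <+> UNIV)" for A
  proof (intro conjI generated_superset)
    have "generated c A \<in> countable_subsets (D <+> UNIV)"
      using cM that by (rule generated_countable)
    from main[OF this generated_closed]
    show "functional_closure (generated c A) \<subseteq> D" "dual_pair (generated c A)" by auto
  qed
  have "omega_monotone (D <+> UNIV) (D <+> UNIV) (generated c)"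
    using cM by (rule omega_monotone_generated)
  then show ?thesis
    unfolding monotone_dual_pairs_def by (intro exI[of _ "generated c"] conjI ballI gen)
qed

lemma image_of_monotonically_Sokolov_imp_monotone_dual_pairs:
  assumes "D \<subseteq> dual smul" "linear_space D" "norms_up_to C D" "weak_star_countably_closed smul D"
    and "image_of_monotonically_Sokolov TYPE('t) (sigma_top D)"
  shows "monotone_dual_pairs D"
proof -
  obtain T :: "'t topology" and f where T: "monotonically_Sokolov T"
    and f: "continuous_map T (sigma_top D) f" "f ` topspace T = topspace (sigma_top D)"
    using assms(5) unfolding image_of_monotonically_Sokolov_def by blast
  have "closed_span smul (f ` topspace T) = UNIV" by (simp add: f(2))
  then show ?thesis
    by (rule monotonically_Sokolov_image_imp_monotone_dual_pairs[OF assms(1-4) T f(1)])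
qed

end

section \<open>The equivalence\<close>

theorem theorem4p1:
  fixes smul :: "'k::real_or_complex \<Rightarrow> 'a::banach \<Rightarrow> 'a"
    and D :: "('a \<Rightarrow> 'k) set"
  assumes "banach_over smul"
    and "D \<subseteq> dual smul" and "linear_space D" and "norming D"
  defines "assertion1 \<equiv> induced_by_skeleton TYPE('a set) smul D"
    and "assertion2 \<equiv>
      (\<exists>\<psi>. omega_monotone (D <+> UNIV) (D <+> UNIV) \<psi> \<and>
        (\<forall>A \<in> countable_subsets (D <+> UNIV).
           let E = weak_star smul closure_of functional_part (\<psi> A);
               Y = closed_span smul (vector_part (\<psi> A))
           in A \<subseteq> \<psi> A \<and> E \<subseteq> D \<and> linear_space E \<and>
              bij_betw (\<lambda>f. restrict f Y) E (dual_on smul Y)))"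
    and "assertion3 \<equiv>
      (\<exists>\<theta>. omega_monotone (UNIV :: 'a set) (D <+> UNIV) \<theta> \<and>
        D = (\<Union>A \<in> countable_subsets UNIV. weak_star smul closure_of functional_part (\<theta> A)) \<and>
        (\<forall>A \<in> countable_subsets UNIV.
           let E = weak_star smul closure_of functional_part (\<theta> A);
               Y = closed_span smul (vector_part (\<theta> A))
           in Inr ` A \<subseteq> \<theta> A \<and> linear_space E \<and>
              bij_betw (\<lambda>f. restrict f Y) E (dual_on smul Y)))"
    and "assertion4 \<equiv>
      weak_star_countably_closed smul D \<and> monotonically_Sokolov (sigma_top D)"
    and "assertion5 \<equiv>
      weak_star_countably_closed smul D \<and>
      (\<exists>M. closed_span smul M = UNIV \<and> monotonically_Sokolov (subtopology (sigma_top D) M))"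
    and "assertion6 \<equiv>
      weak_star_countably_closed smul D \<and>
      image_of_monotonically_Sokolov TYPE('a) (sigma_top D)"
  shows "(assertion1 \<longleftrightarrow> assertion2) \<and> (assertion1 \<longleftrightarrow> assertion3) \<and>
    (assertion1 \<longleftrightarrow> assertion4) \<and> (assertion1 \<longleftrightarrow> assertion5) \<and> (assertion1 \<longleftrightarrow> assertion6) \<and>
    (induced_by_skeleton TYPE('i) smul D \<longrightarrow> assertion1) \<and>
    (weak_star_countably_closed smul D \<and>
       image_of_monotonically_Sokolov TYPE('t) (sigma_top D) \<longrightarrow> assertion6)"
proof -
  interpret banach_over smul by fact
  obtain C where C: "norms_up_to C D"
    using norming_imp_norms_up_to[OF assms(2-4)] by blast
  then have C': "norms_up_to C (dual smul)" using assms(2) by (rule norms_up_to_mono)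
  have a2: "assertion2 \<longleftrightarrow> monotone_dual_pairs D"
    unfolding assertion2_def monotone_dual_pairs_def dual_pair_def Let_def ..
  have a3: "assertion3 \<longleftrightarrow> monotone_dual_pairs_over_vectors D"
    unfolding assertion3_def monotone_dual_pairs_over_vectors_def dual_pair_def Let_def ..
  have 23: "assertion2 \<Longrightarrow> assertion3"
    unfolding a2 a3 by (rule monotone_dual_pairs_imp_monotone_dual_pairs_over_vectors[OF assms(2)])
  have 31: "assertion3 \<Longrightarrow> assertion1"
    unfolding a3 assertion1_def by (rule monotone_dual_pairs_over_vectors_imp_skeleton[OF C'])
  have 14: "assertion1 \<Longrightarrow> assertion4"
    unfolding assertion1_def assertion4_def by (rule induced_by_skeleton_imp_monotonically_Sokolov)
  have 45: "assertion4 \<Longrightarrow> assertion5"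
    unfolding assertion4_def assertion5_def by (auto intro!: exI[of _ UNIV])
  have 46: "assertion4 \<Longrightarrow> assertion6"
    unfolding assertion4_def assertion6_def image_of_monotonically_Sokolov_def
    by (auto intro!: exI[of _ "sigma_top D"] exI[of _ "\<lambda>x. x"])
  have 52: "assertion5 \<Longrightarrow> assertion2"
  proof -
    assume "assertion5"
    then obtain M where M: "weak_star_countably_closed smul D" "closed_span smul M = UNIV"
      "monotonically_Sokolov (subtopology (sigma_top D) M)"
      unfolding assertion5_def by blast
    have "continuous_map (subtopology (sigma_top D) M) (sigma_top D) (\<lambda>x. x)"
      using continuous_map_from_subtopology[OF continuous_map_id, of "sigma_top D" M] by (simp add: id_def)
    then show assertion2
      unfolding a2 using M(2)
      by (intro monotonically_Sokolov_image_imp_monotone_dual_pairs[OF assms(2,3) C M(1,3), of "\<lambda>x. x"]) simp_all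
  qed
  have 62: "assertion6 \<Longrightarrow> assertion2"
    unfolding assertion6_def a2
    using image_of_monotonically_Sokolov_imp_monotone_dual_pairs[OF assms(2,3) C] by blast
  have i1: "assertion1" if "induced_by_skeleton TYPE('i) smul D"
    using induced_by_skeleton_imp_monotonically_Sokolov[OF that] 45 52 23 31
    unfolding assertion4_def by blast
  have t6: "assertion6"
    if "weak_star_countably_closed smul D \<and> image_of_monotonically_Sokolov TYPE('t) (sigma_top D)"
    using image_of_monotonically_Sokolov_imp_monotone_dual_pairs[OF assms(2,3) C] that 23 31 14 46
    unfolding a2 by blast
  show ?thesis
    using 14 45 46 52 62 23 31 i1 t6 by blast
qed

end
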